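(* Let $(\mathcal{X}_1,\mathcal{X}_2,p(y_2|x_1)p(y_3|x_1,x_2,y_2),\mathcal{Y}_2,\mathcal{Y}_3)$ be a discrete memoryless noncausal relay channel that is degraded, i.e., $p(y_3|x_1,x_2,y_2)=p(y_3|x_2,y_2)$ for all $(x_1,x_2,y_2,y_3)$. Then its capacity is \[ C_{\infty} = \max \min \{I(X_1;Y_2),\; I(X_1,U;Y_3)-I(Y_2;U|X_1)\}, \] where the maximum is over all pmfs $p(x_1)p(u|x_1,y_2)$ (with $U$ taking values in a finite set) and all functions $x_2(u,x_1,y_2)$, and the mutual informations are evaluated under the joint distribution $p(x_1)p(y_2|x_1)p(u|x_1,y_2)\mathbf{1}\{x_2=x_2(u,x_1,y_2)\}p(y_3|x_2,y_2)$.
   Context: A discrete memoryless (DM) noncausal relay channel consists of finite alphabets $\mathcal{X}_1,\mathcal{X}_2,\mathcal{Y}_2,\mathcal{Y}_3$ and conditional pmfs $p(y_2|x_1)$ and $p(y_3|x_1,x_2,y_2)$; the sender inputs $X_1$, the relay observes $Y_2$ and inputs $X_2$, the receiver observes $Y_3$. It is memoryless: $p(y_{2i}|x_1^i,y_2^{i-1},m)=p(y_{2i}|x_{1i})$ and $p(y_{3i}|x_1^i,x_2^i,y_2^i,y_3^{i-1},m)=p(y_{3i}|x_{1i},x_{2i},y_{2i})$. A $(2^{nR},n)$ code consists of a message set $[1:2^{nR}]$, an encoder assigning a codeword $x_1^n(m)$ to each message $m$, a relay encoder assigning a symbol $x_{2i}(y_2^n)$ for each $i\in[1:n]$ as a function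 of the entire received sequence $y_2^n$ (noncausal, i.e., unlimited lookahead), and a decoder assigning an estimate $\hat m(y_3^n)$ or an error. The message $M$ is uniform over $[1:2^{nR}]$, the error probability is $P_e^{(n)}=\mathbb{P}\{\hat M\neq M\}$, a rate $R$ is achievable if there is a sequence of $(2^{nR},n)$ codes with $P_e^{(n)}\to 0$, and the capacity $C_\infty$ is the supremum of achievable rates. *)

theory Defs
  imports Complex_Main
begin

definition relay_channel ::
  "('x1::finite \<Rightarrow> 'y2::finite \<Rightarrow> real) \<Rightarrow> ('x1 \<Rightarrow> 'x2::finite \<Rightarrow> 'y2 \<Rightarrow> 'y3::finite \<Rightarrow> real) \<Rightarrow> bool" where
  "relay_channel p2 p3 \<longleftrightarrow>
     (\<forall>x1 y2. 0 \<le> p2 x1 y2) \<and> (\<forall>x1. (\<Sum>y2\<in>UNIV. p2 x1 y2) = 1) \<and>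
     (\<forall>x1 x2 y2 y3. 0 \<le> p3 x1 x2 y2 y3) \<and> (\<forall>x1 x2 y2. (\<Sum>y3\<in>UNIV. p3 x1 x2 y2 y3) = 1)"

definition degraded ::
  "('x1 \<Rightarrow> 'x2 \<Rightarrow> 'y2 \<Rightarrow> 'y3 \<Rightarrow> real) \<Rightarrow> bool" where
  "degraded p3 \<longleftrightarrow> (\<exists>q. \<forall>x1 x2 y2 y3. p3 x1 x2 y2 y3 = q x2 y2 y3)"

text \<open>Number of messages of a (2^{nR}, n) code: the message set is [1 : 2^{nR}],
  i.e. {1, ..., ceiling (2^{nR})}.\<close>

definition num_msgs :: "real \<Rightarrow> nat \<Rightarrow> nat" where
  "num_msgs R n = nat \<lceil>(2::real) powr (real n * R)\<rceil>"

text \<open>A (2^{nR},n) code: encoder enc m (a word of length n for each message m),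
  relay encoder rel i y2s (the i-th relay symbol, i < n, a function of the
  whole received word y2s of length n: noncausal), decoder dec (None = error).
  Average error probability with M uniform on the message set.\<close>

definition err_prob ::
  "('x1::finite \<Rightarrow> 'y2::finite \<Rightarrow> real) \<Rightarrow> ('x1 \<Rightarrow> 'x2::finite \<Rightarrow> 'y2 \<Rightarrow> 'y3::finite \<Rightarrow> real) \<Rightarrow>
   nat \<Rightarrow> nat \<Rightarrow> (nat \<Rightarrow> 'x1 list) \<Rightarrow> (nat \<Rightarrow> 'y2 list \<Rightarrow> 'x2) \<Rightarrow> ('y3 list \<Rightarrow> nat option) \<Rightarrow> real"
  where
  "err_prob p2 p3 n M enc rel dec =
     (1 / real M) * (\<Sum>m\<in>{1..M}.
        \<Sum>y2s\<in>{ys. length ys = n}. \<Sum>y3s\<in>{ys. length ys = n}.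
          (\<Prod>i<n. p2 (enc m ! i) (y2s ! i)) *
          (\<Prod>i<n. p3 (enc m ! i) (rel i y2s) (y2s ! i) (y3s ! i)) *
          (if dec y3s = Some m then 0 else 1))"

definition is_code :: "nat \<Rightarrow> nat \<Rightarrow> (nat \<Rightarrow> 'x1 list) \<Rightarrow> bool" where
  "is_code n M enc \<longleftrightarrow> (\<forall>m\<in>{1..M}. length (enc m) = n)"

definition achievable ::
  "('x1::finite \<Rightarrow> 'y2::finite \<Rightarrow> real) \<Rightarrow> ('x1 \<Rightarrow> 'x2::finite \<Rightarrow> 'y2 \<Rightarrow> 'y3::finite \<Rightarrow> real) \<Rightarrow> real \<Rightarrow> bool"
  where
  "achievable p2 p3 R \<longleftrightarrow>
     (\<exists>(enc :: nat \<Rightarrow> nat \<Rightarrow> 'x1 list) (rel :: nat \<Rightarrow> nat \<Rightarrow> 'y2 list \<Rightarrow> 'x2)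
        (dec :: nat \<Rightarrow> 'y3 list \<Rightarrow> nat option).
        (\<forall>n. is_code n (num_msgs R n) (enc n)) \<and>
        (\<lambda>n. err_prob p2 p3 n (num_msgs R n) (enc n) (rel n) (dec n)) \<longlonglongrightarrow> 0)"

definition capacity ::
  "('x1::finite \<Rightarrow> 'y2::finite \<Rightarrow> real) \<Rightarrow> ('x1 \<Rightarrow> 'x2::finite \<Rightarrow> 'y2 \<Rightarrow> 'y3::finite \<Rightarrow> real) \<Rightarrow> real"
  where "capacity p2 p3 = Sup {R. achievable p2 p3 R}"

definition marg :: "'w set \<Rightarrow> ('w \<Rightarrow> real) \<Rightarrow> ('w \<Rightarrow> 'a) \<Rightarrow> 'a \<Rightarrow> real" where
  "marg \<Omega> P f a = (\<Sum>w\<in>{w\<in>\<Omega>. f w = a}. P w)"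

definition mutual_info :: "'w set \<Rightarrow> ('w \<Rightarrow> real) \<Rightarrow> ('w \<Rightarrow> 'a) \<Rightarrow> ('w \<Rightarrow> 'b) \<Rightarrow> real" where
  "mutual_info \<Omega> P f g = (\<Sum>w\<in>\<Omega>. P w *
     log 2 (marg \<Omega> P (\<lambda>v. (f v, g v)) (f w, g w) / (marg \<Omega> P f (f w) * marg \<Omega> P g (g w))))"

definition cond_mutual_info ::
  "'w set \<Rightarrow> ('w \<Rightarrow> real) \<Rightarrow> ('w \<Rightarrow> 'a) \<Rightarrow> ('w \<Rightarrow> 'b) \<Rightarrow> ('w \<Rightarrow> 'c) \<Rightarrow> real" where
  "cond_mutual_info \<Omega> P f g h = (\<Sum>w\<in>\<Omega>. P w *
     log 2 (marg \<Omega> P (\<lambda>v. (f v, g v, h v)) (f w, g w, h w) * marg \<Omega> P h (h w) /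
            (marg \<Omega> P (\<lambda>v. (f v, h v)) (f w, h w) * marg \<Omega> P (\<lambda>v. (g v, h v)) (g w, h w))))"

text \<open>For a finite auxiliary alphabet Us (a finite set of naturals), a pmf px1 on X1,
  a conditional pmf pu(u|x1,y2) on Us and a function x2 = fx2 u x1 y2, the joint pmf
  p(x1)p(y2|x1)p(u|x1,y2)1{x2 = fx2(u,x1,y2)} p(y3|x1,x2,y2) on tuples (x1,y2,u,y3)
  (x2 being determined).\<close>

definition joint_pmf ::
  "('x1 \<Rightarrow> 'y2 \<Rightarrow> real) \<Rightarrow> ('x1 \<Rightarrow> 'x2 \<Rightarrow> 'y2 \<Rightarrow> 'y3 \<Rightarrow> real) \<Rightarrow>
   ('x1 \<Rightarrow> real) \<Rightarrow> ('x1 \<Rightarrow> 'y2 \<Rightarrow> nat \<Rightarrow> real) \<Rightarrow> (nat \<Rightarrow> 'x1 \<Rightarrow> 'y2 \<Rightarrow> 'x2) \<Rightarrow>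
   ('x1 \<times> 'y2 \<times> nat \<times> 'y3) \<Rightarrow> real" where
  "joint_pmf p2 p3 px1 pu fx2 = (\<lambda>(x1, y2, u, y3).
      px1 x1 * p2 x1 y2 * pu x1 y2 u * p3 x1 (fx2 u x1 y2) y2 y3)"

definition rate_expr ::
  "('x1::finite \<Rightarrow> 'y2::finite \<Rightarrow> real) \<Rightarrow> ('x1 \<Rightarrow> 'x2::finite \<Rightarrow> 'y2 \<Rightarrow> 'y3::finite \<Rightarrow> real) \<Rightarrow>
   nat set \<Rightarrow> ('x1 \<Rightarrow> real) \<Rightarrow> ('x1 \<Rightarrow> 'y2 \<Rightarrow> nat \<Rightarrow> real) \<Rightarrow> (nat \<Rightarrow> 'x1 \<Rightarrow> 'y2 \<Rightarrow> 'x2) \<Rightarrow> real"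
  where
  "rate_expr p2 p3 Us px1 pu fx2 =
    (let \<Omega> = (UNIV :: 'x1 set) \<times> (UNIV :: 'y2 set) \<times> Us \<times> (UNIV :: 'y3 set);
         P = joint_pmf p2 p3 px1 pu fx2;
         X1 = (\<lambda>(x1::'x1, y2::'y2, u::nat, y3::'y3). x1);
         Y2 = (\<lambda>(x1::'x1, y2::'y2, u::nat, y3::'y3). y2);
         U  = (\<lambda>(x1::'x1, y2::'y2, u::nat, y3::'y3). u);
         Y3 = (\<lambda>(x1::'x1, y2::'y2, u::nat, y3::'y3). y3)
     in min (mutual_info \<Omega> P X1 Y2)
            (mutual_info \<Omega> P (\<lambda>w. (X1 w, U w)) Y3 - cond_mutual_info \<Omega> P Y2 U X1))"

definition admissible_input ::
  "nat set \<Rightarrow> ('x1::finite \<Rightarrow> real) \<Rightarrow> ('x1 \<Rightarrow> 'y2::finite \<Rightarrow> nat \<Rightarrow> real) \<Rightarrow> bool" where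
  "admissible_input Us px1 pu \<longleftrightarrow>
     finite Us \<and>
     (\<forall>x1. 0 \<le> px1 x1) \<and> (\<Sum>x1\<in>UNIV. px1 x1) = 1 \<and>
     (\<forall>x1 y2 u. 0 \<le> pu x1 y2 u) \<and> (\<forall>x1 y2. (\<Sum>u\<in>Us. pu x1 y2 u) = 1)"

definition rate_values ::
  "('x1::finite \<Rightarrow> 'y2::finite \<Rightarrow> real) \<Rightarrow> ('x1 \<Rightarrow> 'x2::finite \<Rightarrow> 'y2 \<Rightarrow> 'y3::finite \<Rightarrow> real) \<Rightarrow> real set"
  where
  "rate_values p2 p3 = {rate_expr p2 p3 Us px1 pu fx2 | Us px1 pu fx2. admissible_input Us px1 pu}"

end

theory Submission
  imports Defs "HOL-Analysis.Analysis" "HOL-Real_Asymp.Real_Asymp"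
begin

text \<open>
  Achievability: the relay decodes the message from \<open>Y2\<close> and then knows both the codeword and, noncausally,
  \<open>Y2\<close>, which it treats as a channel state for Gelfand-Pinsker coding superimposed on the codeword. Each
  message carries a codeword and \<open>L\<close> auxiliary words; the relay picks one matching \<open>Y2\<close>, which costs
  \<open>I(Y2;U|X1)\<close>, and the receiver decodes the pair, which allows \<open>I(X1,U;Y3)\<close>. All decoders are threshold
  tests on likelihood ratios, and Chernoff bounds make every error term exponentially small.

  Converse: put \<open>U_i = (M, Y3_1, ..., Y3_(i-1), Y2_(i+1), ..., Y2_n)\<close>. Replacing the relay observations by
  receiver symbols one coordinate at a time, \<open>H(Y3^n|M) - H(Y2^n|M)\<close> telescopes into the sum of
  \<open>H(Y3_i|U_i) - H(Y2_i|U_i)\<close>, and \<open>H(Y2^n|M)\<close> is the sum of \<open>H(Y2_i|X1_i)\<close>. Degradedness gives the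
  bound by \<open>I(X1;Y2)\<close> since the message, \<open>Y2^n\<close> and \<open>Y3^n\<close> form a Markov chain.

  The maximum is attained although \<open>U\<close> ranges over arbitrary finite alphabets: the rate is a continuous
  function on a closed part of the convex hull of a compact set in a fixed finite dimension.
\<close>

subsection \<open>Sums over words\<close>

text \<open>Both directions use the second bound in the form
  \<open>H(Y3) - H(Y2|X1) + (H(Y2|X1,U) - H(Y3|X1,U))\<close>. On blocks, \<open>I(M;Y3^n)\<close>
  is \<open>H(Y3^n) - H(Y2^n|M) + (H(Y2^n|M) - H(Y3^n|M))\<close>, so only the last bracket needs an
  auxiliary variable to become single-letter. Two obstacles shape the proof. In random coding the
  relay's output depends on the whole codebook through its decoded message; a relay error is
  therefore charged in full, and otherwise the relay is treated as if told the message, so that only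
  pairs of codewords interact. In the converse the relay symbol depends on all of
  \<open>Y2^n\<close>, so it is still random given \<open>U_i\<close> and \<open>Y2_i\<close>, while
  the formula admits only functions \<open>x2(u,x1,y2)\<close>; this randomness is moved into the
  auxiliary variable. The resulting auxiliary alphabets grow with \<open>n\<close>, so attainment is
  argued on a convex hull and not on a fixed alphabet. The random coding bound is proved for one use
  of an abstract channel and then applied with words as letters, which is why its alphabets are sets
  and not types.\<close>

definition words :: "nat \<Rightarrow> 'a set \<Rightarrow> 'a list set" where
  "words n A = {xs. set xs \<subseteq> A \<and> length xs = n}"

lemma finite_words [simp]: "finite A \<Longrightarrow> finite (words n A)"
  unfolding words_def by (rule finite_lists_length_eq)

lemma words_UNIV: "words n UNIV = {xs. length xs = n}"
  by (auto simp: words_def)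

lemma words_0 [simp]: "words 0 A = {[]}"
  by (auto simp: words_def)

lemma nth_words: "xs \<in> words n A \<Longrightarrow> i < n \<Longrightarrow> xs ! i \<in> A"
  by (auto simp: words_def)

lemma sum_words_Suc:
  fixes F :: "'a list \<Rightarrow> real"
  shows "(\<Sum>xs\<in>words (Suc n) A. F xs) = (\<Sum>x\<in>A. \<Sum>xs\<in>words n A. F (x # xs))"
proof -
  have eq: "words (Suc n) A = (\<lambda>(x, xs). x # xs) ` (A \<times> words n A)"
    by (auto simp: words_def length_Suc_conv image_iff)
  have "inj_on (\<lambda>(x, xs). x # xs) (A \<times> words n A)"
    by (auto simp: inj_on_def)
  then show ?thesis
    unfolding eq by (simp add: sum.reindex sum.cartesian_product split_def o_def)
qed

lemma sum_words_prod:
  fixes f :: "nat \<Rightarrow> 'a \<Rightarrow> real"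
  shows "(\<Sum>xs\<in>words n A. \<Prod>i<n. f i (xs ! i)) = (\<Prod>i<n. \<Sum>x\<in>A. f i x)"
proof (induction n arbitrary: f)
  case 0
  then show ?case by simp
next
  case (Suc n)
  have "(\<Sum>xs\<in>words (Suc n) A. \<Prod>i<Suc n. f i (xs ! i))
      = (\<Sum>x\<in>A. \<Sum>xs\<in>words n A. f 0 x * (\<Prod>i<n. f (Suc i) (xs ! i)))"
    by (simp only: sum_words_Suc prod.lessThan_Suc_shift) simp
  also have "\<dots> = (\<Sum>x\<in>A. f 0 x) * (\<Prod>i<n. \<Sum>x\<in>A. f (Suc i) x)"
    by (simp add: sum_distrib_left [symmetric] sum_distrib_right Suc.IH[of "\<lambda>i. f (Suc i)"])
  finally show ?case by (simp only: prod.lessThan_Suc_shift o_def)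
qed

text \<open>Memorylessness as an identity: under a product law a letter is independent of the
  letters before it, so against any function \<open>G\<close> of the prefix its indicator may be
  traded for its probability. Keeping the full product on both sides lets the induction simply peel
  off the head.\<close>

lemma sum_words_take_nth:
  fixes k :: "nat \<Rightarrow> 'a \<Rightarrow> real"
  assumes "\<And>j. j < n \<Longrightarrow> (\<Sum>z\<in>A. k j z) = 1" and "finite A" and "i < n" and "z \<in> A"
  shows "(\<Sum>zs\<in>words n A. (\<Prod>j<n. k j (zs ! j)) * (G (take i zs) * of_bool (zs ! i = z)))
       = (\<Sum>zs\<in>words n A. (\<Prod>j<n. k j (zs ! j)) * (G (take i zs) * k i z))"
  using assms
proof (induction n arbitrary: k i G)
  case 0
  then show ?case by simp
next
  case (Suc n)
  have one: "(\<Sum>xs\<in>words n A. \<Prod>j<n. k (Suc j) (xs ! j)) = 1"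
    using Suc.prems(1) by (subst sum_words_prod[where f = "\<lambda>j. k (Suc j)"]) simp
  show ?case
  proof (cases i)
    case 0
    have "(\<Sum>zs\<in>words (Suc n) A. (\<Prod>j<Suc n. k j (zs ! j)) * (G (take i zs) * of_bool (zs ! i = z)))
      = (\<Sum>x\<in>A. \<Sum>xs\<in>words n A. (k 0 x * G [] * of_bool (x = z)) * (\<Prod>j<n. k (Suc j) (xs ! j)))"
      unfolding sum_words_Suc 0 prod.lessThan_Suc_shift by (simp add: mult_ac)
    also have "\<dots> = (\<Sum>x\<in>A. k 0 x * G [] * of_bool (x = z))"
      by (simp add: sum_distrib_left [symmetric] one)
    also have "\<dots> = k 0 z * G []"
      using Suc.prems by (simp add: of_bool_def if_distrib sum.delta cong: if_cong)
    also have "\<dots> = (\<Sum>x\<in>A. k 0 x) * (k 0 z * G [])"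
      using Suc.prems by simp
    also have "\<dots> = (\<Sum>x\<in>A. \<Sum>xs\<in>words n A. (k 0 x * (k 0 z * G [])) * (\<Prod>j<n. k (Suc j) (xs ! j)))"
      by (simp add: sum_distrib_left [symmetric] sum_distrib_right one)
    also have "\<dots> = (\<Sum>zs\<in>words (Suc n) A. (\<Prod>j<Suc n. k j (zs ! j)) * (G (take i zs) * k i z))"
      unfolding sum_words_Suc 0 prod.lessThan_Suc_shift by (simp add: mult_ac)
    finally show ?thesis .
  next
    case (Suc i')
    have IH: "(\<Sum>zs\<in>words n A. (\<Prod>j<n. k (Suc j) (zs ! j)) * (G (x # take i' zs) * of_bool (zs ! i' = z)))
       = (\<Sum>zs\<in>words n A. (\<Prod>j<n. k (Suc j) (zs ! j)) * (G (x # take i' zs) * k (Suc i') z))" for x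
      using Suc Suc.prems by (intro Suc.IH) auto
    show ?thesis
      unfolding sum_words_Suc Suc prod.lessThan_Suc_shift
      using IH by (simp add: mult.assoc sum_distrib_left [symmetric])
  qed
qed

subsection \<open>Entropy\<close>

definition ent :: "real \<Rightarrow> real" where
  "ent t = - t * log 2 t"

lemma ent_0 [simp]: "ent 0 = 0"
  by (simp add: ent_def)

lemma ent_1 [simp]: "ent 1 = 0"
  by (simp add: ent_def)

text \<open>The chain rule at the level of single terms, valid at zero too. Entropies of product
  laws are split with it, so conditional entropy never needs a definition of its own.\<close>

lemma ent_mult: "0 \<le> s \<Longrightarrow> 0 \<le> t \<Longrightarrow> ent (s * t) = t * ent s + s * ent t"
  by (cases "s = 0 \<or> t = 0") (auto simp: ent_def log_mult algebra_simps)

lemma continuous_on_ent: "continuous_on {0..} ent"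
proof -
  have lim: "((\<lambda>t::real. - t * log 2 t) \<longlongrightarrow> 0) (at_right 0)"
    by real_asymp
  have "continuous (at x within {0..}) ent" if "x \<ge> 0" for x
  proof (cases "x = 0")
    case True
    have "at 0 within {0..} = at_right (0::real)"
      by (simp add: at_within_Ici_at_right)
    then show ?thesis
      using lim by (simp add: True continuous_within ent_def [abs_def])
  next
    case False
    then have "isCont ent x"
      using that unfolding ent_def [abs_def] by (intro continuous_intros) auto
    then show ?thesis by (rule continuous_at_imp_continuous_at_within)
  qed
  then show ?thesis by (simp add: continuous_on_eq_continuous_within)
qed

section \<open>Relative entropy, concavity and subadditivity\<close>

lemma mult_log_ratio_le:
  fixes p q :: real
  assumes "0 \<le> p" "0 \<le> q" "p > 0 \<Longrightarrow> q > 0"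
  shows "p * log 2 (q / p) \<le> (q - p) / ln 2"
proof (cases "p = 0")
  case False
  then have pos: "p > 0" "q > 0" using assms by auto
  then have "ln (q / p) \<le> q / p - 1" by (intro ln_le_minus_one) simp
  then have "p * ln (q / p) \<le> p * (q / p - 1)" using pos by (intro mult_left_mono) auto
  also have "\<dots> = q - p" using pos by (simp add: field_simps)
  finally show ?thesis by (simp add: log_def divide_right_mono)
qed (use assms in simp)

text \<open>Nonnegativity of relative entropy for unnormalised weights: \<open>q\<close> may have
  less mass than \<open>p\<close>. Jensen, subadditivity and Fano below are all this inequality for
  a suitable comparison weight \<open>q\<close>.\<close>

lemma gibbs:
  fixes p q :: "'a \<Rightarrow> real"
  assumes "\<And>a. a \<in> S \<Longrightarrow> 0 \<le> p a" "\<And>a. a \<in> S \<Longrightarrow> 0 \<le> q a"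
    and "\<And>a. a \<in> S \<Longrightarrow> p a > 0 \<Longrightarrow> q a > 0"
    and "sum q S \<le> sum p S"
  shows "(\<Sum>a\<in>S. p a * log 2 (q a / p a)) \<le> 0"
proof -
  have "(\<Sum>a\<in>S. p a * log 2 (q a / p a)) \<le> (\<Sum>a\<in>S. (q a - p a) / ln 2)"
    using assms by (intro sum_mono mult_log_ratio_le) auto
  also have "\<dots> = (sum q S - sum p S) / ln 2"
    by (simp add: sum_divide_distrib [symmetric] sum_subtractf)
  also have "\<dots> \<le> 0" using assms(4) by (intro divide_nonpos_pos) auto
  finally show ?thesis .
qed

text \<open>Gibbs' inequality for the weights \<open>w j * a j\<close> against
  \<open>w j * b\<close>, where \<open>b\<close> is the mean; both have total mass \<open>b\<close>.
  Zero values of \<open>a\<close> need no separate argument about derivatives at the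
  boundary.\<close>

lemma ent_jensen:
  fixes w a :: "'j \<Rightarrow> real"
  assumes fin: "finite J" and w: "\<And>j. j \<in> J \<Longrightarrow> 0 \<le> w j" "sum w J = 1"
    and a: "\<And>j. j \<in> J \<Longrightarrow> 0 \<le> a j"
  shows "(\<Sum>j\<in>J. w j * ent (a j)) \<le> ent (\<Sum>j\<in>J. w j * a j)"
proof -
  define b where "b = (\<Sum>j\<in>J. w j * a j)"
  have b0: "0 \<le> b" unfolding b_def using w a by (intro sum_nonneg) auto
  have bpos: "b > 0" if "j \<in> J" "w j * a j > 0" for j
    unfolding b_def using that w a fin by (intro sum_pos2[of J j]) auto
  have "(\<Sum>j\<in>J. (w j * a j) * log 2 ((w j * b) / (w j * a j))) \<le> 0"
  proof (rule gibbs)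
    show "0 \<le> w j * a j" "0 \<le> w j * b" if "j \<in> J" for j using that w a b0 by auto
    show "w j * b > 0" if "j \<in> J" "w j * a j > 0" for j
      using that w a bpos[OF that] by (simp add: zero_less_mult_iff) (metis less_le not_less)
    show "(\<Sum>j\<in>J. w j * b) \<le> (\<Sum>j\<in>J. w j * a j)"
      using w by (simp add: sum_distrib_right [symmetric] b_def)
  qed
  moreover have "(w j * a j) * log 2 ((w j * b) / (w j * a j)) = w j * a j * log 2 b + w j * ent (a j)"
    if "j \<in> J" for j
  proof (cases "w j * a j = 0")
    case False
    then have "w j > 0" "a j > 0" using that w a by (auto simp: less_le)
    then have "w j * a j > 0" by simp
    then have "b > 0" using bpos that by blast
    then show ?thesis using \<open>w j > 0\<close> \<open>a j > 0\<close>
      by (simp add: ent_def log_divide algebra_simps)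
  qed auto
  ultimately have "(\<Sum>j\<in>J. w j * a j) * log 2 b + (\<Sum>j\<in>J. w j * ent (a j)) \<le> 0"
    by (simp add: sum.distrib sum_distrib_right)
  then show ?thesis unfolding b_def [symmetric] by (simp add: ent_def)
qed

lemma ent_subadditive_words:
  fixes a :: "'a::finite list \<Rightarrow> real"
  assumes a: "\<And>ys. ys \<in> words n UNIV \<Longrightarrow> 0 \<le> a ys" and a1: "(\<Sum>ys\<in>words n UNIV. a ys) = 1"
  defines "b \<equiv> \<lambda>i y. \<Sum>ys\<in>words n UNIV. a ys * of_bool (ys ! i = y)"
  shows "(\<Sum>ys\<in>words n UNIV. ent (a ys)) \<le> (\<Sum>i<n. \<Sum>y\<in>UNIV. ent (b i y))"
proof -
  let ?W = "words n (UNIV :: 'a set)"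
  have b0: "0 \<le> b i y" for i y unfolding b_def using a by (intro sum_nonneg) auto
  have bpos: "0 < b i (ys ! i)" if "ys \<in> ?W" "a ys > 0" for ys i
    unfolding b_def using that a by (intro sum_pos2[of _ ys]) auto
  have b1: "(\<Sum>y\<in>UNIV. b i y) = 1" for i
    unfolding b_def by (subst sum.swap) (simp add: a1 sum_distrib_left [symmetric])
  \<comment> \<open>The comparison weight is the product of the letter marginals of
    \<open>a\<close>, which is positive wherever \<open>a\<close> is.\<close>
  have "(\<Sum>ys\<in>?W. a ys * log 2 ((\<Prod>i<n. b i (ys ! i)) / a ys)) \<le> 0"
  proof (rule gibbs)
    show "0 \<le> (\<Prod>i<n. b i (ys ! i))" for ys by (simp add: prod_nonneg b0)
    show "0 < (\<Prod>i<n. b i (ys ! i))" if "ys \<in> ?W" "a ys > 0" for ys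
      using bpos[OF that] by (intro prod_pos) auto
    show "(\<Sum>ys\<in>?W. \<Prod>i<n. b i (ys ! i)) \<le> sum a ?W"
      by (simp add: sum_words_prod b1 a1)
  qed (use a in auto)
  moreover have "a ys * log 2 ((\<Prod>i<n. b i (ys ! i)) / a ys)
      = (\<Sum>i<n. a ys * log 2 (b i (ys ! i))) + ent (a ys)" if "ys \<in> ?W" for ys
  proof (cases "a ys = 0")
    case False
    then have pos: "a ys > 0" using a that by (simp add: less_le)
    have "log 2 (\<Prod>i<n. b i (ys ! i)) = (\<Sum>i<n. log 2 (b i (ys ! i)))"
      using bpos[OF that pos]
      by (simp add: log_def sum_divide_distrib [symmetric] ln_prod less_imp_neq [THEN not_sym])
    moreover have "0 < (\<Prod>i<n. b i (ys ! i))"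
      using bpos[OF that pos] by (intro prod_pos) auto
    ultimately have "log 2 ((\<Prod>i<n. b i (ys ! i)) / a ys) = (\<Sum>i<n. log 2 (b i (ys ! i))) - log 2 (a ys)"
      using pos by (metis log_divide less_irrefl)
    then show ?thesis by (simp only: ent_def right_diff_distrib sum_distrib_left)
  qed auto
  moreover have "(\<Sum>ys\<in>?W. \<Sum>i<n. a ys * log 2 (b i (ys ! i))) = - (\<Sum>i<n. \<Sum>y\<in>UNIV. ent (b i y))"
  proof -
    have "(\<Sum>ys\<in>?W. a ys * log 2 (b i (ys ! i))) = (\<Sum>y\<in>UNIV. b i y * log 2 (b i y))" for i
    proof -
      have "(\<Sum>y\<in>UNIV. b i y * log 2 (b i y))
          = (\<Sum>y\<in>UNIV. \<Sum>ys\<in>?W. a ys * of_bool (ys ! i = y) * log 2 (b i y))"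
        by (simp only: b_def sum_distrib_right)
      also have "\<dots> = (\<Sum>ys\<in>?W. \<Sum>y\<in>UNIV. a ys * of_bool (ys ! i = y) * log 2 (b i y))"
        by (rule sum.swap)
      also have "\<dots> = (\<Sum>ys\<in>?W. a ys * log 2 (b i (ys ! i)))"
        by (intro sum.cong refl)
           (simp add: of_bool_def if_distrib if_distribR sum.delta' cong: if_cong)
      finally show ?thesis by simp
    qed
    then show ?thesis
      by (subst sum.swap) (simp add: ent_def sum_negf)
  qed
  ultimately show ?thesis by (simp add: sum.distrib)
qed

section \<open>Entropies of random variables and mutual information\<close>

definition Hent :: "'w set \<Rightarrow> ('w \<Rightarrow> real) \<Rightarrow> ('w \<Rightarrow> 'a) \<Rightarrow> real" where
  "Hent \<Omega> P f = - (\<Sum>w\<in>\<Omega>. P w * log 2 (marg \<Omega> P f (f w)))"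

lemma marg_alt: "finite \<Omega> \<Longrightarrow> marg \<Omega> P f a = (\<Sum>w\<in>\<Omega>. P w * of_bool (f w = a))"
  by (simp add: marg_def sum.inter_filter of_bool_def if_distrib cong: if_cong)

lemma marg_nonneg: "(\<And>w. w \<in> \<Omega> \<Longrightarrow> 0 \<le> P w) \<Longrightarrow> 0 \<le> marg \<Omega> P f a"
  unfolding marg_def by (intro sum_nonneg) auto

lemma marg_pos:
  assumes "finite \<Omega>" "\<And>w. w \<in> \<Omega> \<Longrightarrow> 0 \<le> P w" "w \<in> \<Omega>" "P w > 0"
  shows "marg \<Omega> P f (f w) > 0"
  unfolding marg_def using assms by (intro sum_pos2[of _ w]) auto

lemma sum_marg_mult:
  assumes "finite \<Omega>" "finite A" "f ` \<Omega> \<subseteq> A"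
  shows "(\<Sum>a\<in>A. marg \<Omega> P f a * g a) = (\<Sum>w\<in>\<Omega>. P w * g (f w))"
proof -
  have "(\<Sum>a\<in>A. marg \<Omega> P f a * g a) = (\<Sum>a\<in>A. \<Sum>w\<in>\<Omega>. P w * of_bool (f w = a) * g a)"
    by (simp only: marg_alt[OF assms(1)] sum_distrib_right)
  also have "\<dots> = (\<Sum>w\<in>\<Omega>. \<Sum>a\<in>A. P w * of_bool (f w = a) * g a)"
    by (rule sum.swap)
  also have "\<dots> = (\<Sum>w\<in>\<Omega>. P w * g (f w))"
  proof (intro sum.cong refl)
    fix w assume "w \<in> \<Omega>"
    then have "f w \<in> A" using assms by auto
    then show "(\<Sum>a\<in>A. P w * of_bool (f w = a) * g a) = P w * g (f w)"
      using assms(2) by (simp add: of_bool_def if_distrib if_distribR sum.delta' cong: if_cong)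
  qed
  finally show ?thesis .
qed

lemma sum_marg:
  assumes "finite \<Omega>" "finite A" "f ` \<Omega> \<subseteq> A"
  shows "(\<Sum>a\<in>A. marg \<Omega> P f a) = (\<Sum>w\<in>\<Omega>. P w)"
  using sum_marg_mult[OF assms, of P "\<lambda>_. 1"] by simp

lemma Hent_eq:
  assumes "finite \<Omega>" "finite A" "f ` \<Omega> \<subseteq> A"
  shows "Hent \<Omega> P f = (\<Sum>a\<in>A. ent (marg \<Omega> P f a))"
  using sum_marg_mult[OF assms, of P "\<lambda>a. log 2 (marg \<Omega> P f a)"]
  by (simp add: Hent_def ent_def sum_negf)

text \<open>Entropy depends only on the partition of \<open>\<Omega>\<close> into level sets. This
  identifies differently arranged tuples, in particular the hybrid words of the converse with pairs
  of an auxiliary value and one letter.\<close>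

lemma Hent_recode:
  assumes "\<And>v w. v \<in> \<Omega> \<Longrightarrow> w \<in> \<Omega> \<Longrightarrow> f v = f w \<longleftrightarrow> g v = g w"
  shows "Hent \<Omega> P f = Hent \<Omega> P g"
proof -
  have "marg \<Omega> P f (f w) = marg \<Omega> P g (g w)" if "w \<in> \<Omega>" for w
    unfolding marg_def using assms that by (intro sum.cong) auto
  then show ?thesis unfolding Hent_def by simp
qed

lemma mutual_info_Hent:
  assumes "finite \<Omega>" "\<And>w. w \<in> \<Omega> \<Longrightarrow> 0 \<le> P w"
  shows "mutual_info \<Omega> P f g = Hent \<Omega> P f + Hent \<Omega> P g - Hent \<Omega> P (\<lambda>w. (f w, g w))"
proof -
  have "P w * log 2 (marg \<Omega> P (\<lambda>v. (f v, g v)) (f w, g w) / (marg \<Omega> P f (f w) * marg \<Omega> P g (g w)))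
     = P w * log 2 (marg \<Omega> P (\<lambda>v. (f v, g v)) (f w, g w)) - P w * log 2 (marg \<Omega> P f (f w))
       - P w * log 2 (marg \<Omega> P g (g w))" if "w \<in> \<Omega>" for w
  proof (cases "P w = 0")
    case False
    then have "P w > 0" using assms that by (simp add: less_le)
    note pos = marg_pos[of \<Omega> P w, OF assms that this]
    show ?thesis using pos[of f] pos[of g] pos[of "\<lambda>v. (f v, g v)"]
      by (simp add: log_divide log_mult algebra_simps)
  qed simp
  then show ?thesis
    unfolding mutual_info_def Hent_def by (simp add: sum_subtractf)
qed

lemma cond_mutual_info_Hent:
  assumes "finite \<Omega>" "\<And>w. w \<in> \<Omega> \<Longrightarrow> 0 \<le> P w"
  shows "cond_mutual_info \<Omega> P f g h = Hent \<Omega> P (\<lambda>w. (f w, h w)) + Hent \<Omega> P (\<lambda>w. (g w, h w))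
     - Hent \<Omega> P (\<lambda>w. (f w, g w, h w)) - Hent \<Omega> P h"
proof -
  have "P w * log 2 (marg \<Omega> P (\<lambda>v. (f v, g v, h v)) (f w, g w, h w) * marg \<Omega> P h (h w) /
            (marg \<Omega> P (\<lambda>v. (f v, h v)) (f w, h w) * marg \<Omega> P (\<lambda>v. (g v, h v)) (g w, h w)))
     = P w * log 2 (marg \<Omega> P (\<lambda>v. (f v, g v, h v)) (f w, g w, h w)) + P w * log 2 (marg \<Omega> P h (h w))
       - P w * log 2 (marg \<Omega> P (\<lambda>v. (f v, h v)) (f w, h w))
       - P w * log 2 (marg \<Omega> P (\<lambda>v. (g v, h v)) (g w, h w))" if "w \<in> \<Omega>" for w
  proof (cases "P w = 0")
    case False
    then have "P w > 0" using assms that by (simp add: less_le)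
    note pos = marg_pos[of \<Omega> P w, OF assms that this]
    show ?thesis
      using pos[of h] pos[of "\<lambda>v. (f v, g v, h v)"] pos[of "\<lambda>v. (f v, h v)"] pos[of "\<lambda>v. (g v, h v)"]
      by (simp add: log_divide log_mult algebra_simps)
  qed simp
  then show ?thesis
    unfolding cond_mutual_info_def Hent_def by (simp add: sum_subtractf sum.distrib)
qed

subsection \<open>Random coding for a single block\<close>

lemma exists_le_average:
  fixes w F :: "'a \<Rightarrow> real"
  assumes "\<And>c. c \<in> S \<Longrightarrow> 0 \<le> w c" "sum w S = 1" "(\<Sum>c\<in>S. w c * F c) \<le> B"
  shows "\<exists>c\<in>S. F c \<le> B"
proof (rule ccontr)
  assume neg: "\<not> (\<exists>c\<in>S. F c \<le> B)"
  have fin: "finite S" using assms(2) by (metis sum.infinite zero_neq_one)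
  obtain c0 where c0: "c0 \<in> S" "w c0 > 0"
    using assms(1,2) by (metis less_le sum.neutral zero_neq_one)
  have "(\<Sum>c\<in>S. w c * B) < (\<Sum>c\<in>S. w c * F c)"
  proof (rule sum_strict_mono_ex1[OF fin])
    show "\<forall>c\<in>S. w c * B \<le> w c * F c"
      using neg assms(1) by (auto intro!: mult_left_mono simp: not_le less_imp_le)
    show "\<exists>c\<in>S. w c * B < w c * F c"
      using c0 neg by (intro bexI[of _ c0]) auto
  qed
  then show False using assms(2,3) by (simp add: sum_distrib_right [symmetric])
qed

text \<open>The union bound on the error involves at most two codewords at a time, so the expectation over
  codebooks needs only the law of one codeword and of a pair.\<close>

lemma random_codebook:
  fixes ps a :: "'s \<Rightarrow> real" and b :: "'s \<Rightarrow> 's \<Rightarrow> real" and I :: "'i set" and \<alpha> \<beta> :: real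
  assumes S: "finite S" "\<And>s. 0 \<le> ps s" "sum ps S = 1" and I: "finite I"
    and a: "(\<Sum>s\<in>S. ps s * a s) \<le> \<alpha>"
    and b: "\<And>s. s \<in> S \<Longrightarrow> (\<Sum>s'\<in>S. ps s' * b s s') \<le> \<beta>" and \<beta>: "0 \<le> \<beta>"
  shows "\<exists>c. (\<forall>m\<in>I. c m \<in> S) \<and>
    (\<Sum>m\<in>I. a (c m) + (\<Sum>m'\<in>I - {m}. b (c m) (c m'))) \<le> card I * (\<alpha> + card I * \<beta>)"
proof -
  define C where "C = PiE I (\<lambda>_. S)"
  define W where "W c = (\<Prod>m\<in>I. ps (c m))" for c
  have W0: "0 \<le> W c" for c using S by (simp add: W_def prod_nonneg)
  have E: "(\<Sum>c\<in>C. W c * (\<Prod>i\<in>I. g i (c i))) = (\<Prod>i\<in>I. \<Sum>s\<in>S. ps s * g i s)"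
    for g :: "'i \<Rightarrow> 's \<Rightarrow> real"
    unfolding C_def W_def using I S(1) by (simp add: prod_sum_PiE prod.distrib)
  have W1: "sum W C = 1"
    using E[of "\<lambda>_ _. 1"] S by simp
  have single: "(\<Sum>c\<in>C. W c * f (c m)) = (\<Sum>s\<in>S. ps s * f s)" if "m \<in> I" for m f
  proof -
    have "(\<Prod>i\<in>I. if i = m then f (c i) else 1) = f (c m)" for c
      using that I by (simp add: prod.delta)
    moreover have "(\<Prod>i\<in>I. \<Sum>s\<in>S. ps s * (if i = m then f s else 1))
        = (\<Prod>i\<in>I. if i = m then (\<Sum>s\<in>S. ps s * f s) else 1)"
      using S by (intro prod.cong) auto
    ultimately show ?thesis
      using E[of "\<lambda>i s. if i = m then f s else 1"] that I by (simp add: prod.delta)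
  qed
  have pair: "(\<Sum>c\<in>C. W c * (f (c m) * g (c m'))) = (\<Sum>s\<in>S. ps s * f s) * (\<Sum>s\<in>S. ps s * g s)"
    if "m \<in> I" "m' \<in> I" "m \<noteq> m'" for m m' and f g :: "'s \<Rightarrow> real"
  proof -
    have split: "(\<Prod>i\<in>I. if i = m then x else if i = m' then y else 1) = x * y" for x y :: real
    proof -
      have "(\<Prod>i\<in>I. if i = m then x else if i = m' then y else 1)
          = (\<Prod>i\<in>I. if i = m then x else 1) * (\<Prod>i\<in>I. if i = m' then y else 1)"
        unfolding prod.distrib [symmetric] using that by (intro prod.cong) auto
      then show ?thesis using that I by (simp add: prod.delta)
    qed
    have "(\<Prod>i\<in>I. if i = m then f (c i) else if i = m' then g (c i) else 1)
        = (\<Prod>i\<in>I. if i = m then f (c m) else if i = m' then g (c m') else 1)" for c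
      by (intro prod.cong) auto
    moreover have "(\<Prod>i\<in>I. \<Sum>s\<in>S. ps s * (if i = m then f s else if i = m' then g s else 1))
        = (\<Prod>i\<in>I. if i = m then (\<Sum>s\<in>S. ps s * f s) else if i = m' then (\<Sum>s\<in>S. ps s * g s) else 1)"
      using S by (intro prod.cong) auto
    ultimately show ?thesis
      using E[of "\<lambda>i s. if i = m then f s else if i = m' then g s else 1"] by (simp add: split)
  qed
  \<comment> \<open>\<open>b\<close> is not a product of a function of each codeword. Summing over
    the value \<open>s\<close> of \<open>c m\<close> makes it one, and independence of the two
    codewords then reduces the claim to the bound for fixed \<open>s\<close>.\<close>
  have pair': "(\<Sum>c\<in>C. W c * b (c m) (c m')) \<le> \<beta>" if m: "m \<in> I" "m' \<in> I" "m \<noteq> m'" for m m'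
  proof -
    have "(\<Sum>c\<in>C. W c * b (c m) (c m')) = (\<Sum>c\<in>C. \<Sum>s\<in>S. W c * (of_bool (c m = s) * b s (c m')))"
    proof (intro sum.cong refl)
      fix c assume "c \<in> C"
      then have "c m \<in> S" using m by (auto simp: C_def)
      then show "W c * b (c m) (c m') = (\<Sum>s\<in>S. W c * (of_bool (c m = s) * b s (c m')))"
        using S(1) by (simp add: of_bool_def if_distrib if_distribR sum.delta' cong: if_cong)
    qed
    also have "\<dots> = (\<Sum>s\<in>S. (\<Sum>t\<in>S. ps t * of_bool (t = s)) * (\<Sum>t\<in>S. ps t * b s t))"
      by (subst sum.swap) (intro sum.cong refl pair[OF m, where f = "\<lambda>t. of_bool (t = _)"])
    also have "\<dots> = (\<Sum>s\<in>S. ps s * (\<Sum>t\<in>S. ps t * b s t))"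
      using S(1) by (intro sum.cong refl)
        (simp add: of_bool_def if_distrib if_distribR sum.delta cong: if_cong)
    also have "\<dots> \<le> (\<Sum>s\<in>S. ps s * \<beta>)"
      using b S by (intro sum_mono mult_left_mono) auto
    also have "\<dots> = \<beta>" using S by (simp add: sum_distrib_right [symmetric])
    finally show ?thesis .
  qed
  have "(\<Sum>c\<in>C. W c * (\<Sum>m\<in>I. a (c m) + (\<Sum>m'\<in>I - {m}. b (c m) (c m'))))
      = (\<Sum>m\<in>I. (\<Sum>c\<in>C. W c * a (c m)) + (\<Sum>m'\<in>I - {m}. \<Sum>c\<in>C. W c * b (c m) (c m')))"
    unfolding sum_distrib_left
    by (subst sum.swap)
       (simp add: sum.distrib distrib_left sum_distrib_left sum.swap[of _ "_ - _" C])
  also have "\<dots> \<le> (\<Sum>m\<in>I. \<alpha> + (\<Sum>m'\<in>I - {m}. \<beta>))"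
    using a pair' by (intro sum_mono add_mono) (auto simp: single)
  also have "\<dots> \<le> (\<Sum>m\<in>I. \<alpha> + (\<Sum>m'\<in>I. \<beta>))"
    using \<beta> I by (intro sum_mono add_mono sum_mono2) auto
  also have "\<dots> = card I * (\<alpha> + card I * \<beta>)" by simp
  finally have avg: "(\<Sum>c\<in>C. W c * (\<Sum>m\<in>I. a (c m) + (\<Sum>m'\<in>I - {m}. b (c m) (c m'))))
      \<le> card I * (\<alpha> + card I * \<beta>)" .
  obtain c where "c \<in> C"
      "(\<Sum>m\<in>I. a (c m) + (\<Sum>m'\<in>I - {m}. b (c m) (c m'))) \<le> card I * (\<alpha> + card I * \<beta>)"
    using exists_le_average[OF _ W1 avg] W0 by auto
  then show ?thesis by (auto simp: C_def intro!: exI[of _ c])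
qed

text \<open>By convexity in \<open>a\<close> the exponential lies below its chord from
  \<open>a = 0\<close> to \<open>a = 1\<close>. In the covering bound this separates the probability
  \<open>1 - a\<close> that the target set is missed from a term that depends only on the number of
  trials.\<close>

lemma exp_neg_mult_le:
  fixes a t :: real
  assumes "0 \<le> a" "a \<le> 1" "0 \<le> t"
  shows "exp (- (a * t)) \<le> 1 - a + exp (- t)"
proof -
  have "exp ((1 - a) *\<^sub>R 0 + a *\<^sub>R (- t)) \<le> (1 - a) * exp 0 + a * exp (- t)"
    using assms by (intro convex_onD[OF exp_convex]) auto
  then have "exp (- (a * t)) \<le> (1 - a) + a * exp (- t)" by simp
  moreover have "a * exp (- t) \<le> exp (- t)" using assms mult_right_mono[of a 1 "exp (- t)"] by simp
  ultimately show ?thesis by linarith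
qed

text \<open>If \<open>m\<close> passes the test and no rival does, the choice is forced. When
  nothing passes, the choice is arbitrary, but then \<open>T m\<close> fails and the first term
  already pays for the error.\<close>

lemma some_decoder_error:
  fixes T :: "'i \<Rightarrow> bool"
  assumes "finite I" "m \<in> I"
  shows "of_bool ((SOME k. k \<in> I \<and> T k) \<noteq> m) \<le> of_bool (\<not> T m) + (\<Sum>k\<in>I - {m}. of_bool (T k) :: real)"
proof (cases "T m \<and> (\<forall>k\<in>I - {m}. \<not> T k)")
  case True
  then have "(SOME k. k \<in> I \<and> T k) = m" using assms by (intro some_equality) auto
  then show ?thesis by (simp add: sum_nonneg)
next
  case False
  show ?thesis
  proof (cases "T m")
    case True
    with False obtain k where k: "k \<in> I - {m}" "T k" by auto
    have "of_bool (T k) \<le> (\<Sum>k\<in>I - {m}. of_bool (T k) :: real)"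
      using assms k by (intro member_le_sum) auto
    then show ?thesis using k by simp
  qed (simp add: sum_nonneg)
qed

lemma sum_words_prod_nth:
  fixes f :: "'a \<Rightarrow> real"
  assumes "sum f A = 1" "l < L"
  shows "(\<Sum>us\<in>words L A. (\<Prod>i<L. f (us ! i)) * g (us ! l)) = (\<Sum>u\<in>A. f u * g u)"
proof -
  have "(\<Prod>i<L. f (us ! i)) * g (us ! l) = (\<Prod>i<L. f (us ! i) * (if i = l then g (us ! i) else 1))" for us
    using assms(2) by (simp add: prod.distrib prod.delta)
  then have "(\<Sum>us\<in>words L A. (\<Prod>i<L. f (us ! i)) * g (us ! l))
      = (\<Prod>i<L. \<Sum>u\<in>A. f u * (if i = l then g u else 1))"
    using sum_words_prod[where f = "\<lambda>i u. f u * (if i = l then g u else 1)" and n = L and A = A]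
    by simp
  also have "\<dots> = (\<Prod>i<L. if i = l then (\<Sum>u\<in>A. f u * g u) else 1)"
    using assms by (intro prod.cong) auto
  also have "\<dots> = (\<Sum>u\<in>A. f u * g u)" using assms by (simp add: prod.delta)
  finally show ?thesis .
qed

text \<open>In \<open>V x r y z\<close> the relay acts on its estimate \<open>r\<close> of the sender's word together with the chosen
  auxiliary word; only for a correct estimate is this the kernel of the intended joint law.\<close>

locale relay_block =
  fixes AX :: "'x set" and AY :: "'y set" and AU :: "'u set" and AZ :: "'z set"
    and p :: "'x \<Rightarrow> real" and w :: "'x \<Rightarrow> 'y \<Rightarrow> real" and q :: "'x \<Rightarrow> 'y \<Rightarrow> 'u \<Rightarrow> real"
    and V :: "'x \<Rightarrow> 'x \<times> 'u \<Rightarrow> 'y \<Rightarrow> 'z \<Rightarrow> real"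
  assumes fin: "finite AX" "finite AY" "finite AU" "finite AZ"
    and nonneg: "\<And>x. 0 \<le> p x" "\<And>x y. 0 \<le> w x y" "\<And>x y u. 0 \<le> q x y u" "\<And>x r y z. 0 \<le> V x r y z"
    and sum_p: "(\<Sum>x\<in>AX. p x) = 1" and sum_w: "\<And>x. (\<Sum>y\<in>AY. w x y) = 1"
    and sum_q: "\<And>x y. (\<Sum>u\<in>AU. q x y u) = 1" and sum_V: "\<And>x r y. (\<Sum>z\<in>AZ. V x r y z) = 1"
begin

section \<open>Threshold tests and covering\<close>

definition "pY y = (\<Sum>x\<in>AX. p x * w x y)"
text \<open>This law of \<open>u\<close> is conditional on \<open>x\<close>, whereas
  \<open>pY\<close>, \<open>pXUZ\<close> and \<open>pZ\<close> are not conditional. In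
  \<open>pXUZ\<close> the relay's estimate is taken to be the true \<open>x\<close>.\<close>

definition "pU x u = (\<Sum>y\<in>AY. w x y * q x y u)"
definition "pXUZ x u z = (\<Sum>y\<in>AY. p x * w x y * q x y u * V x (x, u) y z)"
definition "pZ z = (\<Sum>x\<in>AX. \<Sum>u\<in>AU. pXUZ x u z)"

text \<open>The receiver's likelihood ratio test of the pair \<open>(x, u)\<close> against an output
  independent of it, multiplied out so that a vanishing denominator needs no convention.\<close>

definition "hit \<Gamma> x u z \<longleftrightarrow> pXUZ x u z > \<Gamma> * (p x * pU x u * pZ z)"

lemma derived_nonneg: "0 \<le> pY y" "0 \<le> pU x u" "0 \<le> pXUZ x u z" "0 \<le> pZ z"
  unfolding pY_def pU_def pXUZ_def pZ_def by (auto intro!: sum_nonneg mult_nonneg_nonneg nonneg)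

lemma sum_pU: "(\<Sum>u\<in>AU. pU x u) = 1"
  unfolding pU_def by (subst sum.swap) (simp add: sum_distrib_left [symmetric] sum_q sum_w)

text \<open>Change of measure: passing the test means \<open>w x y / (\<Gamma> * pY y) > 1\<close>,
  and this ratio has mean \<open>1 / \<Gamma>\<close> over a codeword drawn independently of
  \<open>y\<close>. If \<open>pY y = 0\<close>, only letters with \<open>p x = 0\<close> can
  pass.\<close>

lemma false_alarm_relay:
  assumes "\<Gamma> > 0"
  shows "(\<Sum>x\<in>AX. p x * of_bool (w x y > \<Gamma> * pY y)) \<le> 1 / \<Gamma>"
proof (cases "pY y = 0")
  case True
  then have "p x * w x y = 0" if "x \<in> AX" for x
    using that fin by (simp add: pY_def sum_nonneg_eq_0_iff nonneg)
  then have "p x * of_bool (w x y > \<Gamma> * pY y) = 0" if "x \<in> AX" for x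
    using that True by fastforce
  then have "(\<Sum>x\<in>AX. p x * of_bool (w x y > \<Gamma> * pY y)) = 0"
    by (intro sum.neutral ballI)
  then show ?thesis using assms by simp
next
  case False
  then have pos: "pY y > 0" using derived_nonneg(1)[of y] by simp
  have "p x * of_bool (w x y > \<Gamma> * pY y) \<le> p x * w x y / (\<Gamma> * pY y)" for x
  proof -
    have "of_bool (w x y > \<Gamma> * pY y) \<le> w x y / (\<Gamma> * pY y)"
      using assms pos nonneg(2)[of x y] by (simp add: pos_le_divide_eq)
    from mult_left_mono[OF this nonneg(1)[of x]] show ?thesis by simp
  qed
  then have "(\<Sum>x\<in>AX. p x * of_bool (w x y > \<Gamma> * pY y)) \<le> (\<Sum>x\<in>AX. p x * w x y / (\<Gamma> * pY y))"
    by (intro sum_mono)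
  also have "\<dots> = 1 / \<Gamma>"
    using pos by (simp add: sum_divide_distrib [symmetric] pY_def [symmetric])
  finally show ?thesis .
qed

text \<open>The same change of measure for a rival pair drawn from \<open>p x * pU x u\<close>
  independently of \<open>z\<close>.\<close>

lemma false_alarm_receiver:
  assumes "\<Gamma> > 0"
  shows "(\<Sum>x\<in>AX. \<Sum>u\<in>AU. p x * pU x u * of_bool (hit \<Gamma> x u z)) \<le> 1 / \<Gamma>"
proof (cases "pZ z = 0")
  case True
  have "p x * pU x u * of_bool (hit \<Gamma> x u z) = 0" if "x \<in> AX" "u \<in> AU" for x u
  proof -
    have "(\<Sum>u\<in>AU. pXUZ x u z) = 0"
      using True that fin by (simp add: pZ_def sum_nonneg_eq_0_iff sum_nonneg derived_nonneg)
    then have "pXUZ x u z = 0"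
      using that fin by (simp add: sum_nonneg_eq_0_iff derived_nonneg)
    then show ?thesis using True by (simp add: hit_def)
  qed
  then have "(\<Sum>x\<in>AX. \<Sum>u\<in>AU. p x * pU x u * of_bool (hit \<Gamma> x u z)) = 0"
    by (intro sum.neutral ballI)
  then show ?thesis using assms by simp
next
  case False
  then have pos: "pZ z > 0" using derived_nonneg(4)[of z] by simp
  have "p x * pU x u * of_bool (hit \<Gamma> x u z) \<le> pXUZ x u z / (\<Gamma> * pZ z)" for x u
    using assms pos derived_nonneg(3)[of x u z]
    by (auto simp: hit_def pos_le_divide_eq mult_ac less_imp_le)
  then have "(\<Sum>x\<in>AX. \<Sum>u\<in>AU. p x * pU x u * of_bool (hit \<Gamma> x u z))
      \<le> (\<Sum>x\<in>AX. \<Sum>u\<in>AU. pXUZ x u z / (\<Gamma> * pZ z))"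
    by (intro sum_mono)
  also have "\<dots> = 1 / \<Gamma>"
    using pos by (simp add: sum_divide_distrib [symmetric] pZ_def [symmetric])
  finally show ?thesis .
qed

text \<open>Candidates are drawn from \<open>pU x\<close>, but the target law is
  \<open>q x y\<close>. On good \<open>u\<close> the two differ by a factor of at most
  \<open>\<Gamma>\<close>, so one draw is good with probability at least
  \<open>a / \<Gamma>\<close>, where \<open>a\<close> is the mass that the target law gives to good
  \<open>u\<close>. All \<open>L\<close> draws then fail with probability at most
  \<open>exp (- (a * L / \<Gamma>))\<close>.\<close>

lemma covering:
  assumes \<Gamma>: "\<Gamma> > 0" and G: "\<And>u. G u \<Longrightarrow> q x y u \<le> \<Gamma> * pU x u"
  shows "(\<Sum>us\<in>words L AU. (\<Prod>l<L. pU x (us ! l)) * of_bool (\<not> (\<exists>l<L. G (us ! l))))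
       \<le> (\<Sum>u\<in>AU. q x y u * of_bool (\<not> G u)) + exp (- (L / \<Gamma>))"
proof -
  define a where "a = (\<Sum>u\<in>AU. q x y u * of_bool (G u))"
  define b where "b = (\<Sum>u\<in>AU. pU x u * of_bool (G u))"
  have a: "0 \<le> a" "a \<le> 1" and na: "(\<Sum>u\<in>AU. q x y u * of_bool (\<not> G u)) = 1 - a"
  proof -
    show "0 \<le> a" unfolding a_def by (intro sum_nonneg) (simp add: nonneg)
    have "(\<Sum>u\<in>AU. q x y u * of_bool (\<not> G u)) + a = (\<Sum>u\<in>AU. q x y u)"
      unfolding a_def sum.distrib [symmetric] by (intro sum.cong) auto
    then show eq: "(\<Sum>u\<in>AU. q x y u * of_bool (\<not> G u)) = 1 - a" by (simp add: sum_q)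
    have "0 \<le> (\<Sum>u\<in>AU. q x y u * of_bool (\<not> G u))" by (intro sum_nonneg) (simp add: nonneg)
    then show "a \<le> 1" using eq by simp
  qed
  have nb: "(\<Sum>u\<in>AU. pU x u * of_bool (\<not> G u)) = 1 - b"
  proof -
    have "(\<Sum>u\<in>AU. pU x u * of_bool (\<not> G u)) + b = (\<Sum>u\<in>AU. pU x u)"
      unfolding b_def sum.distrib [symmetric] by (intro sum.cong) auto
    then show ?thesis by (simp add: sum_pU)
  qed
  have nb0: "0 \<le> 1 - b" unfolding nb [symmetric] by (intro sum_nonneg) (simp add: derived_nonneg)
  have "a \<le> \<Gamma> * b" unfolding a_def b_def sum_distrib_left
    using G \<Gamma> by (intro sum_mono) auto
  then have ab: "a / \<Gamma> \<le> b" using \<Gamma> by (simp add: field_simps)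
  have "(\<Prod>l<L. pU x (us ! l)) * of_bool (\<not> (\<exists>l<L. G (us ! l)))
      = (\<Prod>l<L. pU x (us ! l) * of_bool (\<not> G (us ! l)))" for us
    by (simp add: prod.distrib) (auto intro: prod.neutral)
  then have "(\<Sum>us\<in>words L AU. (\<Prod>l<L. pU x (us ! l)) * of_bool (\<not> (\<exists>l<L. G (us ! l))))
      = (\<Prod>l<L. \<Sum>u\<in>AU. pU x u * of_bool (\<not> G u))"
    using sum_words_prod[where f = "\<lambda>_ u. pU x u * of_bool (\<not> G u)" and n = L and A = AU]
    by (simp only:)
  also have "\<dots> = (1 - b) ^ L" by (simp only: nb prod_constant card_lessThan)
  also have "\<dots> \<le> exp (- (a / \<Gamma>)) ^ L"
    using exp_ge_add_one_self[of "- (a / \<Gamma>)"] ab nb0 by (intro power_mono) auto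
  also have "\<dots> = exp (- (a * (L / \<Gamma>)))"
    by (simp add: exp_of_nat_mult [symmetric] mult_ac)
  also have "\<dots> \<le> 1 - a + exp (- (L / \<Gamma>))"
    using a \<Gamma> by (intro exp_neg_mult_le) auto
  finally show ?thesis by (simp add: na)
qed


text \<open>Each term is one cause of error. \<open>P1\<close> and \<open>M / \<Gamma>1\<close> are
  the miss and the false alarms of the relay's test; \<open>P2\<close> and the exponential belong to
  covering; \<open>M * L / \<Gamma>3\<close> is the false alarms at the receiver, which compares
  against \<open>L\<close> words for each rival. The receiver's miss probability \<open>P3\<close>
  is split by Markov's inequality into \<open>P3 / \<delta>\<close> and
  \<open>\<delta>\<close>.\<close>

theorem block_code_exists:
  fixes M L :: nat and \<Gamma>1 \<Gamma>2 \<Gamma>3 \<delta> :: real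
  assumes pos: "\<Gamma>1 > 0" "\<Gamma>2 > 0" "\<Gamma>3 > 0" "\<delta> > 0"
  defines "P1 \<equiv> \<Sum>x\<in>AX. \<Sum>y\<in>AY. p x * w x y * of_bool (w x y \<le> \<Gamma>1 * pY y)"
    and "P2 \<equiv> \<Sum>x\<in>AX. \<Sum>y\<in>AY. \<Sum>u\<in>AU. p x * w x y * q x y u * of_bool (q x y u > \<Gamma>2 * pU x u)"
    and "P3 \<equiv> \<Sum>x\<in>AX. \<Sum>u\<in>AU. \<Sum>z\<in>AZ. pXUZ x u z * of_bool (\<not> hit \<Gamma>3 x u z)"
  shows "\<exists>enc r dec. (\<forall>m\<in>{1..M}. enc m \<in> AX) \<and>
    (\<Sum>m\<in>{1..M}. \<Sum>y\<in>AY. \<Sum>z\<in>AZ. w (enc m) y * V (enc m) (r y) y z * of_bool (dec z \<noteq> Some m))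
     \<le> M * (P1 + P2 + P3 / \<delta> + exp (- (L / \<Gamma>2)) + \<delta> + M * (1 / \<Gamma>1 + L / \<Gamma>3))"
proof -
  define S where "S = AX \<times> words L AU"
  define ps where "ps = (\<lambda>(x, us). p x * (\<Prod>l<L. pU x (us ! l)))"
  define v where "v x y u z = V x (x, u) y z" for x y u z
  define miss where "miss x y u = (\<Sum>z\<in>AZ. v x y u z * of_bool (\<not> hit \<Gamma>3 x u z))" for x y u
  \<comment> \<open>A good \<open>u\<close> must also make the receiver's test succeed with high conditional probability;
    this replaces a Markov lemma.\<close>
  define good where "good x y u \<longleftrightarrow> q x y u \<le> \<Gamma>2 * pU x u \<and> miss x y u \<le> \<delta>" for x y u
  \<comment> \<open>Without a good candidate the selected index is arbitrary and may even be out of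
    range. That event is charged to \<open>a\<close>, and \<open>V\<close> is a kernel for every
    second argument.\<close>
  define sel where "sel = (\<lambda>(x, us) y. us ! (SOME l. l < L \<and> good x y (us ! l)))"
  \<comment> \<open>\<open>a\<close> collects the failures that involve only the sent message's own
    codeword, \<open>b\<close> those caused by one rival. This is the shape that
    \<open>random_codebook\<close> averages.\<close>
  define a where "a = (\<lambda>(x, us). (\<Sum>y\<in>AY. w x y * (of_bool (w x y \<le> \<Gamma>1 * pY y) +
      of_bool (\<not> (\<exists>l<L. good x y (us ! l))))) + \<delta>)"
  define b where "b = (\<lambda>(x, us) (x', us'). \<Sum>y\<in>AY. w x y * (of_bool (w x' y > \<Gamma>1 * pY y) +
      (\<Sum>z\<in>AZ. v x y (sel (x, us) y) z * (\<Sum>l<L. of_bool (hit \<Gamma>3 x' (us' ! l) z)))))"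
  have v0: "0 \<le> v x y u z" and v1: "(\<Sum>z\<in>AZ. v x y u z) = 1" for x y u z
    by (simp_all add: v_def nonneg sum_V)
  have finS: "finite S" using fin by (simp add: S_def)
  have ps0: "0 \<le> ps s" for s
    by (cases s) (auto simp: ps_def intro!: mult_nonneg_nonneg prod_nonneg nonneg derived_nonneg)
  have sum_S: "(\<Sum>s\<in>S. F s) = (\<Sum>x\<in>AX. \<Sum>us\<in>words L AU. F (x, us))" for F :: "_ \<Rightarrow> real"
    by (simp add: S_def sum.cartesian_product)
  have prod1: "(\<Sum>us\<in>words L AU. \<Prod>l<L. pU x (us ! l)) = 1" for x
    using sum_words_prod[where f = "\<lambda>_ u. pU x u" and n = L and A = AU] by (simp add: sum_pU)
  have margX: "(\<Sum>s\<in>S. ps s * F (fst s)) = (\<Sum>x\<in>AX. p x * F x)" for F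
    unfolding sum_S ps_def
    by (simp add: sum_distrib_right [symmetric] sum_distrib_left [symmetric] prod1)
  have margXU: "(\<Sum>s\<in>S. ps s * F (fst s) (snd s ! l)) = (\<Sum>x\<in>AX. \<Sum>u\<in>AU. p x * pU x u * F x u)"
    if "l < L" for F l
    unfolding sum_S ps_def using sum_words_prod_nth[OF sum_pU that]
    by (simp add: sum_distrib_left [symmetric] mult.assoc)
  have ps1: "sum ps S = 1" using margX[of "\<lambda>_. 1"] by (simp add: sum_p)

  have Ea: "(\<Sum>s\<in>S. ps s * a s) \<le> P1 + P2 + P3 / \<delta> + exp (- (L / \<Gamma>2)) + \<delta>"
  proof -
    let ?c = "\<lambda>x us y. of_bool (\<not> (\<exists>l<L. good x y (us ! l))) :: real"
    have "(\<Sum>s\<in>S. ps s * a s)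
        = (\<Sum>s\<in>S. ps s * (\<Sum>y\<in>AY. w (fst s) y * of_bool (w (fst s) y \<le> \<Gamma>1 * pY y)))
        + (\<Sum>s\<in>S. ps s * (\<Sum>y\<in>AY. w (fst s) y * ?c (fst s) (snd s) y)) + (\<Sum>s\<in>S. ps s * \<delta>)"
      unfolding sum.distrib [symmetric]
      by (intro sum.cong refl) (simp only: a_def split_def distrib_left sum.distrib)
    also have "(\<Sum>s\<in>S. ps s * \<delta>) = \<delta>" by (simp add: sum_distrib_right [symmetric] ps1)
    also have "(\<Sum>s\<in>S. ps s * (\<Sum>y\<in>AY. w (fst s) y * of_bool (w (fst s) y \<le> \<Gamma>1 * pY y))) = P1"
      unfolding P1_def
      by (subst margX[where F = "\<lambda>x. \<Sum>y\<in>AY. w x y * of_bool (w x y \<le> \<Gamma>1 * pY y)"])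
         (simp only: sum_distrib_left mult.assoc)
    also have "(\<Sum>s\<in>S. ps s * (\<Sum>y\<in>AY. w (fst s) y * ?c (fst s) (snd s) y))
        \<le> P2 + P3 / \<delta> + exp (- (L / \<Gamma>2))"
    proof -
      have "(\<Sum>s\<in>S. ps s * (\<Sum>y\<in>AY. w (fst s) y * ?c (fst s) (snd s) y))
         = (\<Sum>x\<in>AX. \<Sum>y\<in>AY. p x * w x y * (\<Sum>us\<in>words L AU. (\<Prod>l<L. pU x (us ! l)) * ?c x us y))"
        unfolding sum_S ps_def fst_conv snd_conv prod.case sum_distrib_left
        by (subst sum.swap) (simp only: mult_ac)
      also have "\<dots> \<le> (\<Sum>x\<in>AX. \<Sum>y\<in>AY. p x * w x y *
          ((\<Sum>u\<in>AU. q x y u * of_bool (\<not> good x y u)) + exp (- (L / \<Gamma>2))))"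
        by (intro sum_mono mult_left_mono covering mult_nonneg_nonneg nonneg pos) (simp add: good_def)
      also have "\<dots> = (\<Sum>x\<in>AX. \<Sum>y\<in>AY. p x * w x y * (\<Sum>u\<in>AU. q x y u * of_bool (\<not> good x y u)))
          + exp (- (L / \<Gamma>2))"
      proof -
        have "(\<Sum>x\<in>AX. \<Sum>y\<in>AY. p x * w x y * e) = e" for e :: real
          by (simp add: sum_distrib_right [symmetric] sum_distrib_left [symmetric] sum_w sum_p)
        then show ?thesis by (simp only: distrib_left sum.distrib)
      qed
      also have "(\<Sum>x\<in>AX. \<Sum>y\<in>AY. p x * w x y * (\<Sum>u\<in>AU. q x y u * of_bool (\<not> good x y u)))
          \<le> (\<Sum>x\<in>AX. \<Sum>y\<in>AY. p x * w x y *
              (\<Sum>u\<in>AU. q x y u * (of_bool (q x y u > \<Gamma>2 * pU x u) + miss x y u / \<delta>)))"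
      proof (intro sum_mono mult_left_mono mult_nonneg_nonneg nonneg)
        fix x y u
        have m0: "0 \<le> miss x y u" unfolding miss_def by (intro sum_nonneg) (simp add: v0)
        \<comment> \<open>Markov's inequality for \<open>miss\<close> at level
          \<open>\<delta>\<close>.\<close>
        show "of_bool (\<not> good x y u) \<le> of_bool (q x y u > \<Gamma>2 * pU x u) + miss x y u / \<delta>"
          using m0 pos by (auto simp: good_def pos_le_divide_eq)
      qed
      also have "\<dots> = P2 + (\<Sum>x\<in>AX. \<Sum>y\<in>AY. \<Sum>u\<in>AU. p x * w x y * q x y u * (miss x y u / \<delta>))"
        unfolding P2_def by (simp only: distrib_left sum.distrib sum_distrib_left mult.assoc)
      also have "(\<Sum>x\<in>AX. \<Sum>y\<in>AY. \<Sum>u\<in>AU. p x * w x y * q x y u * (miss x y u / \<delta>)) = P3 / \<delta>"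
      proof -
        have "(\<Sum>y\<in>AY. \<Sum>u\<in>AU. p x * w x y * q x y u * miss x y u)
            = (\<Sum>u\<in>AU. \<Sum>z\<in>AZ. pXUZ x u z * of_bool (\<not> hit \<Gamma>3 x u z))" for x
        proof -
          have "(\<Sum>y\<in>AY. \<Sum>u\<in>AU. p x * w x y * q x y u * miss x y u)
             = (\<Sum>u\<in>AU. \<Sum>y\<in>AY. \<Sum>z\<in>AZ. p x * w x y * q x y u * (v x y u z * of_bool (\<not> hit \<Gamma>3 x u z)))"
            unfolding miss_def sum_distrib_left by (rule sum.swap)
          also have "\<dots> = (\<Sum>u\<in>AU. \<Sum>z\<in>AZ. \<Sum>y\<in>AY. p x * w x y * q x y u * (v x y u z * of_bool (\<not> hit \<Gamma>3 x u z)))"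
            by (intro sum.cong refl sum.swap)
          also have "\<dots> = (\<Sum>u\<in>AU. \<Sum>z\<in>AZ. pXUZ x u z * of_bool (\<not> hit \<Gamma>3 x u z))"
            by (simp only: pXUZ_def v_def sum_distrib_right mult.assoc)
          finally show ?thesis .
        qed
        then show ?thesis
          unfolding P3_def by (simp add: times_divide_eq_right sum_divide_distrib [symmetric])
      qed
      finally show ?thesis by simp
    qed
    finally show ?thesis by simp
  qed

  \<comment> \<open>With \<open>s\<close> fixed, \<open>y\<close> and \<open>z\<close> are generated
    from \<open>s\<close> alone, because \<open>b\<close> uses the selection from the own codeword.
    The rival \<open>s'\<close> is independent of them, so both false alarm bounds apply inside the
    sum.\<close>
  have Eb: "(\<Sum>s'\<in>S. ps s' * b s s') \<le> 1 / \<Gamma>1 + L / \<Gamma>3" for s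
  proof -
    obtain x us where s: "s = (x, us)" by (cases s)
    have "(\<Sum>s'\<in>S. ps s' * b s s') = (\<Sum>y\<in>AY. w x y * ((\<Sum>s'\<in>S. ps s' * of_bool (w (fst s') y > \<Gamma>1 * pY y)) +
        (\<Sum>z\<in>AZ. v x y (sel s y) z * (\<Sum>l<L. \<Sum>s'\<in>S. ps s' * of_bool (hit \<Gamma>3 (fst s') (snd s' ! l) z)))))"
    proof -
      have "(\<Sum>s'\<in>S. ps s' * b s s') = (\<Sum>s'\<in>S. \<Sum>y\<in>AY. w x y * (ps s' * of_bool (w (fst s') y > \<Gamma>1 * pY y)) +
        (\<Sum>z\<in>AZ. \<Sum>l<L. w x y * (v x y (sel s y) z * (ps s' * of_bool (hit \<Gamma>3 (fst s') (snd s' ! l) z)))))"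
        by (intro sum.cong refl)
           (simp only: b_def s split_def fst_conv snd_conv distrib_left sum_distrib_left mult_ac)
      also have "\<dots> = (\<Sum>y\<in>AY. \<Sum>s'\<in>S. w x y * (ps s' * of_bool (w (fst s') y > \<Gamma>1 * pY y)) +
        (\<Sum>z\<in>AZ. \<Sum>l<L. w x y * (v x y (sel s y) z * (ps s' * of_bool (hit \<Gamma>3 (fst s') (snd s' ! l) z)))))"
        by (rule sum.swap)
      also have "\<dots> = (\<Sum>y\<in>AY. (\<Sum>s'\<in>S. w x y * (ps s' * of_bool (w (fst s') y > \<Gamma>1 * pY y))) +
        (\<Sum>z\<in>AZ. \<Sum>l<L. \<Sum>s'\<in>S. w x y * (v x y (sel s y) z * (ps s' * of_bool (hit \<Gamma>3 (fst s') (snd s' ! l) z)))))"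
        unfolding sum.distrib by (simp only: sum.swap[of _ AZ S] sum.swap[of _ "{..<L}" S])
      finally show ?thesis by (simp only: distrib_left sum_distrib_left)
    qed
    also have "\<dots> \<le> (\<Sum>y\<in>AY. w x y * (1 / \<Gamma>1 + (\<Sum>z\<in>AZ. v x y (sel s y) z * (\<Sum>l<L. 1 / \<Gamma>3))))"
    proof (intro sum_mono mult_left_mono add_mono nonneg v0)
      show "(\<Sum>s'\<in>S. ps s' * of_bool (w (fst s') y > \<Gamma>1 * pY y)) \<le> 1 / \<Gamma>1" for y
        using false_alarm_relay[OF pos(1)] margX[where F = "\<lambda>x. of_bool (w x y > \<Gamma>1 * pY y)"] by simp
      show "(\<Sum>s'\<in>S. ps s' * of_bool (hit \<Gamma>3 (fst s') (snd s' ! l) z)) \<le> 1 / \<Gamma>3"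
        if "l \<in> {..<L}" for l z
        using false_alarm_receiver[OF pos(3)] that
          margXU[of l "\<lambda>x u. of_bool (hit \<Gamma>3 x u z)"] by simp
    qed
    also have "\<dots> = 1 / \<Gamma>1 + L / \<Gamma>3"
      by (simp only: sum_distrib_right [symmetric] v1 sum_w sum_constant card_lessThan) simp
    finally show ?thesis .
  qed

  obtain c where c: "\<forall>m\<in>{1..M}. c m \<in> S"
    and cle: "(\<Sum>m\<in>{1..M}. a (c m) + (\<Sum>m'\<in>{1..M} - {m}. b (c m) (c m')))
      \<le> M * (P1 + P2 + P3 / \<delta> + exp (- (L / \<Gamma>2)) + \<delta> + M * (1 / \<Gamma>1 + L / \<Gamma>3))"
    using random_codebook[where b = b, OF finS ps0 ps1 _ Ea Eb, of "{1..M}"] pos by auto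

  define enc where "enc m = fst (c m)" for m
  define D where "D y = (SOME m. m \<in> {1..M} \<and> w (enc m) y > \<Gamma>1 * pY y)" for y
  define r where "r y = (enc (D y), sel (c (D y)) y)" for y
  define HT where "HT m z \<longleftrightarrow> (\<exists>l<L. hit \<Gamma>3 (enc m) (snd (c m) ! l) z)" for m z
  define dec where "dec z = Some (SOME m. m \<in> {1..M} \<and> HT m z)" for z
  have err: "(\<Sum>y\<in>AY. \<Sum>z\<in>AZ. w (enc m) y * V (enc m) (r y) y z * of_bool (dec z \<noteq> Some m))
      \<le> a (c m) + (\<Sum>m'\<in>{1..M} - {m}. b (c m) (c m'))" if m: "m \<in> {1..M}" for m
  proof -
    obtain x us where cm: "c m = (x, us)" by (cases "c m")
    then have encm: "enc m = x" by (simp add: enc_def)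
    let ?I = "{1..M} - {m}"
    let ?u = "\<lambda>y. sel (c m) y"
    have point: "(\<Sum>z\<in>AZ. V x (r y) y z * of_bool (dec z \<noteq> Some m))
       \<le> of_bool (w x y \<le> \<Gamma>1 * pY y) + of_bool (\<not> (\<exists>l<L. good x y (us ! l))) + \<delta>
         + (\<Sum>m'\<in>?I. of_bool (w (enc m') y > \<Gamma>1 * pY y) +
             (\<Sum>z\<in>AZ. v x y (?u y) z * (\<Sum>l<L. of_bool (hit \<Gamma>3 (enc m') (snd (c m') ! l) z))))" for y
    proof -
      \<comment> \<open>Only here does the true relay rule \<open>r\<close>, which depends on the
        whole codebook, disappear: if the relay decodes wrongly the error is bounded by one,
        otherwise its output is that of a relay informed of \<open>m\<close>.\<close>
      have 1: "(\<Sum>z\<in>AZ. V x (r y) y z * of_bool (dec z \<noteq> Some m))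
          \<le> of_bool (D y \<noteq> m) + (\<Sum>z\<in>AZ. v x y (?u y) z * of_bool (dec z \<noteq> Some m))"
      proof (cases "D y = m")
        case True
        then show ?thesis by (simp add: r_def v_def encm)
      next
        case False
        have "(\<Sum>z\<in>AZ. V x (r y) y z * of_bool (dec z \<noteq> Some m)) \<le> (\<Sum>z\<in>AZ. V x (r y) y z)"
          by (intro sum_mono) (simp add: nonneg)
        moreover have "0 \<le> (\<Sum>z\<in>AZ. v x y (?u y) z * of_bool (dec z \<noteq> Some m))"
          by (intro sum_nonneg) (simp add: v0)
        ultimately show ?thesis using False by (simp add: sum_V)
      qed
      have 2: "of_bool (D y \<noteq> m) \<le> of_bool (w x y \<le> \<Gamma>1 * pY y) + (\<Sum>m'\<in>?I. of_bool (w (enc m') y > \<Gamma>1 * pY y) :: real)"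
        using some_decoder_error[OF _ m, of "\<lambda>m. w (enc m) y > \<Gamma>1 * pY y"]
        by (simp add: D_def encm not_less)
      have dec_le: "of_bool (dec z \<noteq> Some m) \<le> of_bool (\<not> HT m z) +
          (\<Sum>m'\<in>?I. \<Sum>l<L. of_bool (hit \<Gamma>3 (enc m') (snd (c m') ! l) z) :: real)" for z
      proof -
        have "of_bool (dec z \<noteq> Some m) \<le> of_bool (\<not> HT m z) + (\<Sum>m'\<in>?I. of_bool (HT m' z) :: real)"
          using some_decoder_error[OF _ m, of "\<lambda>m. HT m z"] by (simp add: dec_def)
        also have "(\<Sum>m'\<in>?I. of_bool (HT m' z) :: real)
            \<le> (\<Sum>m'\<in>?I. \<Sum>l<L. of_bool (hit \<Gamma>3 (enc m') (snd (c m') ! l) z))"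
        proof (intro sum_mono)
          fix m'
          show "(of_bool (HT m' z) :: real) \<le> (\<Sum>l<L. of_bool (hit \<Gamma>3 (enc m') (snd (c m') ! l) z))"
          proof (cases "HT m' z")
            case True
            then obtain l where l: "l < L" "hit \<Gamma>3 (enc m') (snd (c m') ! l) z" by (auto simp: HT_def)
            have "(of_bool (hit \<Gamma>3 (enc m') (snd (c m') ! l) z) :: real)
               \<le> (\<Sum>l<L. of_bool (hit \<Gamma>3 (enc m') (snd (c m') ! l) z))"
              using l by (intro member_le_sum) auto
            then show ?thesis using l True by simp
          qed (simp add: sum_nonneg)
        qed
        finally show ?thesis by simp
      qed
      have 3: "(\<Sum>z\<in>AZ. v x y (?u y) z * of_bool (\<not> HT m z)) \<le> of_bool (\<not> (\<exists>l<L. good x y (us ! l))) + \<delta>"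
      proof (cases "\<exists>l<L. good x y (us ! l)")
        case True
        define l where "l = (SOME l. l < L \<and> good x y (us ! l))"
        have l: "l < L \<and> good x y (us ! l)" unfolding l_def using True by (rule someI_ex)
        have u: "?u y = us ! l" by (simp add: sel_def cm l_def)
        have "(\<Sum>z\<in>AZ. v x y (?u y) z * of_bool (\<not> HT m z)) \<le> miss x y (us ! l)"
          unfolding miss_def u using l
          by (intro sum_mono mult_left_mono v0) (auto simp: HT_def cm encm)
        then show ?thesis using l True by (auto simp: good_def)
      next
        case False
        have "(\<Sum>z\<in>AZ. v x y (?u y) z * of_bool (\<not> HT m z)) \<le> (\<Sum>z\<in>AZ. v x y (?u y) z)"
          by (intro sum_mono) (simp add: v0)
        then show ?thesis using False pos by (simp add: v1)
      qed
      have "(\<Sum>z\<in>AZ. v x y (?u y) z * of_bool (dec z \<noteq> Some m))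
         \<le> (\<Sum>z\<in>AZ. v x y (?u y) z * (of_bool (\<not> HT m z) +
          (\<Sum>m'\<in>?I. \<Sum>l<L. of_bool (hit \<Gamma>3 (enc m') (snd (c m') ! l) z))))"
        by (intro sum_mono mult_left_mono v0 dec_le)
      also have "\<dots> = (\<Sum>z\<in>AZ. v x y (?u y) z * of_bool (\<not> HT m z)) +
          (\<Sum>m'\<in>?I. \<Sum>z\<in>AZ. v x y (?u y) z * (\<Sum>l<L. of_bool (hit \<Gamma>3 (enc m') (snd (c m') ! l) z)))"
        unfolding distrib_left sum.distrib sum_distrib_left by (simp only: sum.swap[of _ "?I" AZ])
      finally show ?thesis using 1 2 3 unfolding sum.distrib by linarith
    qed
    have "(\<Sum>y\<in>AY. \<Sum>z\<in>AZ. w (enc m) y * V (enc m) (r y) y z * of_bool (dec z \<noteq> Some m))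
       = (\<Sum>y\<in>AY. w x y * (\<Sum>z\<in>AZ. V x (r y) y z * of_bool (dec z \<noteq> Some m)))"
      by (simp only: encm sum_distrib_left mult.assoc)
    also have "\<dots> \<le> (\<Sum>y\<in>AY. w x y * (of_bool (w x y \<le> \<Gamma>1 * pY y) + of_bool (\<not> (\<exists>l<L. good x y (us ! l))) + \<delta>
         + (\<Sum>m'\<in>?I. of_bool (w (enc m') y > \<Gamma>1 * pY y) +
             (\<Sum>z\<in>AZ. v x y (?u y) z * (\<Sum>l<L. of_bool (hit \<Gamma>3 (enc m') (snd (c m') ! l) z))))))"
      by (intro sum_mono mult_left_mono point nonneg)
    also have "\<dots> = (\<Sum>y\<in>AY. w x y * (of_bool (w x y \<le> \<Gamma>1 * pY y) + of_bool (\<not> (\<exists>l<L. good x y (us ! l)))))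
         + (\<Sum>y\<in>AY. w x y * \<delta>)
         + (\<Sum>m'\<in>?I. \<Sum>y\<in>AY. w x y * (of_bool (w (enc m') y > \<Gamma>1 * pY y) +
             (\<Sum>z\<in>AZ. v x y (?u y) z * (\<Sum>l<L. of_bool (hit \<Gamma>3 (enc m') (snd (c m') ! l) z)))))"
      unfolding sum.swap[of _ AY ?I] by (simp only: distrib_left sum.distrib sum_distrib_left[of _ _ ?I])
    also have "(\<Sum>y\<in>AY. w x y * \<delta>) = \<delta>" by (simp add: sum_distrib_right [symmetric] sum_w)
    finally show ?thesis by (simp only: a_def b_def split_def cm fst_conv snd_conv enc_def)
  qed
  have "(\<Sum>m\<in>{1..M}. \<Sum>y\<in>AY. \<Sum>z\<in>AZ. w (enc m) y * V (enc m) (r y) y z * of_bool (dec z \<noteq> Some m))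
      \<le> (\<Sum>m\<in>{1..M}. a (c m) + (\<Sum>m'\<in>{1..M} - {m}. b (c m) (c m')))"
    by (intro sum_mono err)
  with cle have "(\<Sum>m\<in>{1..M}. \<Sum>y\<in>AY. \<Sum>z\<in>AZ. w (enc m) y * V (enc m) (r y) y z * of_bool (dec z \<noteq> Some m))
     \<le> M * (P1 + P2 + P3 / \<delta> + exp (- (L / \<Gamma>2)) + \<delta> + M * (1 / \<Gamma>1 + L / \<Gamma>3))"
    by linarith
  moreover have "\<forall>m\<in>{1..M}. enc m \<in> AX" using c by (auto simp: S_def enc_def)
  ultimately show ?thesis by blast
qed

end

subsection \<open>Memoryless extensions\<close>

text \<open>Chernoff's device: on the event the ratio of the products is at least one, so its power
  \<open>s\<close> dominates the indicator, and that power factors over the letters.\<close>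

lemma prod_indicator_le:
  fixes P N D :: "nat \<Rightarrow> real"
  assumes P: "\<And>i. i < n \<Longrightarrow> 0 \<le> P i" and ND: "\<And>i. i < n \<Longrightarrow> P i > 0 \<Longrightarrow> N i > 0 \<and> D i > 0"
    and c: "c > 0" and s: "s \<ge> 0"
  shows "(\<Prod>i<n. P i) * of_bool ((\<Prod>i<n. D i) \<le> c ^ n * (\<Prod>i<n. N i))
       \<le> (\<Prod>i<n. P i * (c * N i / D i) powr s)"
proof (cases "(\<exists>i<n. P i = 0) \<or> \<not> (\<Prod>i<n. D i) \<le> c ^ n * (\<Prod>i<n. N i)")
  case True
  then have eq0: "(\<Prod>i<n. P i) * of_bool ((\<Prod>i<n. D i) \<le> c ^ n * (\<Prod>i<n. N i)) = 0"
    by auto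
  show ?thesis unfolding eq0 using P by (intro prod_nonneg) auto
next
  case False
  then have pos: "P i > 0" "N i > 0" "D i > 0" if "i < n" for i
    using that P[of i] ND[of i] by (auto simp: less_le)
  have "(\<Prod>i<n. c * N i / D i) = c ^ n * (\<Prod>i<n. N i) / (\<Prod>i<n. D i)"
    by (simp add: prod_dividef prod.distrib)
  also have "\<dots> \<ge> 1"
    using False prod_pos[of "{..<n}" D] pos by (simp add: pos_le_divide_eq)
  finally have "1 \<le> (\<Prod>i<n. c * N i / D i) powr s"
    using s by (simp add: ge_one_powr_ge_zero)
  also have "\<dots> = (\<Prod>i<n. (c * N i / D i) powr s)"
    using pos c by (simp add: prod_powr_distrib less_imp_le)
  finally have "(\<Prod>i<n. P i) * 1 \<le> (\<Prod>i<n. P i) * (\<Prod>i<n. (c * N i / D i) powr s)"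
    using P by (intro mult_left_mono prod_nonneg) auto
  then show ?thesis using False by (simp add: prod.distrib)
qed

text \<open>As a function of \<open>s\<close> the sum equals 1 at zero and has there the derivative
  given by the mean of \<open>ln (r a)\<close>. A negative mean therefore pushes it below 1 for
  small positive \<open>s\<close>.\<close>

lemma chernoff_exponent:
  fixes P r :: "'a \<Rightarrow> real"
  assumes fin: "finite A" and P: "\<And>a. a \<in> A \<Longrightarrow> 0 \<le> P a" "sum P A = 1"
    and r: "\<And>a. a \<in> A \<Longrightarrow> P a > 0 \<Longrightarrow> r a > 0"
    and neg: "(\<Sum>a\<in>A. P a * ln (r a)) < 0"
  shows "\<exists>s>0. (\<Sum>a\<in>A. P a * r a powr s) < 1"
proof -
  \<comment> \<open>Off the support of \<open>P\<close> the ratio \<open>r\<close> need not be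
    positive, so \<open>r a powr s\<close> must be removed before differentiating.\<close>
  define A' where "A' = {a \<in> A. P a > 0}"
  have eq: "(\<Sum>a\<in>A. P a * g a) = (\<Sum>a\<in>A'. P a * g a)" for g
    using fin P(1) by (intro sum.mono_neutral_right) (auto simp: A'_def less_le)
  have D: "((\<lambda>s. P a * r a powr s) has_real_derivative P a * ln (r a)) (at 0)" if "a \<in> A'" for a
  proof -
    have "r a > 0" using that r by (auto simp: A'_def)
    then show ?thesis by (auto intro!: derivative_eq_intros)
  qed
  have "((\<lambda>s. \<Sum>a\<in>A'. P a * r a powr s) has_real_derivative (\<Sum>a\<in>A'. P a * ln (r a))) (at 0)"
    by (intro DERIV_sum D)
  moreover have "(\<Sum>a\<in>A'. P a * ln (r a)) < 0" using neg eq by simp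
  ultimately obtain d where d: "d > 0"
    "\<And>h. h > 0 \<Longrightarrow> h < d \<Longrightarrow> (\<Sum>a\<in>A'. P a * r a powr (0 + h)) < (\<Sum>a\<in>A'. P a * r a powr 0)"
    using DERIV_neg_dec_right by blast
  have "(\<Sum>a\<in>A'. P a * r a powr 0) = (\<Sum>a\<in>A'. P a * 1)"
    using r by (intro sum.cong) (force simp: A'_def)+
  also have "\<dots> = 1" using eq[of "\<lambda>_. 1"] P(2) by simp
  finally show ?thesis using d(2)[of "d / 2"] d(1) eq
    by (intro exI[of _ "d / 2"]) auto
qed

lemma sum_words3:
  fixes F :: "'a \<Rightarrow> 'b \<Rightarrow> 'c \<Rightarrow> real"
  shows "(\<Sum>xs\<in>words n A. \<Sum>ys\<in>words n B. \<Sum>zs\<in>words n C. \<Prod>i<n. F (xs ! i) (ys ! i) (zs ! i))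
       = (\<Sum>x\<in>A. \<Sum>y\<in>B. \<Sum>z\<in>C. F x y z) ^ n"
proof -
  have "(\<Sum>xs\<in>words n A. \<Sum>ys\<in>words n B. \<Sum>zs\<in>words n C. \<Prod>i<n. F (xs ! i) (ys ! i) (zs ! i))
      = (\<Sum>xs\<in>words n A. \<Sum>ys\<in>words n B. \<Prod>i<n. \<Sum>z\<in>C. F (xs ! i) (ys ! i) z)"
    by (intro sum.cong refl sum_words_prod[where f = "\<lambda>i. F (_ ! i) (_ ! i)"])
  also have "\<dots> = (\<Sum>xs\<in>words n A. \<Prod>i<n. \<Sum>y\<in>B. \<Sum>z\<in>C. F (xs ! i) y z)"
    by (intro sum.cong refl sum_words_prod[where f = "\<lambda>i y. \<Sum>z\<in>C. F (_ ! i) y z"])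
  also have "\<dots> = (\<Prod>i<n. \<Sum>x\<in>A. \<Sum>y\<in>B. \<Sum>z\<in>C. F x y z)"
    by (rule sum_words_prod)
  finally show ?thesis by simp
qed

lemma chernoff_words:
  fixes P N D :: "'a \<Rightarrow> 'b \<Rightarrow> 'c \<Rightarrow> real"
  assumes fin: "finite A" "finite B" "finite C"
    and P: "\<And>x y z. 0 \<le> P x y z" "(\<Sum>x\<in>A. \<Sum>y\<in>B. \<Sum>z\<in>C. P x y z) = 1"
    and ND: "\<forall>x\<in>A. \<forall>y\<in>B. \<forall>z\<in>C. P x y z > 0 \<longrightarrow> N x y z > 0 \<and> D x y z > 0"
    and gap: "\<gamma> < (\<Sum>x\<in>A. \<Sum>y\<in>B. \<Sum>z\<in>C. P x y z * log 2 (D x y z / N x y z))"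
  shows "\<exists>\<rho>. 0 < \<rho> \<and> \<rho> < 1 \<and> (\<forall>n. (\<Sum>xs\<in>words n A. \<Sum>ys\<in>words n B. \<Sum>zs\<in>words n C.
      (\<Prod>i<n. P (xs ! i) (ys ! i) (zs ! i)) *
      of_bool ((\<Prod>i<n. D (xs ! i) (ys ! i) (zs ! i)) \<le> (2 powr \<gamma>) ^ n * (\<Prod>i<n. N (xs ! i) (ys ! i) (zs ! i)))) \<le> \<rho> ^ n)"
proof -
  define T where "T = A \<times> B \<times> C"
  define P' where "P' = (\<lambda>(x, y, z). P x y z)"
  define r where "r = (\<lambda>(x, y, z). 2 powr \<gamma> * N x y z / D x y z)"
  have sumT: "(\<Sum>t\<in>T. F t) = (\<Sum>x\<in>A. \<Sum>y\<in>B. \<Sum>z\<in>C. F (x, y, z))" for F :: "_ \<Rightarrow> real"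
    by (simp add: T_def sum.cartesian_product)
  have "P x y z * ln (r (x, y, z)) = (P x y z * \<gamma> - P x y z * log 2 (D x y z / N x y z)) * ln 2"
    if "x \<in> A" "y \<in> B" "z \<in> C" for x y z
  proof (cases "P x y z = 0")
    case False
    then have "P x y z > 0" using P(1)[of x y z] by simp
    then have "N x y z > 0" "D x y z > 0" using ND that by auto
    then show ?thesis
      by (simp add: r_def ln_mult ln_div ln_powr log_def field_simps)
  qed simp
  then have "(\<Sum>t\<in>T. P' t * ln (r t))
     = (\<Sum>x\<in>A. \<Sum>y\<in>B. \<Sum>z\<in>C. (P x y z * \<gamma> - P x y z * log 2 (D x y z / N x y z)) * ln 2)"
    unfolding sumT P'_def by (intro sum.cong refl) auto
  also have "\<dots> = (\<gamma> - (\<Sum>x\<in>A. \<Sum>y\<in>B. \<Sum>z\<in>C. P x y z * log 2 (D x y z / N x y z))) * ln 2"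
    by (simp only: sum_distrib_right [symmetric] sum_subtractf P(2)) simp
  also have "\<dots> < 0" using gap by (simp add: mult_less_0_iff)
  finally have "\<exists>s>0. (\<Sum>t\<in>T. P' t * r t powr s) < 1"
    using fin P ND by (intro chernoff_exponent) (auto simp: T_def P'_def r_def sum.cartesian_product split_def)
  then obtain s where s: "s > 0" "(\<Sum>t\<in>T. P' t * r t powr s) < 1" by blast
  define \<rho>0 where "\<rho>0 = (\<Sum>t\<in>T. P' t * r t powr s)"
  have \<rho>0: "0 \<le> \<rho>0" "\<rho>0 < 1" using s P(1)
    by (auto simp: \<rho>0_def P'_def split_def intro!: sum_nonneg)
  have bound: "(\<Sum>xs\<in>words n A. \<Sum>ys\<in>words n B. \<Sum>zs\<in>words n C.
      (\<Prod>i<n. P (xs ! i) (ys ! i) (zs ! i)) *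
      of_bool ((\<Prod>i<n. D (xs ! i) (ys ! i) (zs ! i)) \<le> (2 powr \<gamma>) ^ n * (\<Prod>i<n. N (xs ! i) (ys ! i) (zs ! i)))) \<le> \<rho>0 ^ n" for n
  proof -
    have "(\<Sum>xs\<in>words n A. \<Sum>ys\<in>words n B. \<Sum>zs\<in>words n C.
      (\<Prod>i<n. P (xs ! i) (ys ! i) (zs ! i)) *
      of_bool ((\<Prod>i<n. D (xs ! i) (ys ! i) (zs ! i)) \<le> (2 powr \<gamma>) ^ n * (\<Prod>i<n. N (xs ! i) (ys ! i) (zs ! i))))
      \<le> (\<Sum>xs\<in>words n A. \<Sum>ys\<in>words n B. \<Sum>zs\<in>words n C. \<Prod>i<n. P (xs ! i) (ys ! i) (zs ! i)
          * (2 powr \<gamma> * N (xs ! i) (ys ! i) (zs ! i) / D (xs ! i) (ys ! i) (zs ! i)) powr s)"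
      using P(1) ND s(1) by (intro sum_mono prod_indicator_le) (auto simp: nth_words)
    also have "\<dots> = \<rho>0 ^ n"
      by (subst sum_words3[where F = "\<lambda>x y z. P x y z * (2 powr \<gamma> * N x y z / D x y z) powr s"])
         (simp add: \<rho>0_def sumT P'_def r_def)
    finally show ?thesis .
  qed
  \<comment> \<open>The base may be zero; the maximum with \<open>1/2\<close> makes it positive,
    which is needed where a power of its square root serves as the level
    \<open>\<delta>\<close>.\<close>
  have "\<rho>0 ^ n \<le> (max \<rho>0 (1/2)) ^ n" for n using \<rho>0 by (intro power_mono) auto
  with bound \<rho>0 show ?thesis
    by (intro exI[of _ "max \<rho>0 (1/2)"]) (auto intro: order_trans)
qed

lemma exp_minus_le_inverse: "0 < (t::real) \<Longrightarrow> exp (- t) \<le> 1 / t"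
  using exp_ge_add_one_self[of t] le_imp_inverse_le[of t "exp t"]
  by (simp only: exp_minus inverse_eq_divide)

lemma nat_ceiling_le_double:
  assumes "1 \<le> (t::real)"
  shows "real (nat \<lceil>t\<rceil>) \<le> 2 * t" "t \<le> real (nat \<lceil>t\<rceil>)"
  using assms by linarith+

section \<open>Exponential error decay below the information thresholds\<close>

context relay_block
begin

text \<open>These are \<open>I(X;Y)\<close>, \<open>I(Y;U|X)\<close> and \<open>I(X,U;Z)\<close>.
  The sum over \<open>u\<close> in \<open>info1\<close> gives all three the three-letter shape of
  \<open>chernoff_words\<close>.\<close>

definition "info1 = (\<Sum>x\<in>AX. \<Sum>y\<in>AY. \<Sum>u\<in>AU. p x * w x y * q x y u * log 2 (w x y / pY y))"
definition "info2 = (\<Sum>x\<in>AX. \<Sum>y\<in>AY. \<Sum>u\<in>AU. p x * w x y * q x y u * log 2 (q x y u / pU x u))"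
definition "info3 = (\<Sum>x\<in>AX. \<Sum>u\<in>AU. \<Sum>z\<in>AZ. pXUZ x u z * log 2 (pXUZ x u z / (p x * pU x u * pZ z)))"

lemma pU_pos:
  assumes "y \<in> AY" "w x y * q x y u > 0"
  shows "pU x u > 0"
  unfolding pU_def using assms fin nonneg by (intro sum_pos2[of _ y]) auto

lemma pY_pos:
  assumes "x \<in> AX" "p x * w x y > 0"
  shows "pY y > 0"
  unfolding pY_def using assms fin nonneg by (intro sum_pos2[of _ x]) auto

lemma pXUZ_pos:
  assumes "x \<in> AX" "u \<in> AU" "pXUZ x u z > 0"
  shows "p x > 0" "pU x u > 0" "pZ z > 0"
proof -
  obtain y where y: "y \<in> AY" "p x * w x y * q x y u * V x (x, u) y z \<noteq> 0"
    using assms(3) sum.neutral[of AY "\<lambda>y. p x * w x y * q x y u * V x (x, u) y z"]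
    unfolding pXUZ_def by fastforce
  then show "p x > 0" using nonneg(1)[of x] by (simp add: less_le)
  show "pU x u > 0" using y nonneg(2)[of x y] nonneg(3)[of x y u] by (intro pU_pos[of y]) (auto simp: less_le)
  have "pXUZ x u z \<le> (\<Sum>u\<in>AU. pXUZ x u z)"
    using assms fin derived_nonneg by (intro member_le_sum) auto
  also have "\<dots> \<le> pZ z"
    unfolding pZ_def using assms fin derived_nonneg
    by (intro member_le_sum[where f = "\<lambda>x. \<Sum>u\<in>AU. pXUZ x u z"] sum_nonneg) auto
  finally show "pZ z > 0" using assms(3) by simp
qed

text \<open>A mean of relative entropies of \<open>q x y\<close> from \<open>pU x\<close>. It
  ensures that the exponent of the number of auxiliary words is positive.\<close>

lemma info2_nonneg: "0 \<le> info2"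
proof -
  have "0 \<le> (\<Sum>u\<in>AU. p x * w x y * q x y u * log 2 (q x y u / pU x u))" if "y \<in> AY" for x y
  proof (cases "w x y = 0")
    case False
    then have wpos: "w x y > 0" using nonneg(2)[of x y] by simp
    have "(\<Sum>u\<in>AU. q x y u * log 2 (pU x u / q x y u)) \<le> 0"
      using that wpos by (intro gibbs) (auto simp: nonneg derived_nonneg sum_q sum_pU intro!: pU_pos[of y])
    moreover have "q x y u * log 2 (pU x u / q x y u) = - (q x y u * log 2 (q x y u / pU x u))" for u
    proof (cases "q x y u = 0")
      case False
      then have "q x y u > 0" using nonneg(3)[of x y u] by simp
      moreover from this have "pU x u > 0" using that wpos by (intro pU_pos[of y]) auto
      ultimately show ?thesis by (simp add: log_divide algebra_simps)
    qed simp
    ultimately have "0 \<le> (\<Sum>u\<in>AU. q x y u * log 2 (q x y u / pU x u))" by (simp add: sum_negf)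
    then have "0 \<le> p x * w x y * (\<Sum>u\<in>AU. q x y u * log 2 (q x y u / pU x u))"
      using nonneg by simp
    then show ?thesis by (simp add: sum_distrib_left mult.assoc)
  qed simp
  then show ?thesis unfolding info2_def by (intro sum_nonneg[of AX] sum_nonneg[of AY])
qed

text \<open>Product kernels on words satisfy the same locale, so the one-block theorem applies
  verbatim with words as letters.\<close>

lemma iid_extension:
  defines "pn \<equiv> \<lambda>n xs. \<Prod>i<n. p (xs ! i)" and "wn \<equiv> \<lambda>n xs ys. \<Prod>i<n. w (xs ! i) (ys ! i)"
    and "qn \<equiv> \<lambda>n xs ys us. \<Prod>i<n. q (xs ! i) (ys ! i) (us ! i)"
    and "Vn \<equiv> \<lambda>n xs r ys zs. \<Prod>i<n. V (xs ! i) (fst r ! i, snd r ! i) (ys ! i) (zs ! i)"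
  shows "relay_block (words n AX) (words n AY) (words n AU) (words n AZ) (pn n) (wn n) (qn n) (Vn n)"
proof
  show "(\<Sum>x\<in>words n AX. pn n x) = 1"
    unfolding pn_def by (simp add: sum_words_prod[where f = "\<lambda>_. p"] sum_p)
  show "(\<Sum>y\<in>words n AY. wn n x y) = 1" for x
    unfolding wn_def by (simp add: sum_words_prod[where f = "\<lambda>i. w (x ! i)"] sum_w)
  show "(\<Sum>u\<in>words n AU. qn n x y u) = 1" for x y
    unfolding qn_def by (simp add: sum_words_prod[where f = "\<lambda>i. q (x ! i) (y ! i)"] sum_q)
  show "(\<Sum>z\<in>words n AZ. Vn n x r y z) = 1" for x r y
    unfolding Vn_def
    by (simp add: sum_words_prod[where f = "\<lambda>i. V (x ! i) (fst r ! i, snd r ! i) (y ! i)"] sum_V)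
qed (auto simp: fin pn_def wn_def qn_def Vn_def intro!: prod_nonneg nonneg)

theorem iid_codes_exist:
  assumes R: "0 < R" "R < info1" "R < info3 - info2"
  shows "\<exists>\<epsilon>. \<epsilon> \<longlonglongrightarrow> 0 \<and> (\<forall>n M. real M \<le> 2 * 2 powr (real n * R) \<longrightarrow> (\<exists>enc r dec.
     (\<forall>m\<in>{1..M}. enc m \<in> words n AX) \<and>
     (\<Sum>m\<in>{1..M}. \<Sum>ys\<in>words n AY. \<Sum>zs\<in>words n AZ. (\<Prod>i<n. w (enc m ! i) (ys ! i)) *
        (\<Prod>i<n. V (enc m ! i) (fst (r ys) ! i, snd (r ys) ! i) (ys ! i) (zs ! i)) * of_bool (dec zs \<noteq> Some m))
      \<le> real M * \<epsilon> n))"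
proof -
  \<comment> \<open>The gap to the second bound is cut into five parts. With
    \<open>\<gamma>2 = info2 + d\<close> and \<open>\<kappa> = info2 + 2 * d\<close>,
    \<open>L\<close> exceeds the covering threshold by the exponent \<open>d\<close>; with
    \<open>\<gamma>3 = info3 - d\<close>, the receiver's false alarms keep the exponent
    \<open>R + \<kappa> - \<gamma>3 = - 2 * d\<close>. For the relay's test the midpoint of
    \<open>R\<close> and \<open>info1\<close> does.\<close>
  define d where "d = (info3 - info2 - R) / 5"
  define \<gamma>1 where "\<gamma>1 = (R + info1) / 2"
  define \<gamma>2 where "\<gamma>2 = info2 + d"
  define \<gamma>3 where "\<gamma>3 = info3 - d"
  define \<kappa> where "\<kappa> = info2 + 2 * d"
  have d: "d > 0" using R by (simp add: d_def)
  have \<kappa>: "\<kappa> > 0" using d info2_nonneg by (simp add: \<kappa>_def)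
  have sumP: "(\<Sum>x\<in>AX. \<Sum>y\<in>AY. \<Sum>u\<in>AU. p x * w x y * q x y u) = 1"
    by (simp add: sum_distrib_left [symmetric] sum_q sum_w sum_p)
  have sumPXUZ: "(\<Sum>x\<in>AX. \<Sum>u\<in>AU. \<Sum>z\<in>AZ. pXUZ x u z) = 1"
  proof -
    have "(\<Sum>u\<in>AU. \<Sum>z\<in>AZ. pXUZ x u z) = (\<Sum>u\<in>AU. \<Sum>y\<in>AY. \<Sum>z\<in>AZ. p x * w x y * q x y u * V x (x, u) y z)" for x
      unfolding pXUZ_def by (intro sum.cong refl sum.swap)
    also have "\<dots> x = (\<Sum>u\<in>AU. \<Sum>y\<in>AY. p x * w x y * q x y u)" for x
      by (simp add: sum_distrib_left [symmetric] sum_V)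
    also have "\<dots> x = (\<Sum>y\<in>AY. \<Sum>u\<in>AU. p x * w x y * q x y u)" for x by (rule sum.swap)
    finally show ?thesis using sumP by simp
  qed
  have P0: "0 \<le> p x * w x y * q x y u" for x y u by (simp add: nonneg)
  have posP: "p x > 0" "w x y > 0" "q x y u > 0" if "p x * w x y * q x y u > 0" for x y u
    using that nonneg(1)[of x] nonneg(2)[of x y] nonneg(3)[of x y u] by (auto simp: less_le)
  obtain \<rho>1 where \<rho>1: "0 < \<rho>1" "\<rho>1 < 1" "\<And>n. (\<Sum>xs\<in>words n AX. \<Sum>ys\<in>words n AY. \<Sum>us\<in>words n AU.
      (\<Prod>i<n. p (xs ! i) * w (xs ! i) (ys ! i) * q (xs ! i) (ys ! i) (us ! i)) *
      of_bool ((\<Prod>i<n. w (xs ! i) (ys ! i)) \<le> (2 powr \<gamma>1) ^ n * (\<Prod>i<n. pY (ys ! i)))) \<le> \<rho>1 ^ n"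
  proof -
    have gap: "\<gamma>1 < (\<Sum>x\<in>AX. \<Sum>y\<in>AY. \<Sum>u\<in>AU. p x * w x y * q x y u * log 2 (w x y / pY y))"
      using R by (simp add: \<gamma>1_def info1_def)
    have "\<forall>x\<in>AX. \<forall>y\<in>AY. \<forall>u\<in>AU. p x * w x y * q x y u > 0 \<longrightarrow> pY y > 0 \<and> w x y > 0"
    proof (intro ballI impI)
      fix x y u assume a: "x \<in> AX" "y \<in> AY" "u \<in> AU" "p x * w x y * q x y u > 0"
      show "pY y > 0 \<and> w x y > 0" using posP[OF a(4)] pY_pos[OF a(1), of y] by simp
    qed
    from chernoff_words[where P = "\<lambda>x y u. p x * w x y * q x y u" and N = "\<lambda>x y u. pY y" and D = "\<lambda>x y u. w x y",
        OF fin(1-3) P0 sumP this gap]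
    show thesis by (elim exE conjE) (erule that, assumption, erule spec)
  qed
  \<comment> \<open>The bad event is a large ratio of \<open>q\<close> to \<open>pU\<close>, whereas
    \<open>chernoff_words\<close> treats small ratios; hence numerator and denominator are exchanged
    and the threshold becomes \<open>- \<gamma>2\<close>.\<close>
  obtain \<rho>2 where \<rho>2: "0 < \<rho>2" "\<rho>2 < 1" "\<And>n. (\<Sum>xs\<in>words n AX. \<Sum>ys\<in>words n AY. \<Sum>us\<in>words n AU.
      (\<Prod>i<n. p (xs ! i) * w (xs ! i) (ys ! i) * q (xs ! i) (ys ! i) (us ! i)) *
      of_bool ((\<Prod>i<n. pU (xs ! i) (us ! i)) \<le> (2 powr (-\<gamma>2)) ^ n * (\<Prod>i<n. q (xs ! i) (ys ! i) (us ! i)))) \<le> \<rho>2 ^ n"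
  proof -
    have "(\<Sum>x\<in>AX. \<Sum>y\<in>AY. \<Sum>u\<in>AU. p x * w x y * q x y u * log 2 (pU x u / q x y u)) = - info2"
      unfolding info2_def sum_negf [symmetric]
    proof (intro sum.cong refl)
      fix x y u assume "y \<in> AY"
      show "p x * w x y * q x y u * log 2 (pU x u / q x y u) = - (p x * w x y * q x y u * log 2 (q x y u / pU x u))"
      proof (cases "w x y * q x y u = 0")
        case False
        then have "w x y > 0" "q x y u > 0" using nonneg(2)[of x y] nonneg(3)[of x y u] by (auto simp: less_le)
        moreover from this have "pU x u > 0" using \<open>y \<in> AY\<close> by (intro pU_pos[of y]) auto
        ultimately show ?thesis by (simp add: log_divide algebra_simps)
      qed auto
    qed
    then have gap: "- \<gamma>2 < (\<Sum>x\<in>AX. \<Sum>y\<in>AY. \<Sum>u\<in>AU. p x * w x y * q x y u * log 2 (pU x u / q x y u))"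
      using d by (simp add: \<gamma>2_def)
    have "\<forall>x\<in>AX. \<forall>y\<in>AY. \<forall>u\<in>AU. p x * w x y * q x y u > 0 \<longrightarrow> q x y u > 0 \<and> pU x u > 0"
    proof (intro ballI impI)
      fix x y u assume a: "x \<in> AX" "y \<in> AY" "u \<in> AU" "p x * w x y * q x y u > 0"
      show "q x y u > 0 \<and> pU x u > 0" using posP[OF a(4)] pU_pos[OF a(2), of x u] by simp
    qed
    from chernoff_words[where P = "\<lambda>x y u. p x * w x y * q x y u" and N = "q" and D = "\<lambda>x y u. pU x u",
        OF fin(1-3) P0 sumP this gap]
    show thesis by (elim exE conjE) (erule that, assumption, erule spec)
  qed
  obtain \<rho>3 where \<rho>3: "0 < \<rho>3" "\<rho>3 < 1" "\<And>n. (\<Sum>xs\<in>words n AX. \<Sum>us\<in>words n AU. \<Sum>zs\<in>words n AZ.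
      (\<Prod>i<n. pXUZ (xs ! i) (us ! i) (zs ! i)) *
      of_bool ((\<Prod>i<n. pXUZ (xs ! i) (us ! i) (zs ! i)) \<le>
        (2 powr \<gamma>3) ^ n * (\<Prod>i<n. p (xs ! i) * pU (xs ! i) (us ! i) * pZ (zs ! i)))) \<le> \<rho>3 ^ n"
  proof -
    have gap: "\<gamma>3 < (\<Sum>x\<in>AX. \<Sum>u\<in>AU. \<Sum>z\<in>AZ. pXUZ x u z * log 2 (pXUZ x u z / (p x * pU x u * pZ z)))"
      using d by (simp add: \<gamma>3_def info3_def)
    have "\<forall>x\<in>AX. \<forall>u\<in>AU. \<forall>z\<in>AZ. pXUZ x u z > 0 \<longrightarrow> p x * pU x u * pZ z > 0 \<and> pXUZ x u z > 0"
      using pXUZ_pos by simp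
    from chernoff_words[where P = pXUZ and N = "\<lambda>x u z. p x * pU x u * pZ z" and D = pXUZ,
        OF fin(1,3,4) derived_nonneg(3) sumPXUZ this gap]
    show thesis by (elim exE conjE) (erule that, assumption, erule spec)
  qed
  \<comment> \<open>The factor 2 at \<open>sqrt \<rho>3\<close> joins \<open>P3 / \<delta>\<close>
    and \<open>\<delta>\<close>; the last two factors come from
    \<open>M \<le> 2 * 2 powr (real n * R)\<close> and from rounding \<open>L\<close> up, which at
    most doubles it.\<close>
  define \<epsilon> where "\<epsilon> n = \<rho>1 ^ n + \<rho>2 ^ n + 2 * sqrt \<rho>3 ^ n + (2 powr (- d)) ^ n
     + 2 * (2 powr (R - \<gamma>1)) ^ n + 4 * (2 powr (R + \<kappa> - \<gamma>3)) ^ n" for n :: nat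
  have "\<epsilon> \<longlonglongrightarrow> 0 + 0 + 2 * 0 + 0 + 2 * 0 + 4 * 0"
  proof -
    have lt: "2 powr x < 1" if "x < 0" for x :: real
      using powr_less_mono[of x 0 "2::real"] that by simp
    have "5 * d = info3 - info2 - R" by (simp add: d_def)
    then have "R + \<kappa> - \<gamma>3 < 0" using d unfolding \<kappa>_def \<gamma>3_def by linarith
    then have 1: "2 powr (R + \<kappa> - \<gamma>3) < 1" by (rule lt)
    have 2: "2 powr (- d) < 1" using d by (intro lt) simp
    have 3: "2 powr (R - \<gamma>1) < 1" using R by (intro lt) (simp add: \<gamma>1_def)
    have "norm \<rho>1 < 1" "norm \<rho>2 < 1" "norm (sqrt \<rho>3) < 1" "norm (2 powr (R + \<kappa> - \<gamma>3)) < 1"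
        "norm (2 powr (- d)) < 1" "norm (2 powr (R - \<gamma>1)) < 1"
      using \<rho>1(1,2) \<rho>2(1,2) \<rho>3(1,2) 1 2 3 by simp_all
    then show ?thesis
      unfolding \<epsilon>_def [abs_def] by (intro tendsto_add tendsto_mult tendsto_const LIMSEQ_power_zero)
  qed
  then have "\<epsilon> \<longlonglongrightarrow> 0" by simp
  moreover have "\<exists>enc r dec. (\<forall>m\<in>{1..M}. enc m \<in> words n AX) \<and>
     (\<Sum>m\<in>{1..M}. \<Sum>ys\<in>words n AY. \<Sum>zs\<in>words n AZ. (\<Prod>i<n. w (enc m ! i) (ys ! i)) *
        (\<Prod>i<n. V (enc m ! i) (fst (r ys) ! i, snd (r ys) ! i) (ys ! i) (zs ! i)) * of_bool (dec zs \<noteq> Some m))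
      \<le> real M * \<epsilon> n" if M: "real M \<le> 2 * 2 powr (real n * R)" for n M
  proof -
    interpret B: relay_block "words n AX" "words n AY" "words n AU" "words n AZ"
      "\<lambda>xs. \<Prod>i<n. p (xs ! i)" "\<lambda>xs ys. \<Prod>i<n. w (xs ! i) (ys ! i)"
      "\<lambda>xs ys us. \<Prod>i<n. q (xs ! i) (ys ! i) (us ! i)"
      "\<lambda>xs r ys zs. \<Prod>i<n. V (xs ! i) (fst r ! i, snd r ! i) (ys ! i) (zs ! i)"
      by (rule iid_extension)
    have BpY: "B.pY ys = (\<Prod>i<n. pY (ys ! i))" for ys
      unfolding B.pY_def pY_def
      by (simp add: sum_words_prod[where f = "\<lambda>i x. p x * w x (ys ! i)", symmetric] prod.distrib)
    have BpU: "B.pU xs us = (\<Prod>i<n. pU (xs ! i) (us ! i))" for xs us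
      unfolding B.pU_def pU_def
      by (simp add: sum_words_prod[where f = "\<lambda>i y. w (xs ! i) y * q (xs ! i) y (us ! i)", symmetric] prod.distrib)
    have BpXUZ: "B.pXUZ xs us zs = (\<Prod>i<n. pXUZ (xs ! i) (us ! i) (zs ! i))" for xs us zs
      unfolding B.pXUZ_def pXUZ_def
      by (simp add: sum_words_prod[where f = "\<lambda>i y. p (xs ! i) * w (xs ! i) y * q (xs ! i) y (us ! i)
          * V (xs ! i) (xs ! i, us ! i) y (zs ! i)", symmetric] prod.distrib)
    have BpZ: "B.pZ zs = (\<Prod>i<n. pZ (zs ! i))" for zs
    proof -
      have "B.pZ zs = (\<Sum>xs\<in>words n AX. \<Prod>i<n. \<Sum>u\<in>AU. pXUZ (xs ! i) u (zs ! i))"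
        unfolding B.pZ_def BpXUZ
        by (intro sum.cong refl sum_words_prod[where f = "\<lambda>i u. pXUZ (_ ! i) u (zs ! i)"])
      also have "\<dots> = (\<Prod>i<n. pZ (zs ! i))"
        unfolding pZ_def by (rule sum_words_prod[where f = "\<lambda>i x. \<Sum>u\<in>AU. pXUZ x u (zs ! i)"])
      finally show ?thesis .
    qed
    define L where "L = nat \<lceil>(2 powr \<kappa>) ^ n\<rceil>"
    have "1 \<le> (2 powr \<kappa>) ^ n" using \<kappa> by (intro one_le_power) (simp add: ge_one_powr_ge_zero)
    note L = nat_ceiling_le_double[OF this, folded L_def]
    define \<Gamma>1 where "\<Gamma>1 = (2 powr \<gamma>1) ^ n"
    define \<Gamma>2 where "\<Gamma>2 = (2 powr \<gamma>2) ^ n"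
    define \<Gamma>3 where "\<Gamma>3 = (2 powr \<gamma>3) ^ n"
    \<comment> \<open>The square root balances the two terms of Markov's inequality:
      \<open>\<rho>3 ^ n / \<delta> = \<delta>\<close>.\<close>
    define \<delta> where "\<delta> = sqrt \<rho>3 ^ n"
    have pos: "\<Gamma>1 > 0" "\<Gamma>2 > 0" "\<Gamma>3 > 0" "\<delta> > 0"
      using \<rho>3 by (simp_all add: \<Gamma>1_def \<Gamma>2_def \<Gamma>3_def \<delta>_def)
    obtain enc r dec where code: "\<forall>m\<in>{1..M}. enc m \<in> words n AX"
      and err: "(\<Sum>m\<in>{1..M}. \<Sum>ys\<in>words n AY. \<Sum>zs\<in>words n AZ. (\<Prod>i<n. w (enc m ! i) (ys ! i)) *
        (\<Prod>i<n. V (enc m ! i) (fst (r ys) ! i, snd (r ys) ! i) (ys ! i) (zs ! i)) * of_bool (dec zs \<noteq> Some m))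
        \<le> M * ((\<Sum>xs\<in>words n AX. \<Sum>ys\<in>words n AY. (\<Prod>i<n. p (xs ! i)) * (\<Prod>i<n. w (xs ! i) (ys ! i)) *
              of_bool ((\<Prod>i<n. w (xs ! i) (ys ! i)) \<le> \<Gamma>1 * B.pY ys))
          + (\<Sum>xs\<in>words n AX. \<Sum>ys\<in>words n AY. \<Sum>us\<in>words n AU. (\<Prod>i<n. p (xs ! i)) * (\<Prod>i<n. w (xs ! i) (ys ! i))
              * (\<Prod>i<n. q (xs ! i) (ys ! i) (us ! i)) *
              of_bool ((\<Prod>i<n. q (xs ! i) (ys ! i) (us ! i)) > \<Gamma>2 * B.pU xs us))
          + (\<Sum>xs\<in>words n AX. \<Sum>us\<in>words n AU. \<Sum>zs\<in>words n AZ. B.pXUZ xs us zs * of_bool (\<not> B.hit \<Gamma>3 xs us zs)) / \<delta>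
          + exp (- (L / \<Gamma>2)) + \<delta> + M * (1 / \<Gamma>1 + L / \<Gamma>3))" (is "_ \<le> M * (?P1 + ?P2 + ?P3 / \<delta> + _ + \<delta> + _)")
      using B.block_code_exists[OF pos, of M L] by blast
    have P1: "?P1 \<le> \<rho>1 ^ n"
    proof -
      have "?P1 = (\<Sum>xs\<in>words n AX. \<Sum>ys\<in>words n AY. \<Sum>us\<in>words n AU.
          (\<Prod>i<n. p (xs ! i) * w (xs ! i) (ys ! i) * q (xs ! i) (ys ! i) (us ! i)) *
          of_bool ((\<Prod>i<n. w (xs ! i) (ys ! i)) \<le> (2 powr \<gamma>1) ^ n * (\<Prod>i<n. pY (ys ! i))))"
      proof (intro sum.cong refl)
        fix xs ys
        show "(\<Prod>i<n. p (xs ! i)) * (\<Prod>i<n. w (xs ! i) (ys ! i)) *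
              of_bool ((\<Prod>i<n. w (xs ! i) (ys ! i)) \<le> \<Gamma>1 * B.pY ys)
           = (\<Sum>us\<in>words n AU. (\<Prod>i<n. p (xs ! i) * w (xs ! i) (ys ! i) * q (xs ! i) (ys ! i) (us ! i)) *
          of_bool ((\<Prod>i<n. w (xs ! i) (ys ! i)) \<le> (2 powr \<gamma>1) ^ n * (\<Prod>i<n. pY (ys ! i))))"
          unfolding sum_distrib_right [symmetric] prod.distrib sum_distrib_left [symmetric] B.sum_q BpY \<Gamma>1_def
          by simp
      qed
      then show ?thesis using \<rho>1(3) by simp
    qed
    have P2: "?P2 \<le> \<rho>2 ^ n"
    proof -
      have "?P2 \<le> (\<Sum>xs\<in>words n AX. \<Sum>ys\<in>words n AY. \<Sum>us\<in>words n AU.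
      (\<Prod>i<n. p (xs ! i) * w (xs ! i) (ys ! i) * q (xs ! i) (ys ! i) (us ! i)) *
      of_bool ((\<Prod>i<n. pU (xs ! i) (us ! i)) \<le> (2 powr (-\<gamma>2)) ^ n * (\<Prod>i<n. q (xs ! i) (ys ! i) (us ! i))))"
      proof (intro sum_mono)
        fix xs ys us
        have "(2 powr (-\<gamma>2)) ^ n * \<Gamma>2 = 1"
          by (simp add: \<Gamma>2_def power_mult_distrib [symmetric] powr_minus)
        then have "a \<le> (2 powr (-\<gamma>2)) ^ n * b" if "\<Gamma>2 * a < b" for a b
          using mult_left_mono[OF less_imp_le[OF that], of "(2 powr (-\<gamma>2)) ^ n"] by (simp add: mult.assoc [symmetric])
        then have "(of_bool (\<Gamma>2 * B.pU xs us < (\<Prod>i<n. q (xs ! i) (ys ! i) (us ! i))) :: real)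
          \<le> of_bool ((\<Prod>i<n. pU (xs ! i) (us ! i)) \<le> (2 powr (-\<gamma>2)) ^ n * (\<Prod>i<n. q (xs ! i) (ys ! i) (us ! i)))"
          by (auto simp: BpU)
        then show "(\<Prod>i<n. p (xs ! i)) * (\<Prod>i<n. w (xs ! i) (ys ! i)) * (\<Prod>i<n. q (xs ! i) (ys ! i) (us ! i)) *
              of_bool ((\<Prod>i<n. q (xs ! i) (ys ! i) (us ! i)) > \<Gamma>2 * B.pU xs us)
           \<le> (\<Prod>i<n. p (xs ! i) * w (xs ! i) (ys ! i) * q (xs ! i) (ys ! i) (us ! i)) *
      of_bool ((\<Prod>i<n. pU (xs ! i) (us ! i)) \<le> (2 powr (-\<gamma>2)) ^ n * (\<Prod>i<n. q (xs ! i) (ys ! i) (us ! i)))"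
          unfolding prod.distrib by (intro mult_left_mono mult_nonneg_nonneg B.nonneg) auto
      qed
      also have "\<dots> \<le> \<rho>2 ^ n" by (rule \<rho>2(3))
      finally show ?thesis .
    qed
    have P3: "?P3 \<le> \<rho>3 ^ n"
      using \<rho>3(3)[of n] by (simp only: BpXUZ B.hit_def BpU BpZ not_less \<Gamma>3_def prod.distrib)
    have \<delta>: "\<rho>3 ^ n / \<delta> = \<delta>"
      using \<rho>3 by (simp add: \<delta>_def power_divide [symmetric] real_div_sqrt)
    have P3': "?P3 / \<delta> \<le> \<delta>"
      using divide_right_mono[OF P3 less_imp_le[OF pos(4)]] unfolding \<delta> .
    have \<kappa>n: "0 < (2 powr \<kappa>) ^ n" by simp
    then have Lpos: "0 < real L" using L(2) by linarith
    \<comment> \<open>The term is doubly exponentially small, but the crude bound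
      \<open>1 / t\<close> already gives geometric decay since \<open>L / \<Gamma>2\<close> is at
      least \<open>2 powr d\<close> to the power \<open>n\<close>.\<close>
    have "exp (- (L / \<Gamma>2)) \<le> 1 / (L / \<Gamma>2)"
      using Lpos pos(2) by (intro exp_minus_le_inverse divide_pos_pos)
    also have "\<dots> = \<Gamma>2 / L" by simp
    also have "\<dots> \<le> \<Gamma>2 / (2 powr \<kappa>) ^ n"
      using L(2) pos(2) \<kappa>n Lpos by (intro divide_left_mono mult_pos_pos) (simp_all only: less_imp_le)
    also have "\<dots> = (2 powr (- d)) ^ n"
      by (simp add: \<Gamma>2_def power_divide [symmetric] powr_diff [symmetric] \<gamma>2_def \<kappa>_def)
    finally have E: "exp (- (L / \<Gamma>2)) \<le> (2 powr (- d)) ^ n" .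
    have MR: "real M \<le> 2 * (2 powr R) ^ n"
      using M by (simp add: powr_realpow [symmetric] powr_powr mult.commute)
    have "M * (1 / \<Gamma>1 + L / \<Gamma>3) \<le> 2 * (2 powr R) ^ n * (1 / \<Gamma>1 + 2 * (2 powr \<kappa>) ^ n / \<Gamma>3)"
      using L MR pos by (intro mult_mono add_mono divide_right_mono) auto
    also have "\<dots> = 2 * (2 powr (R - \<gamma>1)) ^ n + 4 * (2 powr (R + \<kappa> - \<gamma>3)) ^ n"
      by (simp add: \<Gamma>1_def \<Gamma>3_def powr_diff powr_add power_divide power_mult_distrib distrib_left)
    finally have F: "M * (1 / \<Gamma>1 + L / \<Gamma>3) \<le> 2 * (2 powr (R - \<gamma>1)) ^ n + 4 * (2 powr (R + \<kappa> - \<gamma>3)) ^ n" .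
    have "?P1 + ?P2 + ?P3 / \<delta> + exp (- (L / \<Gamma>2)) + \<delta> + M * (1 / \<Gamma>1 + L / \<Gamma>3) \<le> \<epsilon> n"
      using P1 P2 P3' E F unfolding \<epsilon>_def \<delta>_def by linarith
    then have "M * (?P1 + ?P2 + ?P3 / \<delta> + exp (- (L / \<Gamma>2)) + \<delta> + M * (1 / \<Gamma>1 + L / \<Gamma>3)) \<le> M * \<epsilon> n"
      by (intro mult_left_mono) auto
    with err code show ?thesis by (meson order_trans)
  qed
  ultimately show ?thesis by blast
qed

end

subsection \<open>Achievability\<close>

lemma sum_if_const: "(\<Sum>y\<in>A. if b then f y else 0) = (if b then sum f A else (0::real))"
  by simp

lemma if_conj: "(if b \<and> c then t else (0::real)) = (if b then if c then t else 0 else 0)"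
  by simp

locale relay_input =
  fixes p2 :: "'x1::finite \<Rightarrow> 'y2::finite \<Rightarrow> real"
    and p3 :: "'x1 \<Rightarrow> 'x2::finite \<Rightarrow> 'y2 \<Rightarrow> 'y3::finite \<Rightarrow> real"
    and Us :: "nat set" and px1 :: "'x1 \<Rightarrow> real" and pu :: "'x1 \<Rightarrow> 'y2 \<Rightarrow> nat \<Rightarrow> real"
    and fx2 :: "nat \<Rightarrow> 'x1 \<Rightarrow> 'y2 \<Rightarrow> 'x2"
  assumes channel: "relay_channel p2 p3" and input: "admissible_input Us px1 pu"
begin

sublocale relay_block UNIV UNIV Us UNIV px1 p2 pu "\<lambda>x r y z. p3 x (fx2 (snd r) (fst r) y) y z"
  using channel input by unfold_locales (auto simp: relay_channel_def admissible_input_def)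

abbreviation "P \<equiv> joint_pmf p2 p3 px1 pu fx2"

definition \<Omega> :: "('x1 \<times> 'y2 \<times> nat \<times> 'y3) set" where
  "\<Omega> = UNIV \<times> UNIV \<times> Us \<times> UNIV"

abbreviation "X1 \<equiv> \<lambda>(x1::'x1, y2::'y2, u::nat, y3::'y3). x1"
abbreviation "Y2 \<equiv> \<lambda>(x1::'x1, y2::'y2, u::nat, y3::'y3). y2"
abbreviation "U \<equiv> \<lambda>(x1::'x1, y2::'y2, u::nat, y3::'y3). u"
abbreviation "Y3 \<equiv> \<lambda>(x1::'x1, y2::'y2, u::nat, y3::'y3). y3"

lemma rate_expr_alt: "rate_expr p2 p3 Us px1 pu fx2 =
   min (mutual_info \<Omega> P X1 Y2) (mutual_info \<Omega> P (\<lambda>w. (X1 w, U w)) Y3 - cond_mutual_info \<Omega> P Y2 U X1)"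
  by (simp add: rate_expr_def \<Omega>_def Let_def)

lemma finite_\<Omega>: "finite \<Omega>"
  using fin by (simp add: \<Omega>_def)

lemma P_nonneg: "0 \<le> P w"
  by (cases w) (auto simp: joint_pmf_def intro!: mult_nonneg_nonneg nonneg nonneg(4)[of _ "(_, _)", simplified])

lemma sum_\<Omega>: "(\<Sum>w\<in>\<Omega>. F w) = (\<Sum>x\<in>UNIV. \<Sum>y\<in>UNIV. \<Sum>u\<in>Us. \<Sum>z\<in>UNIV. F (x, y, u, z))" for F :: "_ \<Rightarrow> real"
  by (simp add: \<Omega>_def sum.cartesian_product)

lemma P_apply: "P (x, y, u, z) = px1 x * p2 x y * pu x y u * p3 x (fx2 u x y) y z"
  by (simp add: joint_pmf_def)

lemma sum_p3: "(\<Sum>z\<in>UNIV. p3 x x2 y z) = 1"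
  using channel by (simp add: relay_channel_def)

lemma marg_\<Omega>: "marg \<Omega> P f a = (\<Sum>x\<in>UNIV. \<Sum>y\<in>UNIV. \<Sum>u\<in>Us. \<Sum>z\<in>UNIV.
    if f (x, y, u, z) = a then px1 x * p2 x y * pu x y u * p3 x (fx2 u x y) y z else 0)"
proof -
  have "marg \<Omega> P f a = (\<Sum>w\<in>\<Omega>. if f w = a then P w else 0)"
    unfolding marg_def using finite_\<Omega> by (simp add: sum.inter_filter)
  then show ?thesis by (simp only: sum_\<Omega> joint_pmf_def prod.case)
qed

lemma margs:
  "marg \<Omega> P X1 x = px1 x"
  "marg \<Omega> P Y2 y = pY y"
  "marg \<Omega> P Y3 z = pZ z"
  "marg \<Omega> P (\<lambda>w. (X1 w, Y2 w)) (x, y) = px1 x * p2 x y"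
  "marg \<Omega> P (\<lambda>w. (Y2 w, X1 w)) (y, x) = px1 x * p2 x y"
  "u \<in> Us \<Longrightarrow> marg \<Omega> P (\<lambda>w. (X1 w, U w)) (x, u) = px1 x * pU x u"
  "u \<in> Us \<Longrightarrow> marg \<Omega> P (\<lambda>w. (U w, X1 w)) (u, x) = px1 x * pU x u"
  "u \<in> Us \<Longrightarrow> marg \<Omega> P (\<lambda>w. ((X1 w, U w), Y3 w)) ((x, u), z) = pXUZ x u z"
  "u \<in> Us \<Longrightarrow> marg \<Omega> P (\<lambda>w. (Y2 w, U w, X1 w)) (y, u, x) = px1 x * p2 x y * pu x y u"
proof -
  note [simp] = marg_\<Omega> sum_if_const if_conj sum.delta fin
  have s1: "(\<Sum>z\<in>UNIV. px1 x * p2 x y * pu x y u * p3 x (fx2 u x y) y z) = px1 x * p2 x y * pu x y u" for x y u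
    by (simp add: sum_distrib_left [symmetric] sum_p3)
  have s2: "(\<Sum>u\<in>Us. px1 x * p2 x y * pu x y u) = px1 x * p2 x y" for x y
    by (simp add: sum_distrib_left [symmetric] sum_q)
  have s3: "(\<Sum>y\<in>UNIV. px1 x * p2 x y) = px1 x" for x
    by (simp add: sum_distrib_left [symmetric] sum_w)
  have s4: "(\<Sum>y\<in>UNIV. px1 x * p2 x y * pu x y u) = px1 x * pU x u" for x u
    by (simp add: pU_def sum_distrib_left mult.assoc)
  show "marg \<Omega> P X1 x = px1 x" by (simp add: s1 s2 s3)
  show "marg \<Omega> P Y2 y = pY y" by (simp add: s1 s2 pY_def)
  show "marg \<Omega> P (\<lambda>w. (X1 w, Y2 w)) (x, y) = px1 x * p2 x y" by (simp add: s1 s2)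
  show "marg \<Omega> P (\<lambda>w. (Y2 w, X1 w)) (y, x) = px1 x * p2 x y" by (simp add: s1 s2)
  show "u \<in> Us \<Longrightarrow> marg \<Omega> P (\<lambda>w. (X1 w, U w)) (x, u) = px1 x * pU x u" by (simp add: s1 s4)
  show "u \<in> Us \<Longrightarrow> marg \<Omega> P (\<lambda>w. (U w, X1 w)) (u, x) = px1 x * pU x u" by (simp add: s1 s4)
  show "u \<in> Us \<Longrightarrow> marg \<Omega> P (\<lambda>w. ((X1 w, U w), Y3 w)) ((x, u), z) = pXUZ x u z"
    by (simp add: pXUZ_def)
  show "u \<in> Us \<Longrightarrow> marg \<Omega> P (\<lambda>w. (Y2 w, U w, X1 w)) (y, u, x) = px1 x * p2 x y * pu x y u"
    by (simp add: s1)
  have "marg \<Omega> P Y3 z = (\<Sum>x\<in>UNIV. \<Sum>y\<in>UNIV. \<Sum>u\<in>Us. px1 x * p2 x y * pu x y u * p3 x (fx2 u x y) y z)"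
    by simp
  also have "\<dots> = pZ z"
    unfolding pZ_def pXUZ_def by (simp add: sum.swap[of _ Us UNIV])
  finally show "marg \<Omega> P Y3 z = pZ z" .
qed

lemma info1_eq: "mutual_info \<Omega> P X1 Y2 = info1"
proof -
  have "mutual_info \<Omega> P X1 Y2 = (\<Sum>x\<in>UNIV. \<Sum>y\<in>UNIV. \<Sum>u\<in>Us. \<Sum>z\<in>UNIV.
     px1 x * p2 x y * pu x y u * p3 x (fx2 u x y) y z * log 2 (px1 x * p2 x y / (px1 x * pY y)))"
    unfolding mutual_info_def sum_\<Omega>
    by (intro sum.cong refl) (simp only: prod.case margs P_apply)
  also have "\<dots> = (\<Sum>x\<in>UNIV. \<Sum>y\<in>UNIV. \<Sum>u\<in>Us. px1 x * p2 x y * pu x y u * log 2 (p2 x y / pY y))"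
  proof (intro sum.cong refl)
    fix x y u
    have "(\<Sum>z\<in>UNIV. px1 x * p2 x y * pu x y u * p3 x (fx2 u x y) y z * log 2 (px1 x * p2 x y / (px1 x * pY y)))
       = px1 x * p2 x y * pu x y u * (\<Sum>z\<in>UNIV. p3 x (fx2 u x y) y z) * log 2 (px1 x * p2 x y / (px1 x * pY y))"
      by (simp only: sum_distrib_left sum_distrib_right)
    then show "(\<Sum>z\<in>UNIV. px1 x * p2 x y * pu x y u * p3 x (fx2 u x y) y z * log 2 (px1 x * p2 x y / (px1 x * pY y)))
       = px1 x * p2 x y * pu x y u * log 2 (p2 x y / pY y)"
      by (cases "px1 x = 0") (auto simp: sum_p3)
  qed
  finally show ?thesis by (simp add: info1_def)
qed

lemma info2_eq: "cond_mutual_info \<Omega> P Y2 U X1 = info2"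
proof -
  have "cond_mutual_info \<Omega> P Y2 U X1 = (\<Sum>x\<in>UNIV. \<Sum>y\<in>UNIV. \<Sum>u\<in>Us. \<Sum>z\<in>UNIV.
     px1 x * p2 x y * pu x y u * p3 x (fx2 u x y) y z *
       log 2 (px1 x * p2 x y * pu x y u * px1 x / (px1 x * p2 x y * (px1 x * pU x u))))"
    unfolding cond_mutual_info_def sum_\<Omega>
    by (intro sum.cong refl) (simp only: prod.case margs P_apply)
  also have "\<dots> = (\<Sum>x\<in>UNIV. \<Sum>y\<in>UNIV. \<Sum>u\<in>Us. px1 x * p2 x y * pu x y u * log 2 (pu x y u / pU x u))"
  proof (intro sum.cong refl)
    fix x y u
    let ?l = "log 2 (px1 x * p2 x y * pu x y u * px1 x / (px1 x * p2 x y * (px1 x * pU x u)))"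
    have "(\<Sum>z\<in>UNIV. px1 x * p2 x y * pu x y u * p3 x (fx2 u x y) y z * ?l)
       = px1 x * p2 x y * pu x y u * (\<Sum>z\<in>UNIV. p3 x (fx2 u x y) y z) * ?l"
      by (simp only: sum_distrib_left sum_distrib_right)
    then show "(\<Sum>z\<in>UNIV. px1 x * p2 x y * pu x y u * p3 x (fx2 u x y) y z * ?l)
       = px1 x * p2 x y * pu x y u * log 2 (pu x y u / pU x u)"
      by (cases "px1 x = 0 \<or> p2 x y = 0") (auto simp: sum_p3 field_simps)
  qed
  finally show ?thesis by (simp add: info2_def)
qed

lemma info3_eq: "mutual_info \<Omega> P (\<lambda>w. (X1 w, U w)) Y3 = info3"
proof -
  have "mutual_info \<Omega> P (\<lambda>w. (X1 w, U w)) Y3 = (\<Sum>x\<in>UNIV. \<Sum>y\<in>UNIV. \<Sum>u\<in>Us. \<Sum>z\<in>UNIV.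
     px1 x * p2 x y * pu x y u * p3 x (fx2 u x y) y z * log 2 (pXUZ x u z / (px1 x * pU x u * pZ z)))"
    unfolding mutual_info_def sum_\<Omega>
    by (intro sum.cong refl) (simp only: prod.case margs P_apply)
  also have "\<dots> = (\<Sum>x\<in>UNIV. \<Sum>u\<in>Us. \<Sum>z\<in>UNIV. \<Sum>y\<in>UNIV.
     px1 x * p2 x y * pu x y u * p3 x (fx2 u x y) y z * log 2 (pXUZ x u z / (px1 x * pU x u * pZ z)))"
    by (simp only: sum.swap[of _ Us UNIV] sum.swap[of _ "UNIV :: 'y3 set" "UNIV :: 'y2 set"])
  also have "\<dots> = info3"
    unfolding info3_def pXUZ_def by (simp add: sum_distrib_right)
  finally show ?thesis .
qed

theorem achievable_if_less_rate_expr: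
  assumes R: "0 < R" "R < rate_expr p2 p3 Us px1 pu fx2"
  shows "achievable p2 p3 R"
proof -
  have "R < info1" "R < info3 - info2"
    using R by (auto simp: rate_expr_alt info1_eq info2_eq info3_eq)
  from iid_codes_exist[OF R(1) this] obtain \<epsilon> where \<epsilon>: "\<epsilon> \<longlonglongrightarrow> 0"
    and codes: "\<And>n M. real M \<le> 2 * 2 powr (real n * R) \<Longrightarrow> \<exists>enc r dec.
     (\<forall>m\<in>{1..M}. enc m \<in> words n UNIV) \<and>
     (\<Sum>m\<in>{1..M}. \<Sum>ys\<in>words n UNIV. \<Sum>zs\<in>words n UNIV. (\<Prod>i<n. p2 (enc m ! i) (ys ! i)) *
        (\<Prod>i<n. p3 (enc m ! i) (fx2 (snd (r ys) ! i) (fst (r ys) ! i) (ys ! i)) (ys ! i) (zs ! i)) *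
          of_bool (dec zs \<noteq> Some m)) \<le> real M * \<epsilon> n"
    by (simp only: fst_conv snd_conv) blast
  have "\<exists>enc rel dec. is_code n (num_msgs R n) enc \<and>
      err_prob p2 p3 n (num_msgs R n) enc rel dec \<le> \<epsilon> n" for n
  proof -
    \<comment> \<open>A number that is at least 1 is at most doubled by rounding up; the factor 2 in
      the hypothesis on \<open>M\<close> in the coding theorem is there for this.\<close>
    have "1 \<le> 2 powr (real n * R)" using R by (simp add: ge_one_powr_ge_zero)
    note M = nat_ceiling_le_double[OF this, folded num_msgs_def]
    have M0: "real (num_msgs R n) > 0" using M(2) \<open>1 \<le> 2 powr (real n * R)\<close> by linarith
    from codes[OF M(1)] obtain enc r dec where
      c: "\<forall>m\<in>{1..num_msgs R n}. enc m \<in> words n UNIV" and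
      e: "(\<Sum>m\<in>{1..num_msgs R n}. \<Sum>ys\<in>words n UNIV. \<Sum>zs\<in>words n UNIV. (\<Prod>i<n. p2 (enc m ! i) (ys ! i)) *
        (\<Prod>i<n. p3 (enc m ! i) (fx2 (snd (r ys) ! i) (fst (r ys) ! i) (ys ! i)) (ys ! i) (zs ! i)) *
          of_bool (dec zs \<noteq> Some m)) \<le> num_msgs R n * \<epsilon> n" (is "?s \<le> _")
      by blast
    define rel where "rel i ys = fx2 (snd (r ys) ! i) (fst (r ys) ! i) (ys ! i)" for i ys
    have "err_prob p2 p3 n (num_msgs R n) enc rel dec = (1 / num_msgs R n) * ?s"
      unfolding err_prob_def words_UNIV rel_def
      by (intro arg_cong2[where f = "(*)"] sum.cong refl) simp
    also have "\<dots> \<le> (1 / num_msgs R n) * (num_msgs R n * \<epsilon> n)"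
      using M0 by (intro mult_left_mono e) simp
    also have "\<dots> = \<epsilon> n" using M0 by simp
    finally have "err_prob p2 p3 n (num_msgs R n) enc rel dec \<le> \<epsilon> n" .
    moreover have "is_code n (num_msgs R n) enc" using c by (auto simp: is_code_def words_def)
    ultimately show ?thesis by blast
  qed
  then obtain enc rel dec where c: "\<And>n. is_code n (num_msgs R n) (enc n)"
    and e: "\<And>n. err_prob p2 p3 n (num_msgs R n) (enc n) (rel n) (dec n) \<le> \<epsilon> n" by metis
  have "0 \<le> err_prob p2 p3 n M enc rel dec" for n M enc rel dec
    unfolding err_prob_def using channel
    by (intro mult_nonneg_nonneg sum_nonneg prod_nonneg) (auto simp: relay_channel_def)
  then have "(\<lambda>n. err_prob p2 p3 n (num_msgs R n) (enc n) (rel n) (dec n)) \<longlonglongrightarrow> 0"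
    using e by (intro tendsto_sandwich[OF _ _ tendsto_const \<epsilon>]) auto
  then show ?thesis unfolding achievable_def using c by blast
qed

end

text \<open>At rate 0 there is a single message, so a constant decoder never errs. This makes the
  set of achievable rates nonempty and settles the capacity when the maximum is not
  positive.\<close>

lemma achievable_0:
  fixes p2 :: "'x1::finite \<Rightarrow> 'y2::finite \<Rightarrow> real"
    and p3 :: "'x1 \<Rightarrow> 'x2::finite \<Rightarrow> 'y2 \<Rightarrow> 'y3::finite \<Rightarrow> real"
  shows "achievable p2 p3 0"
proof -
  have "is_code n (num_msgs 0 n) (\<lambda>_. replicate n (undefined :: 'x1))" for n
    by (simp add: is_code_def)
  moreover have "err_prob p2 p3 n (num_msgs 0 n) (\<lambda>_. replicate n (undefined :: 'x1)) rel (\<lambda>_. Some 1) = 0" for n rel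
    by (simp add: err_prob_def num_msgs_def)
  ultimately show ?thesis
    unfolding achievable_def
    by (intro exI[of _ "\<lambda>n _. replicate n (undefined :: 'x1)"] exI[of _ "\<lambda>_ _ _. undefined"] exI[of _ "\<lambda>_ _. Some 1"]) simp
qed

subsection \<open>The maximum is attained\<close>

text \<open>A value \<open>u\<close> of the auxiliary variable enters the rate only through the law \<open>c\<close> of
  \<open>(X1, Y2)\<close> given \<open>U = u\<close>, the induced law of \<open>Y3\<close>, and \<open>H(Y2 | X1, U = u) - H(Y3 | X1, U = u)\<close>.
  These are the coordinates of \<open>point\<close>; in the difference the terms \<open>H(X1 | U = u)\<close> cancel.\<close>

definition out :: "('x1 \<Rightarrow> 'x2 \<Rightarrow> 'y2::finite \<Rightarrow> 'y3 \<Rightarrow> real) \<Rightarrow> ('x1 \<Rightarrow> 'y2 \<Rightarrow> 'x2) \<Rightarrow> ('x1 \<Rightarrow> 'y2 \<Rightarrow> real) \<Rightarrow> 'x1 \<Rightarrow> 'y3 \<Rightarrow> real" where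
  "out p3 f c x z = (\<Sum>y\<in>UNIV. c x y * p3 x (f x y) y z)"

definition hdiff :: "('x1::finite \<Rightarrow> 'x2 \<Rightarrow> 'y2::finite \<Rightarrow> 'y3::finite \<Rightarrow> real) \<Rightarrow> ('x1 \<Rightarrow> 'y2 \<Rightarrow> 'x2) \<Rightarrow> ('x1 \<Rightarrow> 'y2 \<Rightarrow> real) \<Rightarrow> real" where
  "hdiff p3 f c = (\<Sum>x\<in>UNIV. \<Sum>y\<in>UNIV. ent (c x y)) - (\<Sum>x\<in>UNIV. \<Sum>z\<in>UNIV. ent (out p3 f c x z))"

type_synonym ('a, 'b, 'c) point = "(real ^ ('a \<times> 'b)) \<times> (real ^ 'c) \<times> real"

definition point :: "('x1::finite \<Rightarrow> 'x2 \<Rightarrow> 'y2::finite \<Rightarrow> 'y3::finite \<Rightarrow> real) \<Rightarrow> ('x1 \<Rightarrow> 'y2 \<Rightarrow> 'x2) \<Rightarrow> ('x1 \<Rightarrow> 'y2 \<Rightarrow> real) \<Rightarrow> ('x1, 'y2, 'y3) point" where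
  "point p3 f c = (\<chi> i. c (fst i) (snd i), \<chi> z. \<Sum>x\<in>UNIV. out p3 f c x z, hdiff p3 f c)"

definition letters :: "('x1::finite \<Rightarrow> 'x2 \<Rightarrow> 'y2::finite \<Rightarrow> 'y3::finite \<Rightarrow> real) \<Rightarrow> ('x1, 'y2, 'y3) point set" where
  "letters p3 = {point p3 f c | f c. (\<forall>x y. 0 \<le> c x y) \<and> (\<Sum>x\<in>UNIV. \<Sum>y\<in>UNIV. c x y) = 1}"

definition obj1 :: "real ^ ('x1::finite \<times> 'y2::finite) \<Rightarrow> real" where
  "obj1 q = (\<Sum>x\<in>UNIV. ent (\<Sum>y\<in>UNIV. q $ (x, y))) + (\<Sum>y\<in>UNIV. ent (\<Sum>x\<in>UNIV. q $ (x, y)))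
     - (\<Sum>x\<in>UNIV. \<Sum>y\<in>UNIV. ent (q $ (x, y)))"

text \<open>This is \<open>H(Y3) - H(Y2|X1) + (H(Y2|X1,U) - H(Y3|X1,U))\<close>, with the bracket
  stored as the last coordinate.\<close>

definition obj2 :: "('x1::finite, 'y2::finite, 'y3::finite) point \<Rightarrow> real" where
  "obj2 v = (\<Sum>z\<in>UNIV. ent (fst (snd v) $ z)) - (\<Sum>x\<in>UNIV. \<Sum>y\<in>UNIV. ent (fst v $ (x, y)))
     + (\<Sum>x\<in>UNIV. ent (\<Sum>y\<in>UNIV. fst v $ (x, y))) + snd (snd v)"

definition obj :: "('x1::finite, 'y2::finite, 'y3::finite) point \<Rightarrow> real" where
  "obj v = min (obj1 (fst v)) (obj2 v)"

text \<open>Convex combinations mix the values of \<open>U\<close>. The channel constraint is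
  written without division, as a linear equation in the law of \<open>(X1, Y2)\<close>, so it is
  closed and survives averaging.\<close>

definition region :: "('x1::finite \<Rightarrow> 'y2::finite \<Rightarrow> real) \<Rightarrow> ('x1 \<Rightarrow> 'x2 \<Rightarrow> 'y2 \<Rightarrow> 'y3::finite \<Rightarrow> real) \<Rightarrow> ('x1, 'y2, 'y3) point set" where
  "region p2 p3 = {v \<in> convex hull letters p3. \<forall>x y. fst v $ (x, y) = (\<Sum>y'\<in>UNIV. fst v $ (x, y')) * p2 x y}"

lemma out_nonneg:
  "(\<And>x y. 0 \<le> c x y) \<Longrightarrow> (\<And>x x2 y z. 0 \<le> p3 x x2 y z) \<Longrightarrow> 0 \<le> out p3 f c x z"
  unfolding out_def by (intro sum_nonneg mult_nonneg_nonneg)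

lemma sum_out:
  fixes p3 :: "'x1 \<Rightarrow> 'x2 \<Rightarrow> 'y2::finite \<Rightarrow> 'y3::finite \<Rightarrow> real"
  assumes "\<And>x x2 y. (\<Sum>z\<in>UNIV. p3 x x2 y z) = 1"
  shows "(\<Sum>z\<in>UNIV. out p3 f c x z) = (\<Sum>y\<in>UNIV. c x y)"
  unfolding out_def by (subst sum.swap) (simp add: sum_distrib_left [symmetric] assms)

text \<open>Scaling adds \<open>ent t\<close> times the total mass to each of the two entropy sums
  in \<open>hdiff\<close>. Both laws have the same mass, so these terms cancel and
  \<open>point\<close> is homogeneous; weights \<open>p(u)\<close> can thus be absorbed into
  unnormalised laws.\<close>

lemma point_scale:
  fixes p3 :: "'x1::finite \<Rightarrow> 'x2::finite \<Rightarrow> 'y2::finite \<Rightarrow> 'y3::finite \<Rightarrow> real"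
  assumes ch: "relay_channel p2 p3" and c: "\<And>x y. 0 \<le> c x y" and t: "0 \<le> t"
  shows "point p3 f (\<lambda>x y. t * c x y) = t *\<^sub>R point p3 f c"
proof -
  have p3: "\<And>x x2 y z. 0 \<le> p3 x x2 y z" "\<And>x x2 y. (\<Sum>z\<in>UNIV. p3 x x2 y z) = 1"
    using ch by (auto simp: relay_channel_def)
  have o: "out p3 f (\<lambda>x y. t * c x y) x z = t * out p3 f c x z" for x z
    by (simp add: out_def sum_distrib_left mult.assoc)
  have "hdiff p3 f (\<lambda>x y. t * c x y) = t * hdiff p3 f c"
  proof -
    have o0: "0 \<le> out p3 f c x z" for x z using c p3(1) by (intro out_nonneg)
    have "(\<Sum>x\<in>UNIV. \<Sum>y\<in>UNIV. ent (t * c x y))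
        = (\<Sum>x\<in>UNIV. \<Sum>y\<in>UNIV. c x y) * ent t + t * (\<Sum>x\<in>UNIV. \<Sum>y\<in>UNIV. ent (c x y))"
      by (simp only: ent_mult[OF t c] sum.distrib sum_distrib_right [symmetric] sum_distrib_left [symmetric])
    moreover have "(\<Sum>x\<in>UNIV. \<Sum>z\<in>UNIV. ent (t * out p3 f c x z))
        = (\<Sum>x\<in>UNIV. \<Sum>y\<in>UNIV. c x y) * ent t + t * (\<Sum>x\<in>UNIV. \<Sum>z\<in>UNIV. ent (out p3 f c x z))"
      by (simp only: ent_mult[OF t o0] sum.distrib sum_distrib_right [symmetric] sum_distrib_left [symmetric]
          sum_out[OF p3(2)])
    ultimately show ?thesis unfolding hdiff_def o by (simp add: right_diff_distrib)
  qed
  then show ?thesis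
    by (simp add: point_def o vec_eq_iff sum_distrib_left)
qed

text \<open>Homogeneity lets each summand be divided by its mass \<open>t i\<close>, which becomes
  its coefficient in a convex combination; summands of mass zero vanish and are dropped.\<close>

lemma sum_point_in_hull:
  fixes p3 :: "'x1::finite \<Rightarrow> 'x2::finite \<Rightarrow> 'y2::finite \<Rightarrow> 'y3::finite \<Rightarrow> real"
  assumes ch: "relay_channel p2 p3" and fin: "finite I" and c: "\<And>i x y. i \<in> I \<Longrightarrow> 0 \<le> c i x y"
    and one: "(\<Sum>i\<in>I. \<Sum>x\<in>UNIV. \<Sum>y\<in>UNIV. c i x y) = 1"
  shows "(\<Sum>i\<in>I. point p3 (f i) (c i)) \<in> convex hull letters p3"
proof -
  define t where "t i = (\<Sum>x\<in>UNIV. \<Sum>y\<in>UNIV. c i x y)" for i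
  define J where "J = {i \<in> I. t i \<noteq> 0}"
  have t0: "0 \<le> t i" if "i \<in> I" for i unfolding t_def using that c by (intro sum_nonneg) auto
  have zero: "c i x y = 0" if "i \<in> I" "t i = 0" for i x y
  proof -
    have "(\<Sum>y\<in>UNIV. c i x y) = 0"
      using that c unfolding t_def by (subst (asm) sum_nonneg_eq_0_iff) (auto intro!: sum_nonneg)
    then show ?thesis using that c by (subst (asm) sum_nonneg_eq_0_iff) auto
  qed
  have eq: "point p3 (f i) (c i) = t i *\<^sub>R point p3 (f i) (\<lambda>x y. c i x y / t i)" if "i \<in> J" for i
  proof -
    have i: "i \<in> I" "t i \<noteq> 0" using that by (auto simp: J_def)
    have "point p3 (f i) (\<lambda>x y. t i * (c i x y / t i)) = t i *\<^sub>R point p3 (f i) (\<lambda>x y. c i x y / t i)"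
      using c[OF i(1)] t0[OF i(1)] by (intro point_scale[OF ch]) auto
    then show ?thesis using i by simp
  qed
  have "point p3 (f i) (c i) = 0" if "i \<in> I - J" for i
  proof -
    have "c i = (\<lambda>x y. 0)" using that zero by (auto simp: J_def fun_eq_iff)
    then show ?thesis using point_scale[OF ch, of "\<lambda>_ _. 0" 0 "f i"] by simp
  qed
  then have "(\<Sum>i\<in>I. point p3 (f i) (c i)) = (\<Sum>i\<in>J. point p3 (f i) (c i))"
    using fin by (intro sum.mono_neutral_right) (auto simp: J_def)
  also have "\<dots> = (\<Sum>i\<in>J. t i *\<^sub>R point p3 (f i) (\<lambda>x y. c i x y / t i))"
    by (intro sum.cong refl eq)
  also have "\<dots> \<in> convex hull letters p3"
  proof (rule convex_sum)
    show "finite J" using fin by (simp add: J_def)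
    show "convex (convex hull letters p3)" by simp
    have "sum t J = sum t I" using fin by (intro sum.mono_neutral_left) (auto simp: J_def)
    then show "sum t J = 1" using one by (simp add: t_def)
    show "0 \<le> t i" if "i \<in> J" for i using that t0 by (simp add: J_def)
    show "point p3 (f i) (\<lambda>x y. c i x y / t i) \<in> convex hull letters p3" if "i \<in> J" for i
    proof (rule hull_inc)
      have i: "i \<in> I" "t i \<noteq> 0" using that by (auto simp: J_def)
      have "(\<Sum>x\<in>UNIV. \<Sum>y\<in>UNIV. c i x y / t i) = 1"
        using i by (simp add: sum_divide_distrib [symmetric] t_def)
      then show "point p3 (f i) (\<lambda>x y. c i x y / t i) \<in> letters p3"
        unfolding letters_def using c[OF i(1)] t0[OF i(1)]
        by (intro CollectI exI conjI refl) auto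
    qed
  qed
  finally show ?thesis .
qed

lemma point_components:
  "fst (\<Sum>i\<in>I. point p3 (f i) (c i)) $ (x, y) = (\<Sum>i\<in>I. c i x y)"
  "fst (snd (\<Sum>i\<in>I. point p3 (f i) (c i))) $ z = (\<Sum>i\<in>I. \<Sum>x\<in>UNIV. out p3 (f i) (c i) x z)"
  "snd (snd (\<Sum>i\<in>I. point p3 (f i) (c i))) = (\<Sum>i\<in>I. hdiff p3 (f i) (c i))"
  by (simp_all add: point_def fst_sum snd_sum)

lemma sum_Times: "sum F (A \<times> B) = (\<Sum>a\<in>A. \<Sum>b\<in>B. F (a, b))" for F :: "_ \<Rightarrow> real"
  by (simp add: sum.cartesian_product)

section \<open>The rate expression as a function on the convex hull\<close>

context relay_input
begin

text \<open>Each value \<open>u\<close> contributes the unnormalised law of \<open>(X1, Y2)\<close>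
  on the event \<open>U = u\<close>, so its probability is already inside the point.\<close>

definition "v = (\<Sum>u\<in>Us. point p3 (fx2 u) (\<lambda>x y. px1 x * p2 x y * pu x y u))"

lemma v_q: "fst v $ (x, y) = px1 x * p2 x y"
  unfolding v_def point_components by (simp add: sum_distrib_left [symmetric] sum_q)

text \<open>Written in entropies, both terms of the second bound contain \<open>H(X1,U)\<close>,
  which cancels. What remains depends on the law of \<open>(X1, Y2)\<close>, on the law of
  \<open>Y3\<close>, and on a difference that is a sum over \<open>u\<close>.\<close>

lemma rate_expr_obj: "rate_expr p2 p3 Us px1 pu fx2 = obj v"
proof -
  have out: "out p3 (fx2 u) (\<lambda>x y. px1 x * p2 x y * pu x y u) x z = pXUZ x u z" for u x z
    by (simp add: out_def pXUZ_def)
  have r: "fst (snd v) $ z = pZ z" for z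
    unfolding v_def point_components out pZ_def by (rule sum.swap)
  have h: "snd (snd v) = (\<Sum>u\<in>Us. \<Sum>x\<in>UNIV. \<Sum>y\<in>UNIV. ent (px1 x * p2 x y * pu x y u))
      - (\<Sum>u\<in>Us. \<Sum>x\<in>UNIV. \<Sum>z\<in>UNIV. ent (pXUZ x u z))"
    unfolding v_def point_components hdiff_def out by (rule sum_subtractf)
  have px: "(\<Sum>y\<in>UNIV. px1 x * p2 x y) = px1 x" for x
    by (simp add: sum_distrib_left [symmetric] sum_w)
  note E = Hent_eq[OF finite_\<Omega>, where P = P]
  have HX: "Hent \<Omega> P X1 = (\<Sum>x\<in>UNIV. ent (px1 x))"
    by (subst E[of UNIV]) (auto simp: margs)
  have HY: "Hent \<Omega> P Y2 = (\<Sum>y\<in>UNIV. ent (pY y))"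
    by (subst E[of UNIV]) (auto simp: margs)
  have HZ: "Hent \<Omega> P Y3 = (\<Sum>z\<in>UNIV. ent (pZ z))"
    by (subst E[of UNIV]) (auto simp: margs)
  have HXY: "Hent \<Omega> P (\<lambda>w. (X1 w, Y2 w)) = (\<Sum>x\<in>UNIV. \<Sum>y\<in>UNIV. ent (px1 x * p2 x y))"
    by (subst E[of "UNIV \<times> UNIV"]) (auto simp: margs sum.cartesian_product intro!: sum.cong)
  have HYX: "Hent \<Omega> P (\<lambda>w. (Y2 w, X1 w)) = Hent \<Omega> P (\<lambda>w. (X1 w, Y2 w))"
    by (rule Hent_recode) auto
  have HUX: "Hent \<Omega> P (\<lambda>w. (U w, X1 w)) = Hent \<Omega> P (\<lambda>w. (X1 w, U w))"
    by (rule Hent_recode) auto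
  have HXUZ: "Hent \<Omega> P (\<lambda>w. ((X1 w, U w), Y3 w)) = (\<Sum>u\<in>Us. \<Sum>x\<in>UNIV. \<Sum>z\<in>UNIV. ent (pXUZ x u z))"
  proof -
    have "Hent \<Omega> P (\<lambda>w. ((X1 w, U w), Y3 w))
        = (\<Sum>a\<in>(UNIV \<times> Us) \<times> UNIV. ent (marg \<Omega> P (\<lambda>w. ((X1 w, U w), Y3 w)) a))"
      by (rule E) (auto simp: fin \<Omega>_def)
    also have "\<dots> = (\<Sum>x\<in>UNIV. \<Sum>u\<in>Us. \<Sum>z\<in>UNIV. ent (marg \<Omega> P (\<lambda>w. ((X1 w, U w), Y3 w)) ((x, u), z)))"
      by (simp only: sum_Times)
    also have "\<dots> = (\<Sum>x\<in>UNIV. \<Sum>u\<in>Us. \<Sum>z\<in>UNIV. ent (pXUZ x u z))"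
      by (intro sum.cong refl arg_cong[where f = ent] margs)
    finally show ?thesis by (subst sum.swap)
  qed
  have HYUX: "Hent \<Omega> P (\<lambda>w. (Y2 w, U w, X1 w)) = (\<Sum>u\<in>Us. \<Sum>x\<in>UNIV. \<Sum>y\<in>UNIV. ent (px1 x * p2 x y * pu x y u))"
  proof -
    have "Hent \<Omega> P (\<lambda>w. (Y2 w, U w, X1 w))
        = (\<Sum>a\<in>UNIV \<times> Us \<times> UNIV. ent (marg \<Omega> P (\<lambda>w. (Y2 w, U w, X1 w)) a))"
      by (rule E) (auto simp: fin \<Omega>_def)
    also have "\<dots> = (\<Sum>y\<in>UNIV. \<Sum>u\<in>Us. \<Sum>x\<in>UNIV. ent (marg \<Omega> P (\<lambda>w. (Y2 w, U w, X1 w)) (y, u, x)))"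
      by (simp only: sum_Times)
    also have "\<dots> = (\<Sum>y\<in>UNIV. \<Sum>u\<in>Us. \<Sum>x\<in>UNIV. ent (px1 x * p2 x y * pu x y u))"
      by (intro sum.cong refl arg_cong[where f = ent] margs)
    also have "\<dots> = (\<Sum>u\<in>Us. \<Sum>y\<in>UNIV. \<Sum>x\<in>UNIV. ent (px1 x * p2 x y * pu x y u))"
      by (rule sum.swap)
    also have "\<dots> = (\<Sum>u\<in>Us. \<Sum>x\<in>UNIV. \<Sum>y\<in>UNIV. ent (px1 x * p2 x y * pu x y u))"
      by (intro sum.cong refl sum.swap)
    finally show ?thesis .
  qed
  have "mutual_info \<Omega> P X1 Y2 = obj1 (fst v)"
    by (simp add: mutual_info_Hent finite_\<Omega> P_nonneg HX HY HXY obj1_def v_q px pY_def)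
  moreover have "mutual_info \<Omega> P (\<lambda>w. (X1 w, U w)) Y3 - cond_mutual_info \<Omega> P Y2 U X1 = obj2 v"
    by (simp add: mutual_info_Hent cond_mutual_info_Hent finite_\<Omega> P_nonneg HX HXY HYX HUX HXUZ HYUX HZ
        obj2_def v_q px r h)
  ultimately show ?thesis by (simp add: rate_expr_alt obj_def)
qed

lemma v_in_region: "v \<in> region p2 p3"
proof -
  have "v \<in> convex hull letters p3"
    unfolding v_def
  proof (rule sum_point_in_hull[OF channel fin(3)])
    have "(\<Sum>u\<in>Us. \<Sum>x\<in>UNIV. \<Sum>y\<in>UNIV. px1 x * p2 x y * pu x y u)
        = (\<Sum>x\<in>UNIV. \<Sum>y\<in>UNIV. \<Sum>u\<in>Us. px1 x * p2 x y * pu x y u)"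
      by (simp only: sum.swap[of _ Us UNIV])
    then show "(\<Sum>u\<in>Us. \<Sum>x\<in>UNIV. \<Sum>y\<in>UNIV. px1 x * p2 x y * pu x y u) = 1"
      by (simp add: sum_distrib_left [symmetric] sum_q sum_w sum_p)
  qed (simp add: nonneg)
  moreover have "(\<Sum>y'\<in>UNIV. px1 x * p2 x y') = px1 x" for x
    by (simp add: sum_distrib_left [symmetric] sum_w)
  ultimately show ?thesis by (simp add: region_def v_q)
qed

end

text \<open>The index set of a convex combination serves as the alphabet of \<open>U\<close>, with
  the relay map of each letter as its function. The constraint of \<open>region\<close> makes the
  law of \<open>(X1, Y2)\<close> an input law times the channel, so the law of \<open>U\<close> is
  recovered by division.\<close>

lemma region_point_is_rate:
  fixes p2 :: "'x1::finite \<Rightarrow> 'y2::finite \<Rightarrow> real"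
    and p3 :: "'x1 \<Rightarrow> 'x2::finite \<Rightarrow> 'y2 \<Rightarrow> 'y3::finite \<Rightarrow> real"
  assumes ch: "relay_channel p2 p3" and V: "V \<in> region p2 p3"
  shows "obj V \<in> rate_values p2 p3"
proof -
  have "V \<in> convex hull letters p3" using V by (simp add: region_def)
  then obtain k and s :: "nat \<Rightarrow> real" and g where g: "\<And>i. i \<in> {1..k} \<Longrightarrow> 0 \<le> s i \<and> g i \<in> letters p3"
    and s1: "sum s {1..k} = 1" and Veq: "(\<Sum>i = 1..k. s i *\<^sub>R g i) = V"
    unfolding convex_hull_indexed by blast
  have "\<forall>i\<in>{1..k}. \<exists>f c. g i = point p3 f c \<and> (\<forall>x y. 0 \<le> c x y) \<and> (\<Sum>x\<in>UNIV. \<Sum>y\<in>UNIV. c x y) = 1"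
    using g by (auto simp: letters_def)
  then obtain f c where fc: "\<And>i. i \<in> {1..k} \<Longrightarrow> g i = point p3 (f i) (c i)"
    "\<And>i x y. i \<in> {1..k} \<Longrightarrow> 0 \<le> c i x y" "\<And>i. i \<in> {1..k} \<Longrightarrow> (\<Sum>x\<in>UNIV. \<Sum>y\<in>UNIV. c i x y) = 1"
    by metis
  define d where "d i x y = s i * c i x y" for i x y
  have d0: "0 \<le> d i x y" if "i \<in> {1..k}" for i x y using that g fc by (simp add: d_def)
  have Vd: "V = (\<Sum>i\<in>{1..k}. point p3 (f i) (d i))"
    unfolding Veq [symmetric] d_def using g fc by (intro sum.cong refl) (simp add: point_scale[OF ch])
  define px where "px x = (\<Sum>y\<in>UNIV. fst V $ (x, y))" for x
  have qd: "fst V $ (x, y) = (\<Sum>i\<in>{1..k}. d i x y)" for x y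
    unfolding Vd by (rule point_components)
  have qp: "(\<Sum>i\<in>{1..k}. d i x y) = px x * p2 x y" for x y
  proof -
    have "fst V $ (x, y) = px x * p2 x y" using V unfolding region_def px_def by blast
    then show ?thesis unfolding qd .
  qed
  \<comment> \<open>Where \<open>px x * p2 x y\<close> vanishes, division says nothing and all mass
    goes to the value 1. It belongs to \<open>{1..k}\<close> because the weights \<open>s\<close>
    sum to 1.\<close>
  define pu where "pu x y i = (if i \<in> {1..k} then if px x * p2 x y = 0 then of_bool (i = 1) else d i x y / (px x * p2 x y) else 0)"
    for x y i
  have k: "1 \<in> {1..k}" using s1 by (cases k) auto
  have pu: "px x * p2 x y * pu x y i = d i x y" if "i \<in> {1..k}" for x y i
  proof (cases "px x * p2 x y = 0")
    case True
    then have "(\<Sum>i\<in>{1..k}. d i x y) = 0" by (simp only: qp)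
    then have "d i x y = 0" using d0 that by (subst (asm) sum_nonneg_eq_0_iff) auto
    then show ?thesis using True by auto
  qed (use that in \<open>simp add: pu_def\<close>)
  have q0: "0 \<le> fst V $ (x, y)" for x y unfolding qd using d0 by (intro sum_nonneg) auto
  have px0: "0 \<le> px x" for x unfolding px_def using q0 by (intro sum_nonneg) auto
  have pxp2: "0 \<le> px x * p2 x y" for x y using px0 ch by (simp add: relay_channel_def)
  have "admissible_input {1..k} px pu"
    unfolding admissible_input_def
  proof (intro conjI allI)
    show "0 \<le> px x" for x by (rule px0)
    have "(\<Sum>x\<in>UNIV. px x) = (\<Sum>x\<in>UNIV. \<Sum>y\<in>UNIV. \<Sum>i\<in>{1..k}. d i x y)"
      unfolding px_def qd ..
    also have "\<dots> = (\<Sum>i\<in>{1..k}. \<Sum>x\<in>UNIV. \<Sum>y\<in>UNIV. d i x y)"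
      by (simp only: sum.swap[of _ "{1..k}" UNIV])
    also have "\<dots> = (\<Sum>i\<in>{1..k}. s i)"
      by (intro sum.cong refl) (simp add: d_def sum_distrib_left [symmetric] fc)
    finally show "(\<Sum>x\<in>UNIV. px x) = 1" using s1 by simp
    show "0 \<le> pu x y i" for x y i
      using d0[of i x y] pxp2[of x y] by (auto simp: pu_def)
    show "(\<Sum>i\<in>{1..k}. pu x y i) = 1" for x y
    proof (cases "px x * p2 x y = 0")
      case True
      then have "(\<Sum>i\<in>{1..k}. pu x y i) = (\<Sum>i\<in>{1..k}. if i = 1 then 1 else 0)"
        by (intro sum.cong) (auto simp: pu_def)
      then show ?thesis using k by (simp add: sum.delta)
    next
      case False
      then have "(\<Sum>i\<in>{1..k}. pu x y i) = (\<Sum>i\<in>{1..k}. d i x y / (px x * p2 x y))"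
        by (intro sum.cong) (auto simp: pu_def)
      also have "\<dots> = 1" using False by (simp only: sum_divide_distrib [symmetric] qp) simp
      finally show ?thesis .
    qed
  qed simp
  then interpret relay_input p2 p3 "{1..k}" px pu f
    using ch by unfold_locales
  have "v = V" unfolding v_def Vd by (intro sum.cong refl) (simp add: pu cong: if_cong)
  then have "obj V = rate_expr p2 p3 {1..k} px pu f" using rate_expr_obj by simp
  then show ?thesis using input unfolding rate_values_def by blast
qed

lemma rate_values_eq:
  assumes "relay_channel p2 p3"
  shows "rate_values p2 p3 = obj ` region p2 p3"
proof
  show "obj ` region p2 p3 \<subseteq> rate_values p2 p3" using region_point_is_rate[OF assms] by auto
  show "rate_values p2 p3 \<subseteq> obj ` region p2 p3"
  proof
    fix a assume "a \<in> rate_values p2 p3"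
    then obtain Us px1 pu fx2 where a: "a = rate_expr p2 p3 Us px1 pu fx2" "admissible_input Us px1 pu"
      by (auto simp: rate_values_def)
    interpret relay_input p2 p3 Us px1 pu fx2 using assms a by unfold_locales
    show "a \<in> obj ` region p2 p3" using a rate_expr_obj v_in_region by auto
  qed
qed

section \<open>Compactness and attainment\<close>

lemma compact_simplex: "compact {q :: real ^ 'n::finite. (\<forall>i. 0 \<le> q $ i) \<and> (\<Sum>i\<in>UNIV. q $ i) = 1}"
proof -
  let ?S = "{q :: real ^ 'n::finite. (\<forall>i. 0 \<le> q $ i) \<and> (\<Sum>i\<in>UNIV. q $ i) = 1}"
  have "bounded ?S"
  proof (rule boundedI)
    fix q :: "real ^ 'n" assume "q \<in> ?S"
    then show "norm q \<le> 1" using norm_le_l1_cart[of q] by simp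
  qed
  moreover have "closed ?S"
    by (intro closed_Collect_conj closed_Collect_all closed_Collect_le closed_Collect_eq continuous_intros)
  ultimately show ?thesis by (simp add: compact_eq_bounded_closed)
qed

lemma continuous_on_ent_compose:
  assumes "continuous_on S g" "\<And>x. x \<in> S \<Longrightarrow> 0 \<le> g x"
  shows "continuous_on S (\<lambda>x. ent (g x))"
  using assms by (intro continuous_on_compose2[OF continuous_on_ent]) auto

text \<open>There are only finitely many deterministic maps \<open>f\<close>, and for each of them
  the points are a continuous image of the probability simplex.\<close>

lemma compact_letters:
  fixes p3 :: "'x1::finite \<Rightarrow> 'x2::finite \<Rightarrow> 'y2::finite \<Rightarrow> 'y3::finite \<Rightarrow> real"
  assumes p3: "\<And>x x2 y z. 0 \<le> p3 x x2 y z"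
  shows "compact (letters p3)"
proof -
  let ?S = "{q :: real ^ ('x1 \<times> 'y2). (\<forall>i. 0 \<le> q $ i) \<and> (\<Sum>i\<in>UNIV. q $ i) = 1}"
  have sumS: "(\<Sum>i\<in>UNIV. F i) = (\<Sum>x\<in>UNIV. \<Sum>y\<in>UNIV. F (x, y))" for F :: "'x1 \<times> 'y2 \<Rightarrow> real"
    by (simp add: sum.cartesian_product)
  have eq: "letters p3 = (\<Union>f. (\<lambda>q. point p3 f (\<lambda>x y. q $ (x, y))) ` ?S)"
  proof (intro equalityI subsetI)
    fix a assume "a \<in> letters p3"
    then obtain f c where a: "a = point p3 f c" "\<forall>x y. 0 \<le> c x y" "(\<Sum>x\<in>UNIV. \<Sum>y\<in>UNIV. c x y) = 1"
      by (auto simp: letters_def)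
    then have "a = point p3 f (\<lambda>x y. (\<chi> i. c (fst i) (snd i)) $ (x, y))" "(\<chi> i. c (fst i) (snd i)) \<in> ?S"
      by (simp_all add: sumS)
    then show "a \<in> (\<Union>f. (\<lambda>q. point p3 f (\<lambda>x y. q $ (x, y))) ` ?S)" by blast
  qed (auto simp: letters_def sumS)
  have cont: "continuous_on ?S (\<lambda>q. point p3 f (\<lambda>x y. q $ (x, y)))" for f
    unfolding point_def hdiff_def out_def
    by (intro continuous_intros continuous_on_ent_compose sum_nonneg mult_nonneg_nonneg p3) auto
  show ?thesis
    unfolding eq by (intro compact_UN compact_continuous_image compact_simplex cont) simp
qed

text \<open>Continuity of \<open>ent\<close> is established on \<open>{0..}\<close> only, so the
  coordinates to which the objective applies it must be nonnegative on the whole hull. The last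
  coordinate is a difference and enters linearly.\<close>

lemma hull_nonneg:
  fixes p3 :: "'x1::finite \<Rightarrow> 'x2::finite \<Rightarrow> 'y2::finite \<Rightarrow> 'y3::finite \<Rightarrow> real"
  assumes p3: "\<And>x x2 y z. 0 \<le> p3 x x2 y z" and V: "V \<in> convex hull letters p3"
  shows "0 \<le> fst V $ i" "0 \<le> fst (snd V) $ z"
proof -
  let ?N = "{V :: ('x1, 'y2, 'y3) point. (\<forall>i. 0 \<le> fst V $ i) \<and> (\<forall>z. 0 \<le> fst (snd V) $ z)}"
  have "letters p3 \<subseteq> ?N"
    unfolding letters_def point_def using p3 by (auto intro!: sum_nonneg out_nonneg)
  moreover have "convex ?N"
    by (rule convexI) auto
  ultimately have "convex hull letters p3 \<subseteq> ?N" by (rule hull_minimal)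
  then show "0 \<le> fst V $ i" "0 \<le> fst (snd V) $ z" using V by blast+
qed

lemma rate_values_has_max:
  fixes p2 :: "'x1::finite \<Rightarrow> 'y2::finite \<Rightarrow> real"
    and p3 :: "'x1 \<Rightarrow> 'x2::finite \<Rightarrow> 'y2 \<Rightarrow> 'y3::finite \<Rightarrow> real"
  assumes ch: "relay_channel p2 p3"
  shows "\<exists>a\<in>rate_values p2 p3. \<forall>b\<in>rate_values p2 p3. b \<le> a"
proof -
  have p3: "\<And>x x2 y z. 0 \<le> p3 x x2 y z" using ch by (simp add: relay_channel_def)
  have cl: "closed {v :: ('x1, 'y2, 'y3) point. \<forall>x y. fst v $ (x, y) = (\<Sum>y'\<in>UNIV. fst v $ (x, y')) * p2 x y}"
    by (intro closed_Collect_all closed_Collect_eq continuous_intros)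
  have "region p2 p3 = convex hull letters p3 \<inter>
      {v. \<forall>x y. fst v $ (x, y) = (\<Sum>y'\<in>UNIV. fst v $ (x, y')) * p2 x y}"
    by (auto simp: region_def)
  \<comment> \<open>The fixed finite dimension matters here: the hull of a compact set is then
    compact, by Caratheodory's theorem, and no explicit bound on the alphabet of \<open>U\<close>
    has to be produced.\<close>
  then have comp: "compact (region p2 p3)"
    using compact_Int_closed[OF compact_convex_hull[OF compact_letters[OF p3]] cl] by simp
  have nn: "0 \<le> fst V $ i" "0 \<le> fst (snd V) $ z" if "V \<in> region p2 p3" for V i z
  proof -
    have "V \<in> convex hull letters p3" using that by (simp add: region_def)
    from hull_nonneg(1)[OF _ this] hull_nonneg(2)[OF _ this] p3
    show "0 \<le> fst V $ i" "0 \<le> fst (snd V) $ z" by blast+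
  qed
  have "continuous_on (region p2 p3) obj"
    unfolding obj_def [abs_def] obj1_def obj2_def
    by (intro continuous_intros continuous_on_ent_compose sum_nonneg nn)
  then have "compact (rate_values p2 p3)"
    unfolding rate_values_eq[OF ch] using comp by (rule compact_continuous_image)
  moreover have "rate_values p2 p3 \<noteq> {}"
  proof -
    have "admissible_input {0} (\<lambda>x. if x = undefined then 1 else 0) (\<lambda>x y u. 1 :: real)"
      by (simp add: admissible_input_def)
    then show ?thesis unfolding rate_values_def by blast
  qed
  ultimately show ?thesis by (rule compact_attains_sup)
qed

subsection \<open>Converse\<close>

lemma sum_functions_prod:
  fixes \<kappa> :: "'a::finite \<Rightarrow> 'b::finite \<Rightarrow> real"
  shows "(\<Sum>g\<in>UNIV. \<Prod>y\<in>UNIV. \<kappa> y (g y)) = (\<Prod>y\<in>UNIV. \<Sum>x\<in>UNIV. \<kappa> y x)"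
  using prod_sum_PiE[of "UNIV :: 'a set" "\<lambda>_. UNIV :: 'b set" \<kappa>] by (simp add: PiE_UNIV_domain)

text \<open>A map drawn by choosing its values independently with laws \<open>\<kappa> y\<close> has
  the value law \<open>\<kappa> y0\<close> at \<open>y0\<close>. This is how a random relay symbol
  becomes a random choice among deterministic maps.\<close>

lemma sum_functions_prod_apply:
  fixes \<kappa> :: "'a::finite \<Rightarrow> 'b::finite \<Rightarrow> real"
  assumes "\<And>y. (\<Sum>x\<in>UNIV. \<kappa> y x) = 1"
  shows "(\<Sum>g\<in>UNIV. (\<Prod>y\<in>UNIV. \<kappa> y (g y)) * F (g y0)) = (\<Sum>x\<in>UNIV. \<kappa> y0 x * F x)"
proof -
  have "(\<Prod>y\<in>UNIV. \<kappa> y (g y)) * F (g y0) = (\<Prod>y\<in>UNIV. \<kappa> y (g y) * (if y = y0 then F (g y) else 1))" for g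
    by (simp add: prod.distrib prod.delta)
  then have "(\<Sum>g\<in>UNIV. (\<Prod>y\<in>UNIV. \<kappa> y (g y)) * F (g y0))
      = (\<Prod>y\<in>UNIV. \<Sum>x\<in>UNIV. \<kappa> y x * (if y = y0 then F x else 1))"
    using sum_functions_prod[of "\<lambda>y x. \<kappa> y x * (if y = y0 then F x else 1)"] by simp
  also have "\<dots> = (\<Prod>y\<in>UNIV. if y = y0 then (\<Sum>x\<in>UNIV. \<kappa> y0 x * F x) else 1)"
    using assms by (intro prod.cong) auto
  also have "\<dots> = (\<Sum>x\<in>UNIV. \<kappa> y0 x * F x)" by (simp add: prod.delta)
  finally show ?thesis .
qed

text \<open>The relay input may be random given the auxiliary variable. Writing its kernel as a product
  mixture of deterministic maps only increases the objective, because entropy is concave.\<close>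

lemma randomized_point:
  fixes p3 :: "'x1::finite \<Rightarrow> 'x2::finite \<Rightarrow> 'y2::finite \<Rightarrow> 'y3::finite \<Rightarrow> real"
  assumes ch: "relay_channel p2 p3" and fin: "finite A"
    and b0: "\<And>u y x. 0 \<le> b u y x" and a: "\<And>u y. a u y = (\<Sum>x\<in>UNIV. b u y x)"
    and e: "\<And>u z. u \<in> A \<Longrightarrow> e u z = (\<Sum>y\<in>UNIV. \<Sum>x\<in>UNIV. b u y x * p3 (\<xi> u) x y z)"
    and one: "(\<Sum>u\<in>A. \<Sum>y\<in>UNIV. a u y) = 1"
  shows "\<exists>v\<in>convex hull letters p3. (\<forall>x y. fst v $ (x, y) = (\<Sum>u\<in>A. of_bool (\<xi> u = x) * a u y)) \<and>
     (\<forall>z. fst (snd v) $ z = (\<Sum>u\<in>A. e u z)) \<and>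
     (\<Sum>u\<in>A. (\<Sum>y\<in>UNIV. ent (a u y)) - (\<Sum>z\<in>UNIV. ent (e u z))) \<le> snd (snd v)"
proof -
  have p3: "\<And>x x2 y z. 0 \<le> p3 x x2 y z" using ch by (auto simp: relay_channel_def)
  have a0: "0 \<le> a u y" for u y unfolding a using b0 by (intro sum_nonneg)
  \<comment> \<open>The conditional law of the relay symbol; on pairs of probability zero a point
    mass at an arbitrary letter keeps it a kernel.\<close>
  define \<kappa> where "\<kappa> u y x = (if a u y = 0 then of_bool (x = undefined) else b u y x / a u y)" for u y x
  have \<kappa>0: "0 \<le> \<kappa> u y x" for u y x using a0 b0 by (simp add: \<kappa>_def)
  have \<kappa>1: "(\<Sum>x\<in>UNIV. \<kappa> u y x) = 1" for u y
  proof (cases "a u y = 0")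
    case True
    then have "(\<Sum>x\<in>UNIV. \<kappa> u y x) = (\<Sum>x\<in>(UNIV :: 'x2 set). if x = undefined then 1 else 0)"
      by (intro sum.cong) (auto simp: \<kappa>_def)
    then show ?thesis by (simp add: sum.delta)
  qed (simp add: \<kappa>_def sum_divide_distrib [symmetric] a)
  have a\<kappa>: "a u y * \<kappa> u y x = b u y x" for u y x
  proof (cases "a u y = 0")
    case True
    then have "b u y x = 0" using b0 unfolding a by (subst (asm) sum_nonneg_eq_0_iff) auto
    then show ?thesis using True by simp
  qed (simp add: \<kappa>_def)
  define W where "W u g = (\<Prod>y\<in>UNIV. \<kappa> u y (g y))" for u g
  have W0: "0 \<le> W u g" for u g unfolding W_def using \<kappa>0 by (intro prod_nonneg) auto
  have WF: "(\<Sum>g\<in>UNIV. W u g * F (g y)) = (\<Sum>x\<in>UNIV. \<kappa> u y x * F x)" for u F y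
    unfolding W_def by (rule sum_functions_prod_apply[OF \<kappa>1])
  have W1: "(\<Sum>g\<in>UNIV. W u g) = 1" for u
    using WF[of u "\<lambda>_. 1"] by (simp add: \<kappa>1)
  \<comment> \<open>The auxiliary value determines the sender's letter \<open>\<xi> u\<close>, so
    its law lives on one row. It does not depend on \<open>g\<close>, hence the mixture changes only
    the output part of \<open>hdiff\<close>.\<close>
  define ca where "ca u x y = of_bool (\<xi> u = x) * a u y" for u x y
  have ca0: "0 \<le> ca u x y" for u x y using a0 by (simp add: ca_def)
  define c where "c i x y = W (fst i) (snd i) * ca (fst i) x y" for i x y
  define f where "f i = (\<lambda>(x::'x1) y. snd i y)" for i :: "'a \<times> ('y2 \<Rightarrow> 'x2)"
  define I where "I = A \<times> (UNIV :: ('y2 \<Rightarrow> 'x2) set)"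
  define v where "v = (\<Sum>i\<in>I. point p3 (f i) (c i))"
  have sumI: "(\<Sum>i\<in>I. F i) = (\<Sum>u\<in>A. \<Sum>g\<in>UNIV. F (u, g))" for F :: "_ \<Rightarrow> real"
    unfolding I_def by (rule sum_Times)
  define o' where "o' u g z = (\<Sum>y\<in>UNIV. a u y * p3 (\<xi> u) (g y) y z)" for u g z
  have o0: "0 \<le> o' u g z" for u g z unfolding o'_def using a0 p3 by (intro sum_nonneg mult_nonneg_nonneg)
  have out_ca: "out p3 (f (u, g)) (ca u) x z = of_bool (\<xi> u = x) * o' u g z" for u g x z
    unfolding out_def ca_def o'_def f_def by (cases "\<xi> u = x") auto
  have mix: "(\<Sum>g\<in>UNIV. W u g * o' u g z) = e u z" if "u \<in> A" for u z
  proof -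
    have "(\<Sum>g\<in>UNIV. W u g * o' u g z) = (\<Sum>y\<in>UNIV. a u y * (\<Sum>g\<in>UNIV. W u g * p3 (\<xi> u) (g y) y z))"
      unfolding o'_def sum_distrib_left by (subst sum.swap) (simp only: mult_ac)
    also have "\<dots> = (\<Sum>y\<in>UNIV. a u y * (\<Sum>x\<in>UNIV. \<kappa> u y x * p3 (\<xi> u) x y z))"
      by (intro sum.cong refl arg_cong2[where f = "(*)"] WF[where F = "\<lambda>x. p3 (\<xi> _) x _ z"])
    also have "\<dots> = e u z"
      unfolding e[OF that] sum_distrib_left by (simp only: mult.assoc [symmetric] a\<kappa>)
    finally show ?thesis .
  qed
  have pt: "point p3 (f (u, g)) (c (u, g)) = W u g *\<^sub>R point p3 (f (u, g)) (ca u)" for u g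
    unfolding c_def fst_conv snd_conv using ca0 W0 by (intro point_scale[OF ch])
  have v: "v = (\<Sum>u\<in>A. \<Sum>g\<in>UNIV. W u g *\<^sub>R point p3 (f (u, g)) (ca u))"
    unfolding v_def I_def by (simp add: sum.cartesian_product pt split_def flip: pt)
  have sx: "(\<Sum>x\<in>UNIV. of_bool (\<xi> u = x) * t) = t" for u and t :: real
  proof -
    have "(\<Sum>x\<in>UNIV. of_bool (\<xi> u = x) * t) = (\<Sum>x\<in>UNIV. if x = \<xi> u then t else 0)"
      by (intro sum.cong) auto
    then show ?thesis by (simp add: sum.delta)
  qed
  have sy: "(\<Sum>x\<in>UNIV. \<Sum>y\<in>UNIV. of_bool (\<xi> u = x) * F y) = (\<Sum>y\<in>UNIV. F y)"
    for u and F :: "'b::finite \<Rightarrow> real"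
    by (simp only: sum_distrib_left [symmetric] sx)
  have "v \<in> convex hull letters p3"
    unfolding v_def
  proof (rule sum_point_in_hull[OF ch])
    show "finite I" using fin by (simp add: I_def)
    show "0 \<le> c i x y" for i x y unfolding c_def using W0 ca0 by simp
    have "(\<Sum>i\<in>I. \<Sum>x\<in>UNIV. \<Sum>y\<in>UNIV. c i x y)
        = (\<Sum>u\<in>A. \<Sum>g\<in>UNIV. W u g * (\<Sum>x\<in>UNIV. \<Sum>y\<in>UNIV. ca u x y))"
      unfolding sumI c_def fst_conv snd_conv sum_distrib_left ..
    also have "\<dots> = (\<Sum>u\<in>A. \<Sum>x\<in>UNIV. \<Sum>y\<in>UNIV. ca u x y)"
      by (simp only: sum_distrib_right [symmetric] W1 mult_1)
    also have "\<dots> = 1" unfolding ca_def sy by (rule one)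
    finally show "(\<Sum>i\<in>I. \<Sum>x\<in>UNIV. \<Sum>y\<in>UNIV. c i x y) = 1" .
  qed
  moreover have "fst v $ (x, y) = (\<Sum>u\<in>A. of_bool (\<xi> u = x) * a u y)" for x y
  proof -
    have "fst v $ (x, y) = (\<Sum>u\<in>A. \<Sum>g\<in>UNIV. W u g * ca u x y)"
      unfolding v by (simp add: fst_sum point_def)
    then show ?thesis by (simp only: sum_distrib_right [symmetric] W1 mult_1 ca_def)
  qed
  moreover have "fst (snd v) $ z = (\<Sum>u\<in>A. e u z)" for z
  proof -
    have "fst (snd v) $ z = (\<Sum>u\<in>A. \<Sum>g\<in>UNIV. W u g * (\<Sum>x\<in>UNIV. of_bool (\<xi> u = x) * o' u g z))"
      unfolding v by (simp only: fst_sum snd_sum point_def sum_component scaleR_prod_def fst_conv snd_conv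
        vector_scaleR_component vec_lambda_beta real_scaleR_def out_ca)
    also have "\<dots> = (\<Sum>u\<in>A. e u z)" unfolding sx by (intro sum.cong refl mix)
    finally show ?thesis .
  qed
  moreover have "(\<Sum>u\<in>A. (\<Sum>y\<in>UNIV. ent (a u y)) - (\<Sum>z\<in>UNIV. ent (e u z))) \<le> snd (snd v)"
  proof -
    have h: "hdiff p3 (f (u, g)) (ca u) = (\<Sum>y\<in>UNIV. ent (a u y)) - (\<Sum>z\<in>UNIV. ent (o' u g z))" for u g
    proof -
      have ob: "ent (of_bool B * t) = of_bool B * ent t" for B t by (cases B) auto
      show ?thesis unfolding hdiff_def out_ca unfolding ca_def ob sy ..
    qed
    have "snd (snd v) = (\<Sum>u\<in>A. \<Sum>g\<in>UNIV. W u g * hdiff p3 (f (u, g)) (ca u))"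
      unfolding v by (simp add: snd_sum point_def)
    also have "\<dots> = (\<Sum>u\<in>A. (\<Sum>y\<in>UNIV. ent (a u y)) - (\<Sum>z\<in>UNIV. \<Sum>g\<in>UNIV. W u g * ent (o' u g z)))"
    proof (intro sum.cong refl)
      fix u
      have "(\<Sum>g\<in>UNIV. W u g * hdiff p3 (f (u, g)) (ca u))
         = (\<Sum>g\<in>UNIV. W u g * (\<Sum>y\<in>UNIV. ent (a u y))) - (\<Sum>g\<in>UNIV. \<Sum>z\<in>UNIV. W u g * ent (o' u g z))"
        unfolding h right_diff_distrib sum_subtractf sum_distrib_left ..
      then show "(\<Sum>g\<in>UNIV. W u g * hdiff p3 (f (u, g)) (ca u))
         = (\<Sum>y\<in>UNIV. ent (a u y)) - (\<Sum>z\<in>UNIV. \<Sum>g\<in>UNIV. W u g * ent (o' u g z))"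
        by (simp only: sum_distrib_right [symmetric] W1 mult_1 sum.swap[of _ "UNIV :: ('y2 \<Rightarrow> 'x2) set" "UNIV :: 'y3 set"])
    qed
    \<comment> \<open>For fixed \<open>u\<close> the output laws of the maps average to
      \<open>e u\<close>. Concavity bounds their mean entropy by that of \<open>e u\<close>, and it
      enters with a minus sign.\<close>
    also have "\<dots> \<ge> (\<Sum>u\<in>A. (\<Sum>y\<in>UNIV. ent (a u y)) - (\<Sum>z\<in>UNIV. ent (e u z)))"
    proof (intro sum_mono diff_mono order_refl)
      fix u z assume "u \<in> A"
      show "(\<Sum>g\<in>UNIV. W u g * ent (o' u g z)) \<le> ent (e u z)"
        using ent_jensen[of UNIV "W u" "\<lambda>g. o' u g z"] W0 W1 o0 mix[OF \<open>u \<in> A\<close>] by simp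
    qed
    finally show ?thesis .
  qed
  ultimately show ?thesis by blast
qed

lemma ent_prod_words:
  fixes k :: "nat \<Rightarrow> 'a::finite \<Rightarrow> real"
  assumes "\<And>i y. 0 \<le> k i y" "\<And>i. (\<Sum>y\<in>UNIV. k i y) = 1"
  shows "(\<Sum>ys\<in>words n UNIV. ent (\<Prod>i<n. k i (ys ! i))) = (\<Sum>i<n. \<Sum>y\<in>UNIV. ent (k i y))"
  using assms
proof (induction n arbitrary: k)
  case (Suc n)
  define R where "R ys = (\<Prod>i<n. k (Suc i) (ys ! i))" for ys
  have R0: "0 \<le> R ys" for ys unfolding R_def using Suc.prems by (intro prod_nonneg) auto
  have R1: "(\<Sum>ys\<in>words n UNIV. R ys) = 1"
    unfolding R_def using sum_words_prod[where f = "\<lambda>i. k (Suc i)" and n = n and A = UNIV] Suc.prems by simp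
  have RE: "(\<Sum>ys\<in>words n UNIV. ent (R ys)) = (\<Sum>i<n. \<Sum>y\<in>UNIV. ent (k (Suc i) y))"
    unfolding R_def using Suc.prems by (intro Suc.IH[of "\<lambda>i. k (Suc i)"])
  have "(\<Sum>ys\<in>words (Suc n) UNIV. ent (\<Prod>i<Suc n. k i (ys ! i)))
      = (\<Sum>y\<in>UNIV. \<Sum>ys\<in>words n UNIV. R ys * ent (k 0 y) + k 0 y * ent (R ys))"
    unfolding sum_words_Suc prod.lessThan_Suc_shift R_def [symmetric] comp_def
    using Suc.prems R0 by (simp add: R_def [symmetric] ent_mult)
  also have "\<dots> = (\<Sum>y\<in>UNIV. ent (k 0 y)) + (\<Sum>i<n. \<Sum>y\<in>UNIV. ent (k (Suc i) y))"
    by (simp only: sum.distrib sum_distrib_right [symmetric] sum_distrib_left [symmetric] R1 RE Suc.prems mult_1)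
  finally show ?case by (simp only: sum.lessThan_Suc_shift comp_def)
qed simp

text \<open>Gibbs' inequality for the sent message against the law under which message and observation
  are independent, tilted by the factor \<open>M\<close> where decoding succeeds. The observation \<open>z\<close> need only be
  a degraded version of \<open>y\<close>, so Fano's inequality and data processing are obtained in one step.\<close>

lemma fano:
  fixes a :: "nat \<Rightarrow> 'b \<Rightarrow> real" and k :: "'b \<Rightarrow> 'c \<Rightarrow> real" and M :: nat and dec :: "'c \<Rightarrow> nat option"
  assumes M: "M > 0" and fin: "finite B" "finite C"
    and a0: "\<And>m y. 0 \<le> a m y" and a1: "\<And>m. m \<in> {1..M} \<Longrightarrow> (\<Sum>y\<in>B. a m y) = 1 / M"
    and k0: "\<And>y z. 0 \<le> k y z" and k1: "\<And>y. y \<in> B \<Longrightarrow> (\<Sum>z\<in>C. k y z) = 1"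
  defines "Pe \<equiv> \<Sum>m\<in>{1..M}. \<Sum>y\<in>B. \<Sum>z\<in>C. a m y * k y z * of_bool (dec z \<noteq> Some m)"
  shows "(1 - Pe) * log 2 M - 1 \<le> log 2 M + (\<Sum>y\<in>B. ent (\<Sum>m\<in>{1..M}. a m y))
     - (\<Sum>m\<in>{1..M}. \<Sum>y\<in>B. ent (a m y))"
proof -
  define aY where "aY y = (\<Sum>m\<in>{1..M}. a m y)" for y
  define \<phi> where "\<phi> m z = (if dec z = Some m then real M else 1)" for m z
  define S where "S = {1..M} \<times> B \<times> C"
  define p where "p = (\<lambda>(m, y, z). a m y * k y z)"
  \<comment> \<open>For each \<open>z\<close> at most one message is decoded, so the sum of
    \<open>\<phi> m z\<close> over \<open>m\<close> is at most \<open>2 * M\<close>. Halving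
    restores total mass at most 1 and is the source of the lost bit in the conclusion.\<close>
  define q where "q = (\<lambda>(m, y, z). (1 / M) * aY y * k y z * \<phi> m z / 2)"
  have sumS: "(\<Sum>t\<in>S. F t) = (\<Sum>m\<in>{1..M}. \<Sum>y\<in>B. \<Sum>z\<in>C. F (m, y, z))" for F :: "_ \<Rightarrow> real"
    unfolding S_def sum_Times ..
  have aY0: "0 \<le> aY y" for y unfolding aY_def using a0 by (intro sum_nonneg)
  have aYpos: "aY y > 0" if "m \<in> {1..M}" "a m y > 0" for m y
    unfolding aY_def using that a0 by (intro sum_pos2[of _ m]) auto
  have \<phi>0: "\<phi> m z > 0" for m z using M by (simp add: \<phi>_def)
  have sk: "(\<Sum>z\<in>C. t * k y z) = t" if "y \<in> B" for t y
    using k1[OF that] by (simp add: sum_distrib_left [symmetric])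
  have suma: "(\<Sum>m\<in>{1..M}. \<Sum>y\<in>B. a m y) = 1" using a1 M by simp
  have sumaY: "(\<Sum>y\<in>B. aY y) = 1" unfolding aY_def using suma by (subst sum.swap)
  have sp: "sum p S = 1"
  proof -
    have "sum p S = (\<Sum>m\<in>{1..M}. \<Sum>y\<in>B. \<Sum>z\<in>C. a m y * k y z)" unfolding sumS p_def by simp
    also have "\<dots> = (\<Sum>m\<in>{1..M}. \<Sum>y\<in>B. a m y)" by (intro sum.cong refl sk)
    finally show ?thesis using suma by simp
  qed
  have sq: "sum q S \<le> 1"
  proof -
    have \<phi>2: "(\<Sum>m\<in>{1..M}. \<phi> m z) \<le> 2 * M" for z
    proof -
      have "(\<Sum>m\<in>{1..M}. \<phi> m z) \<le> (\<Sum>m\<in>{1..M}. 1 + (if m = the (dec z) then real M else 0))"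
        by (intro sum_mono) (auto simp: \<phi>_def)
      also have "\<dots> = M + (\<Sum>m\<in>{1..M}. if m = the (dec z) then real M else 0)"
        by (simp add: sum.distrib)
      also have "\<dots> \<le> M + M" by (simp add: sum.delta)
      finally show ?thesis by simp
    qed
    have "sum q S = (\<Sum>m\<in>{1..M}. \<Sum>y\<in>B. \<Sum>z\<in>C. (aY y * k y z / (2 * M)) * \<phi> m z)"
      unfolding sumS q_def by (simp add: mult_ac)
    also have "\<dots> = (\<Sum>y\<in>B. \<Sum>z\<in>C. \<Sum>m\<in>{1..M}. (aY y * k y z / (2 * M)) * \<phi> m z)"
      by (simp only: sum.swap[of _ B "{1..M}"] sum.swap[of _ C "{1..M}"])
    also have "\<dots> = (\<Sum>y\<in>B. \<Sum>z\<in>C. (aY y * k y z / (2 * M)) * (\<Sum>m\<in>{1..M}. \<phi> m z))"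
      by (simp only: sum_distrib_left)
    also have "\<dots> \<le> (\<Sum>y\<in>B. \<Sum>z\<in>C. (aY y * k y z / (2 * M)) * (2 * M))"
      using aY0 k0 by (intro sum_mono mult_left_mono \<phi>2) auto
    also have "\<dots> = (\<Sum>y\<in>B. \<Sum>z\<in>C. aY y * k y z)" using M by simp
    also have "\<dots> = (\<Sum>y\<in>B. aY y)" by (intro sum.cong refl sk)
    finally show ?thesis using sumaY by simp
  qed
  have "(\<Sum>t\<in>S. p t * log 2 (q t / p t)) \<le> 0"
  proof (rule gibbs)
    fix t assume t: "t \<in> S"
    obtain m y z where tm: "t = (m, y, z)" by (cases t)
    show "0 \<le> p t" using a0 k0 by (simp add: p_def tm)
    show "0 \<le> q t" using aY0 k0 \<phi>0[of m z] by (simp add: q_def tm)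
    show "0 < q t" if "0 < p t"
    proof -
      have ak: "a m y > 0" "k y z > 0" using that a0[of m y] k0[of y z] by (auto simp: p_def tm zero_less_mult_iff)
      have "m \<in> {1..M}" using t by (simp add: S_def tm)
      then show ?thesis using ak aYpos[of m y] \<phi>0[of m z] M by (simp add: q_def tm)
    qed
  qed (use sp sq in simp)
  moreover have "p (m, y, z) * log 2 (q (m, y, z) / p (m, y, z))
      = a m y * (log 2 (aY y) - log 2 (a m y)) * k y z - a m y * k y z
        - log 2 M * (a m y * k y z * of_bool (dec z \<noteq> Some m))" if m: "m \<in> {1..M}" for m y z
  proof (cases "a m y * k y z = 0")
    case False
    then have pos: "a m y > 0" "k y z > 0" using a0[of m y] k0[of y z] by (auto simp: less_le)
    have "q (m, y, z) / p (m, y, z) = aY y * \<phi> m z / (M * 2 * a m y)"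
      using pos by (simp add: p_def q_def field_simps)
    then have "log 2 (q (m, y, z) / p (m, y, z)) = log 2 (aY y) + log 2 (\<phi> m z) - log 2 M - 1 - log 2 (a m y)"
      using pos aYpos[OF m pos(1)] \<phi>0[of m z] M by (simp add: log_divide log_mult)
    moreover have "log 2 (\<phi> m z) = log 2 M - log 2 M * of_bool (dec z \<noteq> Some m)"
      by (simp add: \<phi>_def)
    ultimately have lq: "log 2 (q (m, y, z) / p (m, y, z))
        = log 2 (aY y) - log 2 (a m y) - 1 - log 2 M * of_bool (dec z \<noteq> Some m)" by simp
    show ?thesis unfolding lq by (simp add: p_def algebra_simps)
  qed (auto simp: p_def)
  then have "(\<Sum>t\<in>S. p t * log 2 (q t / p t))
      = (\<Sum>m\<in>{1..M}. \<Sum>y\<in>B. \<Sum>z\<in>C. a m y * (log 2 (aY y) - log 2 (a m y)) * k y z - a m y * k y z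
        - log 2 M * (a m y * k y z * of_bool (dec z \<noteq> Some m)))"
    unfolding sumS by (intro sum.cong refl)
  also have "\<dots> = (\<Sum>m\<in>{1..M}. \<Sum>y\<in>B. a m y * (log 2 (aY y) - log 2 (a m y)))
        - (\<Sum>m\<in>{1..M}. \<Sum>y\<in>B. a m y) - log 2 M * Pe"
    unfolding Pe_def sum_subtractf sum_distrib_left
    by (intro arg_cong2[where f = "(-)"] sum.cong refl sk)
  also have "(\<Sum>m\<in>{1..M}. \<Sum>y\<in>B. a m y * (log 2 (aY y) - log 2 (a m y)))
      = (\<Sum>m\<in>{1..M}. \<Sum>y\<in>B. ent (a m y)) - (\<Sum>y\<in>B. ent (aY y))"
  proof -
    have "(\<Sum>m\<in>{1..M}. \<Sum>y\<in>B. a m y * log 2 (aY y)) = (\<Sum>y\<in>B. aY y * log 2 (aY y))"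
      unfolding aY_def sum_distrib_right by (rule sum.swap)
    then show ?thesis
      by (simp add: right_diff_distrib sum_subtractf ent_def sum_negf)
  qed
  finally show ?thesis using suma by (simp add: aY_def algebra_simps)
qed

lemma marg_pair_sum:
  assumes "finite \<Omega>" "finite B" "g ` \<Omega> \<subseteq> B"
  shows "(\<Sum>b\<in>B. marg \<Omega> P (\<lambda>w. (f w, g w)) (a, b) * F b) = (\<Sum>w\<in>\<Omega>. P w * of_bool (f w = a) * F (g w))"
proof -
  have "marg \<Omega> P (\<lambda>w. (f w, g w)) (a, b) = marg \<Omega> (\<lambda>w. P w * of_bool (f w = a)) g b" for b
    using assms(1) by (simp only: marg_alt) (intro sum.cong refl, auto)
  then show ?thesis using sum_marg_mult[OF assms, of "\<lambda>w. P w * of_bool (f w = a)" F] by (simp only:)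
qed

section \<open>Fano bounds for a given code\<close>

locale relay_code =
  fixes p2 :: "'x1::finite \<Rightarrow> 'y2::finite \<Rightarrow> real"
    and p3 :: "'x1 \<Rightarrow> 'x2::finite \<Rightarrow> 'y2 \<Rightarrow> 'y3::finite \<Rightarrow> real"
    and n M :: nat and enc :: "nat \<Rightarrow> 'x1 list" and rel :: "nat \<Rightarrow> 'y2 list \<Rightarrow> 'x2"
    and dec :: "'y3 list \<Rightarrow> nat option"
  assumes channel: "relay_channel p2 p3" and n: "n > 0" and M: "M > 0"
begin

lemma p2: "0 \<le> p2 x y" "(\<Sum>y\<in>UNIV. p2 x y) = 1"
  and p3: "0 \<le> p3 x x2 y z" "(\<Sum>z\<in>UNIV. p3 x x2 y z) = 1"
  using channel by (auto simp: relay_channel_def)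

definition "W m ys = (\<Prod>i<n. p2 (enc m ! i) (ys ! i))"
definition "K m ys zs = (\<Prod>i<n. p3 (enc m ! i) (rel i ys) (ys ! i) (zs ! i))"

definition \<Omega> :: "(nat \<times> 'y2 list \<times> 'y3 list) set" where
  "\<Omega> = {1..M} \<times> words n UNIV \<times> words n UNIV"

definition "Pr = (\<lambda>(m, ys, zs). 1 / M * W m ys * K m ys zs)"

lemma finite_\<Omega>: "finite \<Omega>" by (simp add: \<Omega>_def)

lemma W0: "0 \<le> W m ys" and K0: "0 \<le> K m ys zs"
  unfolding W_def K_def by (auto intro!: prod_nonneg p2 p3)

lemma Pr_nonneg: "0 \<le> Pr w"
  by (cases w) (simp add: Pr_def W0 K0)

lemma sum_W: "(\<Sum>ys\<in>words n UNIV. W m ys) = 1"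
  unfolding W_def using sum_words_prod[where f = "\<lambda>i. p2 (enc m ! i)" and n = n and A = UNIV] by (simp add: p2)

lemma sum_K: "(\<Sum>zs\<in>words n UNIV. K m ys zs) = 1"
  unfolding K_def using sum_words_prod[where f = "\<lambda>i. p3 (enc m ! i) (rel i ys) (ys ! i)" and n = n and A = UNIV]
  by (simp add: p3)

lemma sum_\<Omega>: "(\<Sum>w\<in>\<Omega>. F w) = (\<Sum>m\<in>{1..M}. \<Sum>ys\<in>words n UNIV. \<Sum>zs\<in>words n UNIV. F (m, ys, zs))"
  for F :: "_ \<Rightarrow> real"
  unfolding \<Omega>_def sum_Times ..

lemma sum_Pr_mult:
  "(\<Sum>w\<in>\<Omega>. Pr w * F w) = (\<Sum>m\<in>{1..M}. 1 / M * (\<Sum>ys\<in>words n UNIV. W m ys * (\<Sum>zs\<in>words n UNIV. K m ys zs * F (m, ys, zs))))"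
  unfolding sum_\<Omega> Pr_def prod.case sum_distrib_left by (simp only: mult_ac)

lemma sum_Pr_mult_my:
  "(\<Sum>w\<in>\<Omega>. Pr w * F (fst w) (fst (snd w))) = (\<Sum>m\<in>{1..M}. 1 / M * (\<Sum>ys\<in>words n UNIV. W m ys * F m ys))"
  unfolding sum_Pr_mult fst_conv snd_conv sum_distrib_right [symmetric] sum_K mult_1 ..

lemma sum_Pr: "(\<Sum>w\<in>\<Omega>. Pr w) = 1"
  using sum_Pr_mult_my[of "\<lambda>_ _. 1"] M by (simp add: sum_W)

lemma err_prob_eq: "err_prob p2 p3 n M enc rel dec = (\<Sum>w\<in>\<Omega>. Pr w * of_bool (dec (snd (snd w)) \<noteq> Some (fst w)))"
proof -
  have "err_prob p2 p3 n M enc rel dec = (\<Sum>m\<in>{1..M}. 1 / M * (\<Sum>ys\<in>words n UNIV. \<Sum>zs\<in>words n UNIV.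
      W m ys * K m ys zs * of_bool (dec zs \<noteq> Some m)))"
    unfolding err_prob_def words_UNIV W_def K_def sum_distrib_left
    by (intro sum.cong refl) simp
  then show ?thesis unfolding sum_Pr_mult fst_conv snd_conv sum_distrib_left by (simp only: mult_ac)
qed

lemma err_prob_le_1: "err_prob p2 p3 n M enc rel dec \<le> 1"
proof -
  have "err_prob p2 p3 n M enc rel dec \<le> (\<Sum>w\<in>\<Omega>. Pr w)"
    unfolding err_prob_eq using Pr_nonneg by (intro sum_mono) simp
  then show ?thesis by (simp add: sum_Pr)
qed

abbreviation "H \<equiv> Hent \<Omega> Pr"

definition "msg = (\<lambda>w :: nat \<times> 'y2 list \<times> 'y3 list. fst w)"
definition "ywd = (\<lambda>w :: nat \<times> 'y2 list \<times> 'y3 list. fst (snd w))"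
definition "zwd = (\<lambda>w :: nat \<times> 'y2 list \<times> 'y3 list. snd (snd w))"

lemma rv_simps [simp]: "msg (m, ys, zs) = m" "ywd (m, ys, zs) = ys" "zwd (m, ys, zs) = zs"
  by (simp_all add: msg_def ywd_def zwd_def)

lemma marg_msg_ywd:
  assumes "m \<in> {1..M}" "ys \<in> words n UNIV"
  shows "marg \<Omega> Pr (\<lambda>w. (msg w, ywd w)) (m, ys) = 1 / M * W m ys"
proof -
  have "marg \<Omega> Pr (\<lambda>w. (msg w, ywd w)) (m, ys) = (\<Sum>w\<in>\<Omega>. Pr w * (of_bool (fst w = m) * of_bool (fst (snd w) = ys)))"
    unfolding marg_alt[OF finite_\<Omega>] by (intro sum.cong refl) (simp add: msg_def ywd_def)
  also have "\<dots> = (\<Sum>m'\<in>{1..M}. 1 / M * (\<Sum>ys'\<in>words n UNIV. W m' ys' * (of_bool (m' = m) * of_bool (ys' = ys))))"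
    by (rule sum_Pr_mult_my[where F = "\<lambda>m' ys'. of_bool (m' = m) * of_bool (ys' = ys)"])
  also have "\<dots> = (\<Sum>m'\<in>{1..M}. if m' = m then 1 / M * (\<Sum>ys'\<in>words n UNIV. if ys' = ys then W m ys' else 0) else 0)"
    by (intro sum.cong refl) (auto intro!: sum.cong)
  also have "\<dots> = 1 / M * W m ys"
    using assms by (simp add: sum.delta)
  finally show ?thesis .
qed

lemma H_msg_ywd_marg:
  "H (\<lambda>w. (msg w, ywd w)) = (\<Sum>m\<in>{1..M}. \<Sum>ys\<in>words n UNIV. ent (marg \<Omega> Pr (\<lambda>w. (msg w, ywd w)) (m, ys)))"
proof -
  have "(\<lambda>w. (msg w, ywd w)) ` \<Omega> \<subseteq> {1..M} \<times> words n UNIV" by (auto simp: \<Omega>_def)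
  from Hent_eq[OF finite_\<Omega> _ this, of Pr] show ?thesis by (simp add: sum_Times)
qed

text \<open>Given the message the codeword is fixed and the relay's observations are independent, so
  \<open>H(Y2^n|M)\<close> splits into letters with equality. Both halves of the converse rely on
  this.\<close>

lemma H_msg_ywd: "H (\<lambda>w. (msg w, ywd w)) = log 2 M + (\<Sum>i<n. \<Sum>m\<in>{1..M}. 1 / M * (\<Sum>y\<in>UNIV. ent (p2 (enc m ! i) y)))"
proof -
  have "H (\<lambda>w. (msg w, ywd w)) = (\<Sum>m\<in>{1..M}. \<Sum>ys\<in>words n UNIV. ent (marg \<Omega> Pr (\<lambda>w. (msg w, ywd w)) (m, ys)))"
    by (rule H_msg_ywd_marg)
  also have "\<dots> = (\<Sum>m\<in>{1..M}. \<Sum>ys\<in>words n UNIV. W m ys * ent (1 / M) + 1 / M * ent (W m ys))"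
    by (intro sum.cong refl) (simp only: marg_msg_ywd ent_mult W0 zero_le_divide_1_iff of_nat_0_le_iff)
  also have "\<dots> = (\<Sum>m\<in>{1..M}. ent (1 / M)) + (\<Sum>m\<in>{1..M}. 1 / M * (\<Sum>ys\<in>words n UNIV. ent (W m ys)))"
    by (simp only: sum.distrib sum_distrib_right [symmetric] sum_distrib_left [symmetric] sum_W mult_1)
  also have "(\<Sum>m\<in>{1..M}. ent (1 / M)) = log 2 M"
    using M by (simp add: ent_def log_divide)
  also have "(\<Sum>m\<in>{1..M}. 1 / M * (\<Sum>ys\<in>words n UNIV. ent (W m ys)))
      = (\<Sum>m\<in>{1..M}. 1 / M * (\<Sum>i<n. \<Sum>y\<in>UNIV. ent (p2 (enc m ! i) y)))"
    unfolding W_def by (intro sum.cong refl arg_cong2[where f = "(*)"] ent_prod_words p2)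
  also have "\<dots> = (\<Sum>i<n. \<Sum>m\<in>{1..M}. 1 / M * (\<Sum>y\<in>UNIV. ent (p2 (enc m ! i) y)))"
    unfolding sum_distrib_left[of _ _ "{..<n}"] by (rule sum.swap)
  finally show ?thesis .
qed

lemma H_subadditive_ywd: "H ywd \<le> (\<Sum>i<n. \<Sum>y\<in>UNIV. ent (marg \<Omega> Pr (\<lambda>w. ywd w ! i) y))"
  and H_subadditive_zwd: "H zwd \<le> (\<Sum>i<n. \<Sum>z\<in>UNIV. ent (marg \<Omega> Pr (\<lambda>w. zwd w ! i) z))"
proof -
  have *: "Hent \<Omega> Pr g \<le> (\<Sum>i<n. \<Sum>y\<in>UNIV. ent (marg \<Omega> Pr (\<lambda>w. g w ! i) y))"
    if g: "g ` \<Omega> \<subseteq> words n UNIV" for g :: "_ \<Rightarrow> 'a::finite list"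
  proof -
    have nn: "0 \<le> marg \<Omega> Pr g ys" for ys using Pr_nonneg by (intro marg_nonneg)
    have one: "(\<Sum>ys\<in>words n UNIV. marg \<Omega> Pr g ys) = 1"
      using sum_marg[OF finite_\<Omega> finite_words g, of Pr] sum_Pr by simp
    have "(\<Sum>ys\<in>words n UNIV. marg \<Omega> Pr g ys * of_bool (ys ! i = y)) = marg \<Omega> Pr (\<lambda>w. g w ! i) y" for i y
      using sum_marg_mult[OF finite_\<Omega> finite_words g, of Pr "\<lambda>ys. of_bool (ys ! i = y)"]
      by (simp only: marg_alt[OF finite_\<Omega>] finite)
    moreover have "Hent \<Omega> Pr g = (\<Sum>ys\<in>words n UNIV. ent (marg \<Omega> Pr g ys))"
      by (rule Hent_eq[OF finite_\<Omega> finite_words g]) simp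
    ultimately show ?thesis
      using ent_subadditive_words[of n "marg \<Omega> Pr g", OF nn one] by (simp only:)
  qed
  show "H ywd \<le> (\<Sum>i<n. \<Sum>y\<in>UNIV. ent (marg \<Omega> Pr (\<lambda>w. ywd w ! i) y))"
    by (rule *) (auto simp: \<Omega>_def)
  show "H zwd \<le> (\<Sum>i<n. \<Sum>z\<in>UNIV. ent (marg \<Omega> Pr (\<lambda>w. zwd w ! i) z))"
    by (rule *) (auto simp: \<Omega>_def)
qed

lemma fano_ywd:
  assumes "degraded p3"
  shows "(1 - err_prob p2 p3 n M enc rel dec) * log 2 M - 1 \<le> log 2 M + H ywd - H (\<lambda>w. (msg w, ywd w))"
proof -
  obtain Q where Q: "\<And>x1 x2 y z. p3 x1 x2 y z = Q x2 y z" using assms by (auto simp: degraded_def)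
  \<comment> \<open>By degradedness the kernel does not see the codeword, so message 1 can stand for
    all of them.\<close>
  define k where "k ys zs = K 1 ys zs" for ys zs
  have k: "K m ys zs = k ys zs" for m ys zs by (simp add: k_def K_def Q)
  define a where "a m ys = 1 / M * W m ys" for m ys
  have "(1 - (\<Sum>m\<in>{1..M}. \<Sum>ys\<in>words n UNIV. \<Sum>zs\<in>words n UNIV. a m ys * k ys zs * of_bool (dec zs \<noteq> Some m)))
       * log 2 M - 1
     \<le> log 2 M + (\<Sum>ys\<in>words n UNIV. ent (\<Sum>m\<in>{1..M}. a m ys)) - (\<Sum>m\<in>{1..M}. \<Sum>ys\<in>words n UNIV. ent (a m ys))"
  proof (rule fano[OF M])
    show "0 \<le> a m ys" for m ys by (simp add: a_def W0)
    show "(\<Sum>ys\<in>words n UNIV. a m ys) = 1 / M" for m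
      unfolding a_def by (simp only: sum_distrib_left [symmetric] sum_W mult_1_right)
    show "0 \<le> k ys zs" for ys zs by (simp add: k_def K0)
    show "(\<Sum>zs\<in>words n UNIV. k ys zs) = 1" for ys by (simp add: k_def sum_K)
  qed simp_all
  moreover have "(\<Sum>m\<in>{1..M}. \<Sum>ys\<in>words n UNIV. \<Sum>zs\<in>words n UNIV. a m ys * k ys zs * of_bool (dec zs \<noteq> Some m))
      = err_prob p2 p3 n M enc rel dec"
    unfolding err_prob_eq sum_\<Omega> Pr_def a_def k prod.case fst_conv snd_conv ..
  moreover have "H (\<lambda>w. (msg w, ywd w)) = (\<Sum>m\<in>{1..M}. \<Sum>ys\<in>words n UNIV. ent (a m ys))"
    unfolding H_msg_ywd_marg by (simp only: a_def marg_msg_ywd cong: sum.cong)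
  moreover have "H ywd = (\<Sum>ys\<in>words n UNIV. ent (\<Sum>m\<in>{1..M}. a m ys))"
  proof -
    have "marg \<Omega> Pr ywd ys = (\<Sum>m\<in>{1..M}. a m ys)" if "ys \<in> words n UNIV" for ys
    proof -
      have "(\<Sum>m\<in>{1..M}. a m ys) = (\<Sum>m\<in>{1..M}. marg \<Omega> Pr (\<lambda>w. (msg w, ywd w)) (m, ys))"
        using that by (simp only: a_def marg_msg_ywd cong: sum.cong)
      also have "\<dots> = (\<Sum>m\<in>{1..M}. marg \<Omega> Pr (\<lambda>w. (ywd w, msg w)) (ys, m) * 1)"
        unfolding marg_def by (intro sum.cong refl) (auto intro!: sum.cong)
      also have "\<dots> = marg \<Omega> Pr ywd ys"
        by (subst marg_pair_sum[OF finite_\<Omega>]) (auto simp: \<Omega>_def marg_alt finite_\<Omega>[unfolded \<Omega>_def])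
      finally show ?thesis by simp
    qed
    moreover have "H ywd = (\<Sum>ys\<in>words n UNIV. ent (marg \<Omega> Pr ywd ys))"
      by (rule Hent_eq[OF finite_\<Omega>]) (auto simp: \<Omega>_def)
    ultimately show ?thesis by (simp cong: sum.cong)
  qed
  ultimately show ?thesis by simp
qed

lemma fano_zwd:
  shows "(1 - err_prob p2 p3 n M enc rel dec) * log 2 M - 1 \<le> log 2 M + H zwd - H (\<lambda>w. (msg w, zwd w))"
proof -
  define a where "a m zs = marg \<Omega> Pr (\<lambda>w. (msg w, zwd w)) (m, zs)" for m zs
  \<comment> \<open>The identity kernel: here the observation is the receiver's own word, and
    nothing is lost between it and the decoder's input.\<close>
  define k where "k zs zs' = (of_bool (zs = zs') :: real)" for zs zs' :: "'y3 list"
  have sk: "(\<Sum>zs'\<in>words n UNIV. k zs zs' * F zs') = F zs" if "zs \<in> words n UNIV" for zs and F :: "_ \<Rightarrow> real"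
  proof -
    have "(\<Sum>zs'\<in>words n UNIV. k zs zs' * F zs') = (\<Sum>zs'\<in>words n UNIV. if zs' = zs then F zs else 0)"
      by (intro sum.cong) (auto simp: k_def)
    then show ?thesis using that by (simp add: sum.delta)
  qed
  have zim: "zwd ` \<Omega> \<subseteq> words n UNIV" and mim: "msg ` \<Omega> \<subseteq> {1..M}" by (auto simp: \<Omega>_def)
  have "(1 - (\<Sum>m\<in>{1..M}. \<Sum>zs\<in>words n UNIV. \<Sum>zs'\<in>words n UNIV. a m zs * k zs zs' * of_bool (dec zs' \<noteq> Some m)))
       * log 2 M - 1
     \<le> log 2 M + (\<Sum>zs\<in>words n UNIV. ent (\<Sum>m\<in>{1..M}. a m zs)) - (\<Sum>m\<in>{1..M}. \<Sum>zs\<in>words n UNIV. ent (a m zs))"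
  proof (rule fano[OF M])
    show "0 \<le> a m zs" for m zs unfolding a_def using Pr_nonneg by (intro marg_nonneg)
    show "(\<Sum>zs\<in>words n UNIV. a m zs) = 1 / M" if "m \<in> {1..M}" for m
    proof -
      have "(\<Sum>zs\<in>words n UNIV. a m zs) = (\<Sum>w\<in>\<Omega>. Pr w * of_bool (fst w = m))"
        unfolding a_def using marg_pair_sum[OF finite_\<Omega> _ zim, of Pr msg m "\<lambda>_. 1"] by (simp add: msg_def)
      also have "\<dots> = (\<Sum>m'\<in>{1..M}. 1 / M * (\<Sum>ys\<in>words n UNIV. W m' ys * of_bool (m' = m)))"
        by (rule sum_Pr_mult_my[where F = "\<lambda>m' ys. of_bool (m' = m)"])
      also have "\<dots> = (\<Sum>m'\<in>{1..M}. if m' = m then 1 / M else 0)"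
        by (intro sum.cong refl) (simp only: sum_distrib_right [symmetric] sum_W, simp)
      also have "\<dots> = 1 / M" using that by (simp add: sum.delta)
      finally show ?thesis .
    qed
    show "(\<Sum>zs'\<in>words n UNIV. k zs zs') = 1" if "zs \<in> words n UNIV" for zs
      using sk[OF that, of "\<lambda>_. 1"] by simp
  qed (simp_all add: k_def)
  moreover have "(\<Sum>m\<in>{1..M}. \<Sum>zs\<in>words n UNIV. \<Sum>zs'\<in>words n UNIV. a m zs * k zs zs' * of_bool (dec zs' \<noteq> Some m))
      = err_prob p2 p3 n M enc rel dec"
  proof -
    have "(\<Sum>m\<in>{1..M}. \<Sum>zs\<in>words n UNIV. \<Sum>zs'\<in>words n UNIV. a m zs * k zs zs' * of_bool (dec zs' \<noteq> Some m))
        = (\<Sum>m\<in>{1..M}. \<Sum>zs\<in>words n UNIV. a m zs * of_bool (dec zs \<noteq> Some m))"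
      by (intro sum.cong refl) (simp only: mult.assoc sum_distrib_left [symmetric] sk)
    also have "\<dots> = (\<Sum>t\<in>{1..M} \<times> words n UNIV. marg \<Omega> Pr (\<lambda>w. (msg w, zwd w)) t * of_bool (dec (snd t) \<noteq> Some (fst t)))"
      unfolding sum_Times a_def by simp
    also have "\<dots> = (\<Sum>w\<in>\<Omega>. Pr w * of_bool (dec (snd (msg w, zwd w)) \<noteq> Some (fst (msg w, zwd w))))"
      by (rule sum_marg_mult[OF finite_\<Omega>]) (auto simp: \<Omega>_def)
    finally show ?thesis unfolding err_prob_eq by (simp add: msg_def zwd_def)
  qed
  moreover have "H (\<lambda>w. (msg w, zwd w)) = (\<Sum>m\<in>{1..M}. \<Sum>zs\<in>words n UNIV. ent (a m zs))"
    unfolding sum_Times [symmetric] a_def by (rule Hent_eq[OF finite_\<Omega>, of "{1..M} \<times> words n UNIV", unfolded sum_Times]) (auto simp: \<Omega>_def)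
  moreover have "H zwd = (\<Sum>zs\<in>words n UNIV. ent (\<Sum>m\<in>{1..M}. a m zs))"
  proof -
    have "marg \<Omega> Pr zwd zs = (\<Sum>m\<in>{1..M}. a m zs)" for zs
    proof -
      have "(\<Sum>m\<in>{1..M}. a m zs) = (\<Sum>m\<in>{1..M}. marg \<Omega> Pr (\<lambda>w. (zwd w, msg w)) (zs, m) * 1)"
        unfolding marg_def a_def by (intro sum.cong refl) (auto intro!: sum.cong)
      also have "\<dots> = marg \<Omega> Pr zwd zs"
        by (subst marg_pair_sum[OF finite_\<Omega> _ mim]) (simp_all add: marg_alt finite_\<Omega>)
      finally show ?thesis by simp
    qed
    moreover have "H zwd = (\<Sum>zs\<in>words n UNIV. ent (marg \<Omega> Pr zwd zs))"
      by (rule Hent_eq[OF finite_\<Omega> _ zim]) simp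
    ultimately show ?thesis by simp
  qed
  ultimately show ?thesis by simp
qed

end

text \<open>Time averaging. \<open>H(Y2|X1)\<close> is linear in the input law because the channel
  is fixed, so it averages exactly to \<open>D / n\<close>; the last coordinate averages linearly
  too. The entropies of \<open>Y2\<close> and \<open>Y3\<close> can only grow, by concavity.\<close>

lemma obj_average:
  fixes p2 :: "'x1::finite \<Rightarrow> 'y2::finite \<Rightarrow> real"
    and p3 :: "'x1 \<Rightarrow> 'x2::finite \<Rightarrow> 'y2 \<Rightarrow> 'y3::finite \<Rightarrow> real"
  assumes ch: "relay_channel p2 p3" and n: "n > 0"
    and v: "\<And>i. i < n \<Longrightarrow> v i \<in> convex hull letters p3"
    and q: "\<And>i x y. i < n \<Longrightarrow> fst (v i) $ (x, y) = px i x * p2 x y"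
  defines "V \<equiv> (\<Sum>i<n. (1 / real n) *\<^sub>R v i)"
    and "D \<equiv> \<Sum>i<n. \<Sum>x\<in>UNIV. px i x * (\<Sum>y\<in>UNIV. ent (p2 x y))"
  shows "V \<in> region p2 p3"
    and "(\<Sum>i<n. \<Sum>y\<in>UNIV. ent (\<Sum>x\<in>UNIV. px i x * p2 x y)) - D \<le> n * obj1 (fst V)"
    and "(\<Sum>i<n. \<Sum>z\<in>UNIV. ent (fst (snd (v i)) $ z)) - D + (\<Sum>i<n. snd (snd (v i))) \<le> n * obj2 V"
proof -
  have p2: "\<And>x y. 0 \<le> p2 x y" "\<And>x. (\<Sum>y\<in>UNIV. p2 x y) = 1" and p3: "\<And>x x2 y z. 0 \<le> p3 x x2 y z"
    using ch by (auto simp: relay_channel_def)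
  have nn: "0 \<le> fst (v i) $ j" "0 \<le> fst (snd (v i)) $ z" if "i < n" for i j z
    using hull_nonneg(1)[OF _ v[OF that]] hull_nonneg(2)[OF _ v[OF that]] p3 by blast+
  define pX where "pX x = (\<Sum>i<n. 1 / real n * px i x)" for x
  have sumpx: "(\<Sum>y\<in>UNIV. t * p2 x y) = t" for t x
    by (simp add: sum_distrib_left [symmetric] p2)
  have px0: "0 \<le> px i x" if "i < n" for i x
  proof -
    have "0 \<le> (\<Sum>y\<in>UNIV. fst (v i) $ (x, y))" using nn[OF that] by (intro sum_nonneg) auto
    then show ?thesis by (simp add: q[OF that] sumpx)
  qed
  have pX0: "0 \<le> pX x" for x unfolding pX_def using px0 by (intro sum_nonneg) auto
  have Vq: "fst V $ (x, y) = pX x * p2 x y" for x y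
    unfolding V_def pX_def by (simp add: fst_sum sum_distrib_right q)
  have Vr: "fst (snd V) $ z = (\<Sum>i<n. 1 / real n * fst (snd (v i)) $ z)" for z
    unfolding V_def by (simp add: fst_sum snd_sum)
  have Vh: "snd (snd V) = 1 / real n * (\<Sum>i<n. snd (snd (v i)))"
    unfolding V_def by (simp add: snd_sum sum_divide_distrib)
  have w1: "(\<Sum>i<n. 1 / real n) = 1" using n by simp
  have "V \<in> convex hull letters p3"
    unfolding V_def by (rule convex_sum) (use v w1 in auto)
  then show "V \<in> region p2 p3" by (simp add: region_def Vq sumpx)
  have Dn: "(\<Sum>x\<in>UNIV. pX x * (\<Sum>y\<in>UNIV. ent (p2 x y))) = 1 / real n * D"
  proof -
    have "(\<Sum>x\<in>UNIV. pX x * g x) = 1 / real n * (\<Sum>i<n. \<Sum>x\<in>UNIV. px i x * g x)" for g :: "'x1 \<Rightarrow> real"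
      unfolding pX_def sum_distrib_right sum_distrib_left by (subst sum.swap) (simp only: mult.assoc)
    then show ?thesis unfolding D_def .
  qed
  have entq: "(\<Sum>x\<in>UNIV. \<Sum>y\<in>UNIV. ent (fst V $ (x, y))) = (\<Sum>x\<in>UNIV. ent (pX x)) + 1 / real n * D"
    unfolding Vq ent_mult[OF pX0 p2(1)] Dn [symmetric]
    by (simp only: sum.distrib sum_distrib_left [symmetric] sum_distrib_right [symmetric] p2(2) mult_1)
  have jen: "(\<Sum>i<n. ent (g i)) \<le> n * ent (\<Sum>i<n. 1 / real n * g i)" if "\<And>i. i < n \<Longrightarrow> 0 \<le> g i" for g
  proof -
    have "(\<Sum>i<n. 1 / real n * ent (g i)) \<le> ent (\<Sum>i<n. 1 / real n * g i)"
      using that w1 by (intro ent_jensen) auto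
    then have "n * (\<Sum>i<n. 1 / real n * ent (g i)) \<le> n * ent (\<Sum>i<n. 1 / real n * g i)"
      by (intro mult_left_mono) auto
    moreover have "n * (\<Sum>i<n. 1 / real n * ent (g i)) = (\<Sum>i<n. ent (g i))"
      using n by (simp add: sum_distrib_left)
    ultimately show ?thesis by (simp only:)
  qed
  have o1: "obj1 (fst V) = (\<Sum>y\<in>UNIV. ent (\<Sum>x\<in>UNIV. pX x * p2 x y)) - 1 / real n * D"
    unfolding obj1_def entq unfolding Vq sumpx by simp
  have avg: "(\<Sum>x\<in>UNIV. pX x * p2 x y) = (\<Sum>i<n. 1 / real n * (\<Sum>x\<in>UNIV. px i x * p2 x y))" for y
    unfolding pX_def sum_distrib_right sum_distrib_left by (subst sum.swap) (simp only: mult.assoc)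
  have "(\<Sum>i<n. \<Sum>y\<in>UNIV. ent (\<Sum>x\<in>UNIV. px i x * p2 x y))
      \<le> (\<Sum>y\<in>UNIV. n * ent (\<Sum>x\<in>UNIV. pX x * p2 x y))"
    unfolding avg by (subst sum.swap) (intro sum_mono jen sum_nonneg mult_nonneg_nonneg px0 p2)
  then show "(\<Sum>i<n. \<Sum>y\<in>UNIV. ent (\<Sum>x\<in>UNIV. px i x * p2 x y)) - D \<le> n * obj1 (fst V)"
    unfolding o1 using n by (simp add: sum_distrib_left right_diff_distrib)
  have o2: "obj2 V = (\<Sum>z\<in>UNIV. ent (fst (snd V) $ z)) - 1 / real n * D + 1 / real n * (\<Sum>i<n. snd (snd (v i)))"
    unfolding obj2_def entq Vh unfolding Vq sumpx by simp
  have "(\<Sum>i<n. \<Sum>z\<in>UNIV. ent (fst (snd (v i)) $ z)) \<le> (\<Sum>z\<in>UNIV. n * ent (fst (snd V) $ z))"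
    unfolding Vr by (subst sum.swap) (intro sum_mono jen nn)
  then show "(\<Sum>i<n. \<Sum>z\<in>UNIV. ent (fst (snd (v i)) $ z)) - D + (\<Sum>i<n. snd (snd (v i))) \<le> n * obj2 V"
    unfolding o2 using n by (simp add: sum_distrib_left right_diff_distrib distrib_left)
qed

section \<open>The auxiliary variables of a code\<close>

context relay_code
begin

definition "U i = (\<lambda>w. (msg w, take i (zwd w), drop (Suc i) (ywd w)))"

definition "px i x = (\<Sum>m\<in>{1..M}. 1 / M * of_bool (enc m ! i = x))"

lemma sum_W_nth:
  assumes "i < n"
  shows "(\<Sum>ys\<in>words n UNIV. W m ys * of_bool (ys ! i = y)) = p2 (enc m ! i) y"
proof -
  have "(\<Sum>ys\<in>words n UNIV. W m ys * (1 * of_bool (ys ! i = y))) = (\<Sum>ys\<in>words n UNIV. W m ys * (1 * p2 (enc m ! i) y))"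
    unfolding W_def
    by (rule sum_words_take_nth[where G = "\<lambda>_. 1" and k = "\<lambda>i. p2 (enc m ! i)"]) (use assms p2 in auto)
  then show ?thesis by (simp only: mult_1 sum_distrib_right [symmetric] sum_W)
qed

lemma marg_ywd_nth:
  assumes "i < n"
  shows "marg \<Omega> Pr (\<lambda>w. ywd w ! i) y = (\<Sum>x\<in>UNIV. px i x * p2 x y)"
proof -
  have "marg \<Omega> Pr (\<lambda>w. ywd w ! i) y = (\<Sum>w\<in>\<Omega>. Pr w * of_bool (fst (snd w) ! i = y))"
    by (simp only: marg_alt[OF finite_\<Omega>] ywd_def)
  also have "\<dots> = (\<Sum>m\<in>{1..M}. 1 / M * p2 (enc m ! i) y)"
    by (subst sum_Pr_mult_my[where F = "\<lambda>m ys. of_bool (ys ! i = y)"]) (simp only: sum_W_nth[OF assms])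
  also have "\<dots> = (\<Sum>m\<in>{1..M}. \<Sum>x\<in>UNIV. 1 / M * of_bool (enc m ! i = x) * p2 x y)"
  proof (intro sum.cong refl)
    fix m
    have "(\<Sum>x\<in>UNIV. 1 / M * of_bool (enc m ! i = x) * p2 x y) = (\<Sum>x\<in>UNIV. if x = enc m ! i then 1 / M * p2 x y else 0)"
      by (intro sum.cong) auto
    then show "1 / M * p2 (enc m ! i) y = (\<Sum>x\<in>UNIV. 1 / M * of_bool (enc m ! i = x) * p2 x y)"
      by (simp add: sum.delta)
  qed
  also have "\<dots> = (\<Sum>x\<in>UNIV. px i x * p2 x y)"
    unfolding px_def sum_distrib_right by (rule sum.swap)
  finally show ?thesis .
qed

text \<open>\<open>U i\<close> is a function of the message, the relay's word and the receiver's
  past. Given these, the next receiver symbol follows the channel law by memorylessness, and the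
  sender's letter can be read off \<open>u\<close> because \<open>u\<close> contains the
  message.\<close>

lemma marg_U_zwd_nth:
  assumes i: "i < n"
  shows "marg \<Omega> Pr (\<lambda>w. (U i w, zwd w ! i)) (u, z)
    = (\<Sum>w\<in>\<Omega>. Pr w * of_bool (U i w = u) * p3 (enc (fst u) ! i) (rel i (ywd w)) (ywd w ! i) z)"
proof -
  obtain m0 t s where u: "u = (m0, t, s)" by (cases u)
  have "marg \<Omega> Pr (\<lambda>w. (U i w, zwd w ! i)) (u, z)
     = (\<Sum>w\<in>\<Omega>. Pr w * (of_bool (fst w = m0 \<and> drop (Suc i) (ywd w) = s) *
          (of_bool (take i (zwd w) = t) * of_bool (zwd w ! i = z))))"
    unfolding marg_alt[OF finite_\<Omega>] by (intro sum.cong refl) (auto simp: U_def u msg_def)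
  also have "\<dots> = (\<Sum>w\<in>\<Omega>. Pr w * (of_bool (fst w = m0 \<and> drop (Suc i) (ywd w) = s) *
          (of_bool (take i (zwd w) = t) * p3 (enc (fst w) ! i) (rel i (ywd w)) (ywd w ! i) z)))"
  proof -
    have "(\<Sum>zs\<in>words n UNIV. K m ys zs * (of_bool (take i zs = t) * of_bool (zs ! i = z)))
        = (\<Sum>zs\<in>words n UNIV. K m ys zs * (of_bool (take i zs = t) * p3 (enc m ! i) (rel i ys) (ys ! i) z))" for m ys
      unfolding K_def
      by (rule sum_words_take_nth[where G = "\<lambda>zs. of_bool (zs = t)" and k = "\<lambda>i. p3 (enc m ! i) (rel i ys) (ys ! i)"])
         (use i p3 in auto)
    then show ?thesis
      unfolding sum_Pr_mult fst_conv rv_simps mult.left_commute[of "K _ _ _"]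
      by (simp only: sum_distrib_left [symmetric])
  qed
  also have "\<dots> = (\<Sum>w\<in>\<Omega>. Pr w * of_bool (U i w = u) * p3 (enc (fst u) ! i) (rel i (ywd w)) (ywd w ! i) z)"
    by (intro sum.cong refl) (auto simp: U_def u msg_def)
  finally show ?thesis .
qed

text \<open>The relay symbol also depends on the observations before time \<open>i\<close>, which
  \<open>U i\<close> omits; given \<open>U i\<close> and the current observation it is still random.
  Hence its joint law \<open>b\<close> is passed to \<open>randomized_point\<close>.\<close>

lemma letter_point:
  assumes i: "i < n"
  shows "\<exists>v\<in>convex hull letters p3. (\<forall>x y. fst v $ (x, y) = px i x * p2 x y) \<and>
    (\<forall>z. fst (snd v) $ z = marg \<Omega> Pr (\<lambda>w. zwd w ! i) z) \<and>
    H (\<lambda>w. (U i w, ywd w ! i)) - H (\<lambda>w. (U i w, zwd w ! i)) \<le> snd (snd v)"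
proof -
  define A where "A = U i ` \<Omega>"
  define \<xi> where "\<xi> u = enc (fst u) ! i" for u :: "nat \<times> 'y3 list \<times> 'y2 list"
  define b where "b u y x = marg \<Omega> Pr (\<lambda>w. (U i w, (ywd w ! i, rel i (ywd w)))) (u, (y, x))" for u y x
  define a where "a u y = marg \<Omega> Pr (\<lambda>w. (U i w, ywd w ! i)) (u, y)" for u y
  define e where "e u z = marg \<Omega> Pr (\<lambda>w. (U i w, zwd w ! i)) (u, z)" for u z
  have finA: "finite A" by (simp add: A_def finite_\<Omega>)
  have "\<exists>v\<in>convex hull letters p3. (\<forall>x y. fst v $ (x, y) = (\<Sum>u\<in>A. of_bool (\<xi> u = x) * a u y)) \<and>
     (\<forall>z. fst (snd v) $ z = (\<Sum>u\<in>A. e u z)) \<and>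
     (\<Sum>u\<in>A. (\<Sum>y\<in>UNIV. ent (a u y)) - (\<Sum>z\<in>UNIV. ent (e u z))) \<le> snd (snd v)"
  proof (rule randomized_point[OF channel finA])
    show "0 \<le> b u y x" for u y x unfolding b_def using Pr_nonneg by (intro marg_nonneg)
    show "a u y = (\<Sum>x\<in>UNIV. b u y x)" for u y
    proof -
      have "(\<Sum>x\<in>UNIV. b u y x) = (\<Sum>x\<in>UNIV. marg \<Omega> Pr (\<lambda>w. ((U i w, ywd w ! i), rel i (ywd w))) ((u, y), x) * 1)"
        unfolding b_def marg_def by (intro sum.cong refl) (auto intro!: sum.cong)
      also have "\<dots> = a u y"
        unfolding a_def by (subst marg_pair_sum[OF finite_\<Omega>]) (simp_all add: marg_alt finite_\<Omega>)
      finally show ?thesis by simp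
    qed
    show "e u z = (\<Sum>y\<in>UNIV. \<Sum>x\<in>UNIV. b u y x * p3 (\<xi> u) x y z)" for u z
    proof -
      have "(\<Sum>y\<in>UNIV. \<Sum>x\<in>UNIV. b u y x * p3 (\<xi> u) x y z)
          = (\<Sum>t\<in>UNIV \<times> UNIV. marg \<Omega> Pr (\<lambda>w. (U i w, (ywd w ! i, rel i (ywd w)))) (u, t) * p3 (\<xi> u) (snd t) (fst t) z)"
        unfolding sum_Times b_def by simp
      also have "\<dots> = (\<Sum>w\<in>\<Omega>. Pr w * of_bool (U i w = u) * p3 (\<xi> u) (rel i (ywd w)) (ywd w ! i) z)"
        by (subst marg_pair_sum[OF finite_\<Omega>]) (simp_all only: finite fst_conv snd_conv, auto)
      finally show ?thesis unfolding e_def marg_U_zwd_nth[OF i] \<xi>_def by simp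
    qed
    have "(\<lambda>w. (U i w, ywd w ! i)) ` \<Omega> \<subseteq> A \<times> UNIV" by (auto simp: A_def)
    from sum_marg[OF finite_\<Omega> _ this, of Pr]
    have "(\<Sum>t\<in>A \<times> UNIV. marg \<Omega> Pr (\<lambda>w. (U i w, ywd w ! i)) t) = 1"
      using finA sum_Pr by simp
    then show "(\<Sum>u\<in>A. \<Sum>y\<in>UNIV. a u y) = 1" unfolding sum_Times a_def .
  qed
  then obtain v where v: "v \<in> convex hull letters p3"
    and q: "\<And>x y. fst v $ (x, y) = (\<Sum>u\<in>A. of_bool (\<xi> u = x) * a u y)"
    and r: "\<And>z. fst (snd v) $ z = (\<Sum>u\<in>A. e u z)"
    and h: "(\<Sum>u\<in>A. (\<Sum>y\<in>UNIV. ent (a u y)) - (\<Sum>z\<in>UNIV. ent (e u z))) \<le> snd (snd v)"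
    by blast
  have UA: "U i ` \<Omega> \<subseteq> A" by (simp add: A_def)
  have "fst v $ (x, y) = px i x * p2 x y" for x y
  proof -
    have "fst v $ (x, y) = (\<Sum>u\<in>A. marg \<Omega> Pr (\<lambda>w. (ywd w ! i, U i w)) (y, u) * of_bool (\<xi> u = x))"
    proof -
      have "a u y = marg \<Omega> Pr (\<lambda>w. (ywd w ! i, U i w)) (y, u)" for u
        unfolding a_def marg_def by (intro sum.cong) auto
      then show ?thesis unfolding q by (simp only: mult.commute)
    qed
    also have "\<dots> = (\<Sum>w\<in>\<Omega>. Pr w * of_bool (ywd w ! i = y) * of_bool (\<xi> (U i w) = x))"
      by (rule marg_pair_sum[OF finite_\<Omega> finA UA])
    also have "\<dots> = (\<Sum>w\<in>\<Omega>. Pr w * (of_bool (enc (fst w) ! i = x) * of_bool (fst (snd w) ! i = y)))"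
      by (intro sum.cong refl) (simp add: \<xi>_def U_def msg_def ywd_def)
    also have "\<dots> = (\<Sum>m\<in>{1..M}. 1 / M * (\<Sum>ys\<in>words n UNIV. W m ys * (of_bool (enc m ! i = x) * of_bool (ys ! i = y))))"
      by (rule sum_Pr_mult_my[where F = "\<lambda>m ys. of_bool (enc m ! i = x) * of_bool (ys ! i = y)"])
    also have "\<dots> = (\<Sum>m\<in>{1..M}. 1 / M * (of_bool (enc m ! i = x) * p2 (enc m ! i) y))"
      by (simp only: mult.left_commute[of "W _ _"] sum_distrib_left [symmetric] sum_W_nth[OF i])
    also have "\<dots> = (\<Sum>m\<in>{1..M}. 1 / M * of_bool (enc m ! i = x) * p2 x y)"
      by (intro sum.cong refl) auto
    finally show ?thesis by (simp only: px_def sum_distrib_right)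
  qed
  moreover have "fst (snd v) $ z = marg \<Omega> Pr (\<lambda>w. zwd w ! i) z" for z
  proof -
    have "fst (snd v) $ z = (\<Sum>u\<in>A. marg \<Omega> Pr (\<lambda>w. (zwd w ! i, U i w)) (z, u) * 1)"
      unfolding r e_def marg_def by (intro sum.cong refl) (auto intro!: sum.cong)
    also have "\<dots> = marg \<Omega> Pr (\<lambda>w. zwd w ! i) z"
      by (subst marg_pair_sum[OF finite_\<Omega> finA UA]) (simp add: marg_alt finite_\<Omega>)
    finally show ?thesis .
  qed
  moreover have "H (\<lambda>w. (U i w, ywd w ! i)) - H (\<lambda>w. (U i w, zwd w ! i)) \<le> snd (snd v)"
  proof -
    have *: "Hent \<Omega> Pr (\<lambda>w. (U i w, g w)) = (\<Sum>u\<in>A. \<Sum>y\<in>UNIV. ent (marg \<Omega> Pr (\<lambda>w. (U i w, g w)) (u, y)))"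
      for g :: "_ \<Rightarrow> 'c::finite"
    proof -
      have "(\<lambda>w. (U i w, g w)) ` \<Omega> \<subseteq> A \<times> UNIV" by (auto simp: A_def)
      from Hent_eq[OF finite_\<Omega> _ this, of Pr] finA show ?thesis by (simp add: sum_Times)
    qed
    show ?thesis using h unfolding * a_def e_def sum_subtractf .
  qed
  ultimately show ?thesis using v by blast
qed

theorem converse:
  assumes "degraded p3"
  shows "\<exists>v\<in>region p2 p3. (1 - err_prob p2 p3 n M enc rel dec) * log 2 M - 1 \<le> n * obj v"
proof -
  define good where "good i v \<longleftrightarrow> v \<in> convex hull letters p3 \<and> (\<forall>x y. fst v $ (x, y) = px i x * p2 x y) \<and>
    (\<forall>z. fst (snd v) $ z = marg \<Omega> Pr (\<lambda>w. zwd w ! i) z) \<and>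
    H (\<lambda>w. (U i w, ywd w ! i)) - H (\<lambda>w. (U i w, zwd w ! i)) \<le> snd (snd v)" for i v
  have "\<forall>i. \<exists>v. i < n \<longrightarrow> good i v"
    using letter_point unfolding good_def by blast
  then obtain v where good: "\<And>i. i < n \<Longrightarrow> good i (v i)" by metis
  have v: "v i \<in> convex hull letters p3"
    and q: "fst (v i) $ (x, y) = px i x * p2 x y"
    and r: "fst (snd (v i)) $ z = marg \<Omega> Pr (\<lambda>w. zwd w ! i) z"
    and h: "H (\<lambda>w. (U i w, ywd w ! i)) - H (\<lambda>w. (U i w, zwd w ! i)) \<le> snd (snd (v i))"
    if "i < n" for i x y z
    using good[OF that] unfolding good_def by blast+
  \<comment> \<open>One averaged point serves both bounds, so the minimum in \<open>obj\<close> is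
    bounded by a single choice of the auxiliary variable.\<close>
  define V where "V = (\<Sum>i<n. (1 / real n) *\<^sub>R v i)"
  define D where "D = (\<Sum>i<n. \<Sum>x\<in>UNIV. px i x * (\<Sum>y\<in>UNIV. ent (p2 x y)))"
  note avg = obj_average[where v = v and px = px, OF channel n v q, folded V_def D_def]
  have HD: "H (\<lambda>w. (msg w, ywd w)) = log 2 M + D"
  proof -
    have eq: "(\<Sum>m\<in>{1..M}. 1 / M * g (enc m ! i)) = (\<Sum>x\<in>UNIV. px i x * g x)" for i and g :: "'x1 \<Rightarrow> real"
    proof -
      have "(\<Sum>x\<in>UNIV. px i x * g x) = (\<Sum>m\<in>{1..M}. \<Sum>x\<in>UNIV. 1 / M * of_bool (enc m ! i = x) * g x)"
        unfolding px_def sum_distrib_right by (rule sum.swap)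
      also have "\<dots> = (\<Sum>m\<in>{1..M}. \<Sum>x\<in>UNIV. if x = enc m ! i then 1 / M * g x else 0)"
        by (intro sum.cong) auto
      finally show ?thesis by (simp add: sum.delta)
    qed
    show ?thesis unfolding H_msg_ywd D_def by (simp only: eq[of "\<lambda>x. \<Sum>y\<in>UNIV. ent (p2 x y)"])
  qed
  \<comment> \<open>Csiszar's sum identity appears here as a telescoping sum: \<open>T i\<close> is the entropy of the hybrid
    word made of the first \<open>i\<close> receiver symbols and the remaining relay observations.\<close>
  define T where "T i = H (\<lambda>w. (msg w, take i (zwd w), drop i (ywd w)))" for i
  have len: "length (zwd w) = n" "length (ywd w) = n" if "w \<in> \<Omega>" for w
    using that by (auto simp: \<Omega>_def words_def)
  have T1: "T i = H (\<lambda>w. (U i w, ywd w ! i))" if "i < n" for i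
    unfolding T_def U_def using that len by (intro Hent_recode) (auto simp: Cons_nth_drop_Suc [symmetric])
  have T2: "T (Suc i) = H (\<lambda>w. (U i w, zwd w ! i))" if "i < n" for i
    unfolding T_def U_def using that len by (intro Hent_recode) (auto simp: take_Suc_conv_app_nth)
  have "(\<Sum>i<n. T i - T (Suc i)) \<le> (\<Sum>i<n. snd (snd (v i)))"
    using h T1 T2 by (intro sum_mono) auto
  then have tele: "T 0 - T n \<le> (\<Sum>i<n. snd (snd (v i)))"
    by (simp add: sum_lessThan_telescope')
  have T0: "T 0 = H (\<lambda>w. (msg w, ywd w))"
    unfolding T_def by (rule Hent_recode) auto
  have Tn: "T n = H (\<lambda>w. (msg w, zwd w))"
    unfolding T_def by (rule Hent_recode) (use len in auto)
  have "H ywd \<le> (\<Sum>i<n. \<Sum>y\<in>UNIV. ent (\<Sum>x\<in>UNIV. px i x * p2 x y))"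
    using H_subadditive_ywd by (simp add: marg_ywd_nth)
  then have 1: "(1 - err_prob p2 p3 n M enc rel dec) * log 2 M - 1 \<le> n * obj1 (fst V)"
    using avg(2) fano_ywd[OF assms] HD by linarith
  have "H zwd \<le> (\<Sum>i<n. \<Sum>z\<in>UNIV. ent (fst (snd (v i)) $ z))"
    using H_subadditive_zwd by (simp add: r)
  \<comment> \<open>\<open>H(M,Y3^n)\<close> is replaced by \<open>H(M,Y2^n)\<close>, which is
    \<open>log 2 M + D\<close>, minus the telescoped sum. The two terms \<open>log 2 M\<close>
    cancel and the left side of the averaging bound for \<open>obj2\<close> remains.\<close>
  then have 2: "(1 - err_prob p2 p3 n M enc rel dec) * log 2 M - 1 \<le> n * obj2 V"
    using avg(3) fano_zwd HD tele T0 Tn by linarith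
  have "(1 - err_prob p2 p3 n M enc rel dec) * log 2 M - 1 \<le> n * obj V"
    using 1 2 by (simp add: obj_def min_def)
  then show ?thesis using avg(1) by blast
qed

end

text \<open>Dividing the converse by \<open>n\<close> turns the lost bit into \<open>1 / n\<close>,
  which vanishes together with the error probability. The bound holds for every positive
  \<open>n\<close>, so only the limit remains.\<close>

lemma achievable_le_max_rate:
  fixes p2 :: "'x1::finite \<Rightarrow> 'y2::finite \<Rightarrow> real"
    and p3 :: "'x1 \<Rightarrow> 'x2::finite \<Rightarrow> 'y2 \<Rightarrow> 'y3::finite \<Rightarrow> real"
  assumes ch: "relay_channel p2 p3" and deg: "degraded p3" and R: "achievable p2 p3 R"
    and C: "\<And>b. b \<in> rate_values p2 p3 \<Longrightarrow> b \<le> C"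
  shows "R \<le> C"
proof -
  obtain enc rel dec where lim: "(\<lambda>n. err_prob p2 p3 n (num_msgs R n) (enc n) (rel n) (dec n)) \<longlonglongrightarrow> 0"
    using R unfolding achievable_def by blast
  let ?e = "\<lambda>n. err_prob p2 p3 n (num_msgs R n) (enc n) (rel n) (dec n)"
  have "(1 - ?e n) * R - 1 / real n \<le> C" if n: "n > 0" for n
  proof -
    let ?M = "num_msgs R n"
    have le: "2 powr (real n * R) \<le> ?M" unfolding num_msgs_def by (rule real_nat_ceiling_ge)
    have "0 < 2 powr (real n * R)" by simp
    then have M: "?M > 0" using le by (intro gr0I) auto
    then have logM: "real n * R \<le> log 2 ?M" using le by (simp add: le_log_iff)
    interpret relay_code p2 p3 n ?M "enc n" "rel n" "dec n"
      using ch n M by unfold_locales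
    obtain v where "v \<in> region p2 p3" and v: "(1 - ?e n) * log 2 ?M - 1 \<le> n * obj v"
      using converse[OF deg] by blast
    then have "obj v \<le> C" using C region_point_is_rate[OF ch] by blast
    then have "real n * obj v \<le> n * C" by (intro mult_left_mono) auto
    moreover have "(1 - ?e n) * (real n * R) \<le> (1 - ?e n) * log 2 ?M"
      using err_prob_le_1 logM by (intro mult_left_mono) auto
    ultimately have "(1 - ?e n) * (real n * R) - 1 \<le> n * C" using v by linarith
    then show ?thesis using n by (simp add: field_simps)
  qed
  then have "eventually (\<lambda>n. (1 - ?e n) * R - 1 / real n \<le> C) sequentially"
    by (intro eventually_sequentiallyI[of 1]) auto
  moreover have "(\<lambda>n. (1 - ?e n) * R - 1 / real n) \<longlonglongrightarrow> (1 - 0) * R - 0"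
    by (intro tendsto_intros lim lim_1_over_n)
  ultimately show ?thesis
    using tendsto_upperbound[of "\<lambda>n. (1 - ?e n) * R - 1 / real n" "(1 - 0) * R - 0" sequentially C] by simp
qed

subsection \<open>Capacity\<close>

theorem theorem5:
  fixes p2 :: "'x1::finite \<Rightarrow> 'y2::finite \<Rightarrow> real"
    and p3 :: "'x1 \<Rightarrow> 'x2::finite \<Rightarrow> 'y2 \<Rightarrow> 'y3::finite \<Rightarrow> real"
  assumes "relay_channel p2 p3"
    and "degraded p3"
  shows "capacity p2 p3 \<in> rate_values p2 p3 \<and> (\<forall>v\<in>rate_values p2 p3. v \<le> capacity p2 p3)"
proof -
  obtain C where C: "C \<in> rate_values p2 p3" "\<And>b. b \<in> rate_values p2 p3 \<Longrightarrow> b \<le> C"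
    using rate_values_has_max[OF assms(1)] by blast
  have upper: "R \<le> C" if "achievable p2 p3 R" for R
    using achievable_le_max_rate[OF assms that] C(2) by blast
  have "capacity p2 p3 = C"
    unfolding capacity_def
  proof (rule antisym)
    show "Sup {R. achievable p2 p3 R} \<le> C"
      using achievable_0 upper by (intro cSup_least) auto
    have bdd: "bdd_above {R. achievable p2 p3 R}" using upper by (intro bdd_aboveI[of _ C]) auto
    show "C \<le> Sup {R. achievable p2 p3 R}"
    \<comment> \<open>Coding is available at positive rates only. A maximum that is not positive is
      covered by rate 0; otherwise all rates strictly between 0 and \<open>C\<close> are
      achievable.\<close>
    proof (cases "C \<le> 0")
      case True
      then show ?thesis using cSup_upper[OF _ bdd, of 0] achievable_0 by force
    next
      case False
      obtain Us px1 pu fx2 where in': "C = rate_expr p2 p3 Us px1 pu fx2" "admissible_input Us px1 pu"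
        using C(1) by (auto simp: rate_values_def)
      interpret relay_input p2 p3 Us px1 pu fx2 using assms(1) in' by unfold_locales
      show ?thesis
      proof (rule dense_le_bounded[of 0])
        show "0 < C" using False by simp
        fix R assume "0 < R" "R < C"
        then have "achievable p2 p3 R" using in' by (intro achievable_if_less_rate_expr) auto
        then show "R \<le> Sup {R. achievable p2 p3 R}" using bdd by (intro cSup_upper) auto
      qed
    qed
  qed
  then show ?thesis using C by blast
qed

end
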